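(* Let $\zeta$ be a primitive, aperiodic, self-similar and strongly totally non-Pisot substitution over an alphabet $\mathcal{A}=\{T_1,\dots,T_m\}$ of tiles of $\mathbb{R}^d$, and let $(\mathfrak{X}_\zeta,\mu,\phi)$ be the associated tiling dynamical system. There exist constants $r_0,c,\gamma>0$ depending only on the substitution $\zeta$ such that for every Lipschitz cylindrical function $f\in L^2(\mathfrak{X}_\zeta,\mu)$ with zero mean and every $\boldsymbol{\omega}\in\mathbb{R}^d$, $$\sigma_f(C^{\boldsymbol{\omega}}_r)\le c\,\|f\|_{\mathrm{Lip}}^2\,\log(1/r)^{-\gamma}\qquad\text{for all } 0<r<r_0 .$$
   Context: Tiles and tilings. A tile of $\mathbb{R}^d$ is a pair $T=(\mathrm{supp}(T),\mathrm{punc}(T))$, where $\mathrm{supp}(T)\subseteq\mathbb{R}^d$ is compact and the closure of its interior and $\mathrm{punc}(T)$ is a point of its interior; $T+\boldsymbol{s}$ is the tile with both components translated by $\boldsymbol{s}$. A patch is a finite set of tiles whose supports have pairwise disjoint interiors; a tiling is an infinite countable collection of tiles all of whose finite subcollections are patches and whose supports cover $\mathbb{R}^d$. Translation acts on patches and tilings tilewise. An alphabet $\mathcal{A}=\{T_1,\dots,T_m\}$ is a finite set of tiles, pairwise not translates of each other, with $\mathrm{punc}(T_j)=\boldsymbol{0}$ (the prototiles); $\mathcal{P}_{\mathcal{A}}$ is the set of patches consisting of translates of prototiles. All tilings considered consist of translates of prototiles and are assumed to have finite local complexity (finitely many two-tile patches up to translation). Substitutions. Let $L:\mathbb{R}^d\to\mathbb{R}^d$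 be linear and expansive (all eigenvalues outside the closed unit disk). A substitution with expansion $L$ is a map $\zeta:\mathcal{A}\to\mathcal{P}_{\mathcal{A}}$ with $\mathrm{supp}(\zeta(T))=L(\mathrm{supp}(T))$ for all $T\in\mathcal{A}$ (the support of a patch is the union of the supports of its tiles). It extends by $\zeta(T+\boldsymbol{s})=\zeta(T)+L\boldsymbol{s}$ and by unions to patches and tilings. The substitution matrix $\mathcal{S}_\zeta$ has $(i,j)$-entry the number of translates of $T_i$ in $\zeta(T_j)$; $\zeta$ is primitive if $\mathcal{S}_\zeta$ is primitive. $\mathfrak{X}_\zeta$ is the set of tilings all of whose patches are translates of sub-patches of $\zeta^n(T_j)$ for some $n\in\mathbb{N}$, $1\le j\le m$. $\zeta$ is aperiodic if for all $\boldsymbol{X}\in\mathfrak{X}_\zeta$, $\boldsymbol{X}-\boldsymbol{s}=\boldsymbol{X}$ only for $\boldsymbol{s}=\boldsymbol{0}$. $\zeta$ is self-affine if there is $\boldsymbol{X}\in\mathfrak{X}_\zeta$ with $\zeta(\boldsymbol{X})=\boldsymbol{X}$; it is self-similar if moreover $\|L\boldsymbol{x}\|=\lambda\|\boldsymbol{x}\|$ for all $\boldsymbol{x}\in\mathbb{R}^d$, for some $\lambda>1$. Dynamics. $\phi_{\boldsymbol{s}}(\boldsymbol{X})=\boldsymbol{X}-\boldsymbol{s}$ defines a continuous $\mathbb{R}^d$-action on $\mathfrak{X}_\zeta$, which is compact for the metric in which two tilings are close if they agree on a large ball around $\boldsymbol{0}$ up to a small translation; $\mu$ denotes the unique $\phi$-invariant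 Borel probability measure. Spectral measures. $e[x]=e^{2\pi i x}$. For $f\in L^2(\mathfrak{X}_\zeta,\mu)$, $\sigma_f$ is the positive finite Borel measure on $\mathbb{R}^d$ with $\int_{\mathbb{R}^d}e[-\boldsymbol{\omega}\cdot\boldsymbol{s}]\,d\sigma_f(\boldsymbol{\omega})=\langle f\circ\phi_{\boldsymbol{s}},f\rangle_{L^2(\mathfrak{X}_\zeta,\mu)}$ for all $\boldsymbol{s}\in\mathbb{R}^d$. $C^{\boldsymbol{\omega}}_r=[\omega_1-r,\omega_1+r]\times\dots\times[\omega_d-r,\omega_d+r]$. Cylindrical functions. $f:\mathfrak{X}_\zeta\to\mathbb{C}$ is cylindrical if it is integrable and there are integrable $\psi_i:\mathbb{R}^d\to\mathbb{C}$ ($1\le i\le m$) supported in $\mathrm{supp}(T_i)$ and vanishing on the boundary of $\mathrm{supp}(T_i)$, such that $f(\boldsymbol{X})=\psi_i(\boldsymbol{s})$ whenever $T_i-\boldsymbol{s}\in\boldsymbol{X}$ with $\boldsymbol{s}\in\mathrm{supp}(T_i)$ (i.e. $f$ depends only on the tile containing $\boldsymbol{0}$ and its position). $f$ is Lipschitz if all $\psi_i$ are Lipschitz, and $\|f\|_{\mathrm{Lip}}=\max_i\|\psi_i\|_{\mathrm{Lip}}$, where $\|g\|_{\mathrm{Lip}}=\|g\|_\infty+\inf\{s>0: |g(\boldsymbol{x})-g(\boldsymbol{y})|\le s|\boldsymbol{x}-\boldsymbol{y}|\ \forall \boldsymbol{x},\boldsymbol{y}\in\mathbb{R}^d\}$.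 Zero mean means $\int f\,d\mu=0$. Non-Pisot condition. Let $\Lambda$ be the set of eigenvalues of $L$ (assumed algebraic integers), decomposed as $\Lambda=\Lambda_1\cup\dots\cup\Lambda_p$ into classes sharing the same minimal polynomial. A finite set of algebraic integers outside the unit disk is a Pisot family if every Galois conjugate of its elements not belonging to the set has modulus $<1$; otherwise it is a non-Pisot family. $\Lambda$ is totally non-Pisot if every $\Lambda_i$ is a non-Pisot family. $\Lambda$ is strongly totally non-Pisot if it is totally non-Pisot and for every $i$ and every $\lambda\in\Lambda_i$ there is a Galois conjugate of $\lambda$ outside the closed unit disk that is not in $\Lambda_i$. $\zeta$ is strongly totally non-Pisot if $\Lambda$ is. *)

theory Defs
  imports
    "HOL-Probability.Probability"
    "HOL-Computational_Algebra.Polynomial"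
begin

section \<open>Tiles and tilings\<close>

type_synonym 'd tile = "(real^'d) set \<times> (real^'d)"

abbreviation tsupp :: "'d::finite tile \<Rightarrow> (real^'d) set" where "tsupp \<equiv> fst"
abbreviation punc :: "'d::finite tile \<Rightarrow> real^'d" where "punc \<equiv> snd"

definition tile :: "'d::finite tile \<Rightarrow> bool" where
  "tile t \<longleftrightarrow> compact (tsupp t) \<and> tsupp t = closure (interior (tsupp t)) \<and>
     punc t \<in> interior (tsupp t)"

definition shift :: "real^'d::finite \<Rightarrow> 'd tile \<Rightarrow> 'd tile" where
  "shift s t = ((\<lambda>x. x + s) ` tsupp t, punc t + s)"

definition patch :: "'d::finite tile set \<Rightarrow> bool" where
  "patch P \<longleftrightarrow> finite P \<and> (\<forall>t\<in>P. tile t) \<and>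
     (\<forall>t\<in>P. \<forall>t'\<in>P. t \<noteq> t' \<longrightarrow> interior (tsupp t) \<inter> interior (tsupp t') = {})"

definition psupp :: "'d::finite tile set \<Rightarrow> (real^'d) set" where
  "psupp P = (\<Union>t\<in>P. tsupp t)"

definition tiling :: "'d::finite tile set \<Rightarrow> bool" where
  "tiling X \<longleftrightarrow> infinite X \<and> countable X \<and> (\<forall>P\<subseteq>X. finite P \<longrightarrow> patch P) \<and> psupp X = UNIV"

text \<open>The prototiles are indexed by a finite type, so that the alphabet is
  the set \<open>range T\<close>.\<close>

definition alphabet :: "('m::finite \<Rightarrow> 'd::finite tile) \<Rightarrow> bool" where
  "alphabet T \<longleftrightarrow> (\<forall>i. tile (T i) \<and> punc (T i) = 0) \<and>
     (\<forall>i j s. T i = shift s (T j) \<longrightarrow> i = j)"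

definition over_alphabet :: "('m::finite \<Rightarrow> 'd::finite tile) \<Rightarrow> 'd tile set \<Rightarrow> bool" where
  "over_alphabet T X \<longleftrightarrow> (\<forall>t\<in>X. \<exists>i s. t = shift s (T i))"

text \<open>Finite local complexity. In an infinite tiling, pairs of arbitrarily distant tiles
  always give infinitely many translation classes; as usual, a two-tile patch here consists
  of two distinct tiles whose supports meet.\<close>

definition finite_local_complexity :: "'d::finite tile set \<Rightarrow> bool" where
  "finite_local_complexity X \<longleftrightarrow> (\<exists>F. finite F \<and>
     (\<forall>t\<in>X. \<forall>t'\<in>X. t \<noteq> t' \<and> tsupp t \<inter> tsupp t' \<noteq> {} \<longrightarrow>
        (\<exists>P\<in>F. \<exists>s. {t, t'} = shift s ` P)))"


section \<open>Eigenvalues and the non-Pisot condition\<close>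

definition complex_eigenvalues :: "(real^'d::finite \<Rightarrow> real^'d) \<Rightarrow> complex set" where
  "complex_eigenvalues L = {x. \<exists>v :: complex^'d. v \<noteq> 0 \<and>
     (\<chi> i j. complex_of_real (matrix L $ i $ j)) *v v = x *s v}"

definition expansive :: "(real^'d::finite \<Rightarrow> real^'d) \<Rightarrow> bool" where
  "expansive L \<longleftrightarrow> (\<forall>x\<in>complex_eigenvalues L. norm x > 1)"

definition is_minimal_poly :: "rat poly \<Rightarrow> complex \<Rightarrow> bool" where
  "is_minimal_poly p x \<longleftrightarrow> lead_coeff p = 1 \<and> poly (map_poly of_rat p) x = 0 \<and>
     (\<forall>q. q \<noteq> 0 \<and> poly (map_poly of_rat q) x = 0 \<longrightarrow> degree p \<le> degree q)"

definition galois_conjugates :: "complex \<Rightarrow> complex set" where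
  "galois_conjugates x = {y. \<exists>p. is_minimal_poly p x \<and> poly (map_poly of_rat p) y = 0}"

definition minimal_poly_classes :: "complex set \<Rightarrow> complex set set" where
  "minimal_poly_classes A =
     A // {(x, y) \<in> A \<times> A. \<exists>p. is_minimal_poly p x \<and> is_minimal_poly p y}"

definition expanding_algebraic_integers :: "complex set \<Rightarrow> bool" where
  "expanding_algebraic_integers F \<longleftrightarrow> finite F \<and> (\<forall>x\<in>F. algebraic_int x \<and> norm x > 1)"

definition pisot_family :: "complex set \<Rightarrow> bool" where
  "pisot_family F \<longleftrightarrow> expanding_algebraic_integers F \<and>
     (\<forall>x\<in>F. \<forall>y\<in>galois_conjugates x. y \<notin> F \<longrightarrow> norm y < 1)"

definition non_pisot_family :: "complex set \<Rightarrow> bool" where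
  "non_pisot_family F \<longleftrightarrow> expanding_algebraic_integers F \<and> \<not> pisot_family F"

definition totally_non_pisot :: "complex set \<Rightarrow> bool" where
  "totally_non_pisot A \<longleftrightarrow> (\<forall>C\<in>minimal_poly_classes A. non_pisot_family C)"

definition strongly_totally_non_pisot :: "complex set \<Rightarrow> bool" where
  "strongly_totally_non_pisot A \<longleftrightarrow> totally_non_pisot A \<and>
     (\<forall>C\<in>minimal_poly_classes A. \<forall>x\<in>C. \<exists>y\<in>galois_conjugates x. norm y > 1 \<and> y \<notin> C)"


section \<open>Substitutions\<close>

definition substitution ::
  "('m::finite \<Rightarrow> 'd::finite tile) \<Rightarrow> ('m \<Rightarrow> 'd tile set) \<Rightarrow> (real^'d \<Rightarrow> real^'d) \<Rightarrow> bool" where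
  "substitution T \<zeta> L \<longleftrightarrow> linear L \<and> expansive L \<and>
     (\<forall>i. patch (\<zeta> i) \<and> over_alphabet T (\<zeta> i) \<and> psupp (\<zeta> i) = L ` tsupp (T i))"

text \<open>The extension of the substitution to sets of translated prototiles,
  from \<open>\<zeta>(T\<^sub>i + s) = \<zeta>(T\<^sub>i) + L s\<close>.\<close>

definition subst_ext ::
  "('m::finite \<Rightarrow> 'd::finite tile) \<Rightarrow> ('m \<Rightarrow> 'd tile set) \<Rightarrow> (real^'d \<Rightarrow> real^'d) \<Rightarrow>
     'd tile set \<Rightarrow> 'd tile set" where
  "subst_ext T \<zeta> L X = (\<Union>(i, s) \<in> {(i, s). shift s (T i) \<in> X}. shift (L s) ` \<zeta> i)"

definition substitution_matrix ::
  "('m::finite \<Rightarrow> 'd::finite tile) \<Rightarrow> ('m \<Rightarrow> 'd tile set) \<Rightarrow> nat^'m^'m" where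
  "substitution_matrix T \<zeta> = (\<chi> i j. card {t \<in> \<zeta> j. \<exists>s. t = shift s (T i)})"

definition primitive_matrix :: "nat^'m^'m::finite \<Rightarrow> bool" where
  "primitive_matrix M \<longleftrightarrow> (\<exists>k>0. \<forall>i j. (((**) M ^^ k) (mat 1)) $ i $ j > 0)"

definition tiling_space ::
  "('m::finite \<Rightarrow> 'd::finite tile) \<Rightarrow> ('m \<Rightarrow> 'd tile set) \<Rightarrow> (real^'d \<Rightarrow> real^'d) \<Rightarrow>
     'd tile set set" where
  "tiling_space T \<zeta> L = {X. tiling X \<and> over_alphabet T X \<and>
     (\<forall>P\<subseteq>X. finite P \<longrightarrow> (\<exists>n j s. shift s ` P \<subseteq> (subst_ext T \<zeta> L ^^ n) {T j}))}"

text \<open>The action \<open>\<phi>\<^sub>s(X) = X - s\<close>.\<close>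

definition action :: "real^'d::finite \<Rightarrow> 'd tile set \<Rightarrow> 'd tile set" where
  "action s X = shift (- s) ` X"

definition aperiodic ::
  "('m::finite \<Rightarrow> 'd::finite tile) \<Rightarrow> ('m \<Rightarrow> 'd tile set) \<Rightarrow> (real^'d \<Rightarrow> real^'d) \<Rightarrow> bool" where
  "aperiodic T \<zeta> L \<longleftrightarrow> (\<forall>X\<in>tiling_space T \<zeta> L. \<forall>s. action s X = X \<longrightarrow> s = 0)"

definition self_affine ::
  "('m::finite \<Rightarrow> 'd::finite tile) \<Rightarrow> ('m \<Rightarrow> 'd tile set) \<Rightarrow> (real^'d \<Rightarrow> real^'d) \<Rightarrow> bool" where
  "self_affine T \<zeta> L \<longleftrightarrow> (\<exists>X\<in>tiling_space T \<zeta> L. subst_ext T \<zeta> L X = X)"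

definition self_similar ::
  "('m::finite \<Rightarrow> 'd::finite tile) \<Rightarrow> ('m \<Rightarrow> 'd tile set) \<Rightarrow> (real^'d \<Rightarrow> real^'d) \<Rightarrow> bool" where
  "self_similar T \<zeta> L \<longleftrightarrow> self_affine T \<zeta> L \<and> (\<exists>c>1. \<forall>x. norm (L x) = c * norm x)"


section \<open>The tiling dynamical system\<close>

text \<open>The tiling metric: two tilings have distance less than \<open>\<epsilon>\<close> (for small \<open>\<epsilon>\<close>) if, after
  translating each by less than \<open>\<epsilon>\<close>, the same tiles meet the ball of radius \<open>1 / \<epsilon>\<close> about 0.
  The cut-off \<open>1 / sqrt 2\<close> makes the triangle inequality hold.\<close>

definition agree_on :: "(real^'d::finite) set \<Rightarrow> 'd tile set \<Rightarrow> 'd tile set \<Rightarrow> bool" where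
  "agree_on B X Y \<longleftrightarrow> {t\<in>X. tsupp t \<inter> B \<noteq> {}} = {t\<in>Y. tsupp t \<inter> B \<noteq> {}}"

definition tiling_dist :: "'d::finite tile set \<Rightarrow> 'd tile set \<Rightarrow> real" where
  "tiling_dist X Y = Inf (insert (1 / sqrt 2)
     {\<epsilon>. \<epsilon> > 0 \<and> (\<exists>s t. norm s < \<epsilon> \<and> norm t < \<epsilon> \<and>
              agree_on (cball 0 (1 / \<epsilon>)) (action s X) (action t Y))})"

definition tiling_borel ::
  "('m::finite \<Rightarrow> 'd::finite tile) \<Rightarrow> ('m \<Rightarrow> 'd tile set) \<Rightarrow> (real^'d \<Rightarrow> real^'d) \<Rightarrow>
     'd tile set measure" where
  "tiling_borel T \<zeta> L = sigma (tiling_space T \<zeta> L)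
     {U. openin (Metric_space.mtopology (tiling_space T \<zeta> L) tiling_dist) U}"

definition invariant_probability ::
  "('m::finite \<Rightarrow> 'd::finite tile) \<Rightarrow> ('m \<Rightarrow> 'd tile set) \<Rightarrow> (real^'d \<Rightarrow> real^'d) \<Rightarrow>
     'd tile set measure \<Rightarrow> bool" where
  "invariant_probability T \<zeta> L \<mu> \<longleftrightarrow> prob_space \<mu> \<and>
     space \<mu> = tiling_space T \<zeta> L \<and> sets \<mu> = sets (tiling_borel T \<zeta> L) \<and>
     (\<forall>s. action s \<in> measurable \<mu> \<mu> \<and> distr \<mu> \<mu> (action s) = \<mu>)"


section \<open>Spectral measures\<close>

definition square_integrable :: "'a measure \<Rightarrow> ('a \<Rightarrow> complex) \<Rightarrow> bool" where
  "square_integrable M f \<longleftrightarrow> f \<in> borel_measurable M \<and> integrable M (\<lambda>x. (norm (f x))\<^sup>2)"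

definition e_char :: "real \<Rightarrow> complex" where
  "e_char x = exp (2 * of_real pi * \<i> * of_real x)"

definition spectral_measure ::
  "'d::finite tile set measure \<Rightarrow> ('d tile set \<Rightarrow> complex) \<Rightarrow> (real^'d) measure \<Rightarrow> bool" where
  "spectral_measure \<mu> f \<sigma> \<longleftrightarrow> finite_measure \<sigma> \<and> sets \<sigma> = sets borel \<and>
     (\<forall>s. (LINT \<omega>|\<sigma>. e_char (- (\<omega> \<bullet> s))) = (LINT X|\<mu>. f (action s X) * cnj (f X)))"

definition cube :: "real^'d::finite \<Rightarrow> real \<Rightarrow> (real^'d) set" where
  "cube \<omega> r = cbox (\<chi> i. \<omega> $ i - r) (\<chi> i. \<omega> $ i + r)"


section \<open>Cylindrical functions\<close>

text \<open>\<open>f\<close> is cylindrical with profile \<open>\<psi>\<close>. For a primitive self-affine substitution every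
  prototile occurs in the tiling space, so \<open>f\<close> determines \<open>\<psi>\<close>.\<close>

definition cylindrical ::
  "('m::finite \<Rightarrow> 'd::finite tile) \<Rightarrow> 'd tile set measure \<Rightarrow> ('d tile set \<Rightarrow> complex) \<Rightarrow>
     ('m \<Rightarrow> real^'d \<Rightarrow> complex) \<Rightarrow> bool" where
  "cylindrical T \<mu> f \<psi> \<longleftrightarrow> integrable \<mu> f \<and>
     (\<forall>i. integrable lebesgue (\<psi> i) \<and>
        (\<forall>x. x \<notin> tsupp (T i) \<longrightarrow> \<psi> i x = 0) \<and> (\<forall>x\<in>frontier (tsupp (T i)). \<psi> i x = 0)) \<and>
     (\<forall>X\<in>space \<mu>. \<forall>i s. shift (- s) (T i) \<in> X \<and> s \<in> tsupp (T i) \<longrightarrow> f X = \<psi> i s)"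

definition lip_norm :: "(real^'d::finite \<Rightarrow> complex) \<Rightarrow> real" where
  "lip_norm g = (SUP x. norm (g x)) +
     Inf {s. s > 0 \<and> (\<forall>x y. norm (g x - g y) \<le> s * norm (x - y))}"

definition cyl_lip_norm :: "('m::finite \<Rightarrow> real^'d::finite \<Rightarrow> complex) \<Rightarrow> real" where
  "cyl_lip_norm \<psi> = Max (range (\<lambda>i. lip_norm (\<psi> i)))"

end

theory Submission
  imports
    Defs
    "HOL-Computational_Algebra.Fundamental_Theorem_Algebra"
    "HOL-Real_Asymp.Real_Asymp"
begin

text \<open>
  A spectral measure is controlled by ergodic integrals: if \<open>R\<close> is a small multiple of \<open>1 / r\<close>, the phase
  \<open>e((\<omega> - \<eta>) \<bullet> x)\<close> hardly varies for \<open>x\<close> in the ball of radius \<open>R\<close> and \<open>\<eta>\<close> in the cube of side \<open>2 r\<close> about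
  \<open>\<omega>\<close>, so \<open>\<sigma>\<close> of this cube is at most a constant times the square of the supremum over the hull of the
  normalized integral of \<open>e(\<omega> \<bullet> x) f(X - x)\<close> over that ball (\<open>spectral_measure_cube_from_balls\<close>). Riemann
  sums turn the integral into a finite sum of translates of \<open>f\<close>, to which the defining identity of \<open>\<sigma>\<close>
  applies directly.

  On the ball, a tiling of the hull agrees with a translate of some \<open>\<zeta> ^ N (T j)\<close>, which splits into
  supertiles \<open>\<zeta> ^ n (T i)\<close> with \<open>c ^ n\<close> much smaller than \<open>R\<close>; those that meet the boundary of the ball are
  negligible. The integral over a supertile is a twisted sum over its tiles, and the twisted sums of
  level \<open>n + k\<close> are combinations of those of level \<open>n\<close> with phases \<open>e(\<omega> \<bullet> L ^ n p)\<close>. Hence they are bounded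
  by the number of tiles times a constant that does not increase with \<open>n\<close>, and this constant drops by
  a factor \<open>\<theta> < 1\<close> whenever \<open>\<omega> \<bullet> L ^ n v\<close> is far from the integers for one of finitely many spanning
  return vectors \<open>v\<close>, because then two copies of one supertile partly cancel
  (\<open>twisted_bound_contract\<close>).

  The non-Pisot condition makes such \<open>n\<close> frequent (\<open>exists_far_from_integers\<close>). The numbers
  \<open>\<omega> \<bullet> L ^ n v\<close> satisfy a linear recurrence with integer characteristic polynomial \<open>P\<close> whose roots are the
  eigenvalues of \<open>L\<close> and their Galois conjugates. While they stay close to integers \<open>K n\<close>, the integers
  satisfy the same recurrence. For a conjugate \<open>y\<close> outside the closed unit disk that is not an
  eigenvalue, applying \<open>P / (X - y)\<close> in the shift kills the orbit and maps \<open>K\<close> to a bounded sequence which is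
  geometric of ratio \<open>y\<close>; its first term is the value at \<open>y\<close> of an integer polynomial of height at most a
  multiple of \<open>|\<omega>|\<close>. By a Liouville inequality it vanishes as soon as the window is longer than a
  multiple of \<open>1 + log |\<omega>|\<close>. If this happens for one conjugate of every eigenvalue, then \<open>K 0 = 0\<close>, and \<open>\<omega>\<close> is
  small. Since \<open>|L ^ n \<omega>|\<close> grows like \<open>c ^ n\<close>, the windows form a geometric progression, so there are about
  \<open>log n\<close> of them up to level \<open>n\<close>; with \<open>n\<close> of order \<open>log (1 / r)\<close> this gives a power of \<open>log (1 / r)\<close>.

  This works if \<open>|\<omega>|\<close> lies between \<open>r ^ (1 / 4)\<close> and \<open>log (1 / r)\<close>, up to constants
  (\<open>middle_frequencies\<close>). Below, the cube lies in a slightly larger cube about 0, and at frequency 0 the averages over supertiles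
  converge exponentially fast to a common limit, which is 0 since \<open>f\<close> has mean zero
  (\<open>small_frequencies\<close>). Above, \<open>f\<close> is Lipschitz along orbits, so \<open>\<sigma>\<close> decays like \<open>|\<omega>| ^ (- 2)\<close>
  (\<open>large_frequencies\<close>).
\<close>

section \<open>Evaluating integer and rational polynomials at complex numbers\<close>

abbreviation ipoly :: "int poly \<Rightarrow> complex \<Rightarrow> complex" where
  "ipoly q y \<equiv> poly (map_poly of_int q) y"

abbreviation rpoly :: "rat poly \<Rightarrow> complex \<Rightarrow> complex" where
  "rpoly q y \<equiv> poly (map_poly of_rat q) y"

lemma poly_map_poly_add:
  fixes h :: "'a::comm_ring_1 \<Rightarrow> 'b::comm_ring_1"
  assumes "h 0 = 0" "\<And>a b. h (a + b) = h a + h b"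
  shows "poly (map_poly h (p + q)) y = poly (map_poly h p) y + poly (map_poly h q) y"
proof -
  have "map_poly h (p + q) = map_poly h p + map_poly h q"
    by (rule poly_eqI) (simp add: coeff_map_poly assms)
  thus ?thesis by simp
qed

lemma poly_map_poly_mult:
  fixes h :: "'a::comm_ring_1 \<Rightarrow> 'b::comm_ring_1"
  assumes h: "h 0 = 0" "\<And>a b. h (a + b) = h a + h b" "\<And>a b. h (a * b) = h a * h b"
  shows "poly (map_poly h (p * q)) y = poly (map_poly h p) y * poly (map_poly h q) y"
proof (induction p)
  case 0
  thus ?case by simp
next
  case (pCons a p)
  have sm: "poly (map_poly h (smult a q)) y = h a * poly (map_poly h q) y"
    by (simp add: map_poly_smult h)
  have pc: "poly (map_poly h (pCons b r)) y = h b + y * poly (map_poly h r) y" for b r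
    by (cases "r = 0 \<and> b = 0") (auto simp: map_poly_pCons h)
  show ?case
    by (simp add: poly_map_poly_add[OF h(1,2)] sm pc pCons.IH h(1) algebra_simps)
qed

lemma ipoly_simps [simp]:
  "ipoly (p + q) y = ipoly p y + ipoly q y"
  "ipoly (p - q) y = ipoly p y - ipoly q y"
  "ipoly (p * q) y = ipoly p y * ipoly q y"
  "ipoly (monom c n) y = of_int c * y ^ n"
  "ipoly (smult c p) y = of_int c * ipoly p y"
proof -
  show a: "ipoly (p + q) y = ipoly p y + ipoly q y" for p q
    by (rule poly_map_poly_add) auto
  have "ipoly p y = ipoly (p - q) y + ipoly q y" using a[of "p - q" q] by simp
  thus "ipoly (p - q) y = ipoly p y - ipoly q y" by simp
  show "ipoly (p * q) y = ipoly p y * ipoly q y"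
    by (rule poly_map_poly_mult) auto
  show "ipoly (monom c n) y = of_int c * y ^ n" by (simp add: map_poly_monom poly_monom)
  show "ipoly (smult c p) y = of_int c * ipoly p y" by (simp add: map_poly_smult)
qed

lemma ipoly_sum [simp]: "ipoly (sum f A) y = (\<Sum>i\<in>A. ipoly (f i) y)"
  by (induction A rule: infinite_finite_induct) (auto simp: ipoly_simps(1))

lemma rpoly_add: "rpoly (p + q) y = rpoly p y + rpoly q y"
  by (rule poly_map_poly_add) (auto simp: of_rat_add)

lemma rpoly_mult: "rpoly (p * q) y = rpoly p y * rpoly q y"
  by (rule poly_map_poly_mult) (auto simp: of_rat_add of_rat_mult)

lemma rpoly_1: "rpoly 1 y = 1"
  by (simp add: map_poly_1)

lemma rpoly_prod: "rpoly (prod f A) y = (\<Prod>i\<in>A. rpoly (f i) y)"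
  by (induction A rule: infinite_finite_induct) (auto simp: rpoly_mult rpoly_1)

lemma ipoly_altdef: "ipoly q y = (\<Sum>k\<le>degree q. of_int (coeff q k) * y ^ k)"
  by (simp add: poly_altdef degree_map_poly coeff_map_poly)

section \<open>A Liouville inequality\<close>

text \<open>Euclid's algorithm with pseudo-remainders: one step at most squares the height, up to a factor 2,
  and lowers the degree. After a number of steps bounded by the degrees a nonzero integer constant
  is reached, and it is a combination of the two initial values whose coefficients are polynomial
  in the height.\<close>

lemma ipoly_pair_lower_bound:
  "\<exists>c>0. \<exists>e::nat. \<forall>a b. \<forall>H::int. degree a + degree b \<le> d \<and> 1 \<le> H \<and>
     (\<forall>k. \<bar>coeff a k\<bar> \<le> H) \<and> (\<forall>k. \<bar>coeff b k\<bar> \<le> H) \<and> \<not> (\<exists>z. ipoly a z = 0 \<and> ipoly b z = 0) \<longrightarrow>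
     c / of_int H ^ e \<le> max (norm (ipoly a y)) (norm (ipoly b y))"
proof (induction d)
  case 0
  show ?case
  proof (rule exI[of _ 1], rule conjI, simp, rule exI[of _ 0], intro allI impI, elim conjE)
    fix a b H
    assume *: "degree a + degree b \<le> 0" and nr: "\<not> (\<exists>z. ipoly a z = 0 \<and> ipoly b z = 0)"
    from * obtain u v where ab: "a = [:u:]" "b = [:v:]"
      by (metis add_is_0 degree_eq_zeroE le_zero_eq)
    have n: "norm (of_int w :: complex) \<ge> 1" if "w \<noteq> 0" for w
      using that by (simp add: linorder_not_less)
    have ev: "ipoly [:w:] z = of_int w" for w z by (cases "w = 0") (simp_all add: map_poly_pCons)
    have "u \<noteq> 0 \<or> v \<noteq> 0" using nr ab by (auto simp: ev)
    thus "1 / of_int H ^ 0 \<le> max (norm (ipoly a y)) (norm (ipoly b y))"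
      unfolding ab ev le_max_iff_disj using n[of u] n[of v] by auto
  qed
next
  case (Suc d)
  then obtain c e where c: "c > 0" and IH: "\<And>a b H. degree a + degree b \<le> d \<Longrightarrow> 1 \<le> H \<Longrightarrow>
     (\<forall>k. \<bar>coeff a k\<bar> \<le> H) \<Longrightarrow> (\<forall>k. \<bar>coeff b k\<bar> \<le> H) \<Longrightarrow> \<not> (\<exists>z. ipoly a z = 0 \<and> ipoly b z = 0) \<Longrightarrow>
     c / of_int H ^ e \<le> max (norm (ipoly a y)) (norm (ipoly b y))" by blast
  define Y where "Y = max 1 (norm y) ^ Suc d"
  have Y1: "Y \<ge> 1" unfolding Y_def by (intro one_le_power) auto
  (* the minimum with 1 covers the cases in which a nonzero constant is met at once *)
  define c' where "c' = min 1 (c / (2 ^ e * (2 * Y)))"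
  have c': "c' > 0" using c Y1 by (simp add: c'_def)
  have main: "c' / of_int H ^ (2 * e + 1) \<le> max (norm (ipoly a y)) (norm (ipoly b y))"
    if ds: "degree a + degree b \<le> Suc d" and H: "1 \<le> H" and ha: "\<forall>k. \<bar>coeff a k\<bar> \<le> H"
      and hb: "\<forall>k. \<bar>coeff b k\<bar> \<le> H" and nr: "\<not> (\<exists>z. ipoly a z = 0 \<and> ipoly b z = 0)"
      and le: "degree b \<le> degree a" for a b H
  proof -
    have H1: "(of_int H :: real) \<ge> 1" using H by simp
    have small: "c' / of_int H ^ (2 * e + 1) \<le> 1"
    proof -
      have "c' \<le> 1" by (simp add: c'_def)
      also have "(1::real) \<le> of_int H ^ (2 * e + 1)" using H1 by (intro one_le_power)
      finally show ?thesis using H1 by (simp add: field_simps)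
    qed
    consider "degree a = 0" | "degree a > 0" "b = 0" | "degree a > 0" "b \<noteq> 0" "degree b = 0"
      | "degree a > 0" "degree b > 0" by linarith
    thus ?thesis
    proof cases
      case 1
      with le obtain u v where ab: "a = [:u:]" "b = [:v:]"
        by (metis degree_eq_zeroE le_zero_eq)
      have n: "norm (of_int w :: complex) \<ge> 1" if "w \<noteq> 0" for w
        using that by (simp add: linorder_not_less)
      have ev: "ipoly [:w:] z = of_int w" for w z by (cases "w = 0") (simp_all add: map_poly_pCons)
      have "u \<noteq> 0 \<or> v \<noteq> 0" using nr ab by (auto simp: ev)
      thus ?thesis using small n[of u] n[of v]
        unfolding ab ev le_max_iff_disj by force
    next
      case 2
      have "degree (map_poly of_int a :: complex poly) = degree a" by (simp add: degree_map_poly)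
      with 2 have "\<not> constant (poly (map_poly of_int a :: complex poly))"
        by (simp add: constant_degree)
      then obtain z where "ipoly a z = 0" using fundamental_theorem_of_algebra by blast
      with 2 nr have False by auto
      thus ?thesis ..
    next
      case 3
      then obtain v where b: "b = [:v:]" "v \<noteq> 0" by (metis degree_eq_zeroE pCons_0_0)
      have "norm (of_int v :: complex) \<ge> 1"
        using b by (simp add: linorder_not_less)
      moreover have "ipoly b y = of_int v" using b by (simp add: map_poly_pCons)
      ultimately show ?thesis using small by simp
    next
      case 4
      define k where "k = degree a - degree b"
      define a' where "a' = smult (lead_coeff b) a - monom (lead_coeff a) k * b"
      have lb: "lead_coeff b \<noteq> 0" using 4 by auto
      have dk: "degree a = k + degree b" using le by (simp add: k_def)
      have deg: "degree a' < degree a"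
      proof -
        have "degree a' \<le> degree a" unfolding a'_def
        proof (intro degree_diff_le)
          show "degree (monom (lead_coeff a) k * b) \<le> degree a"
            by (rule order_trans[OF degree_mult_le]) (use dk degree_monom_le[of "lead_coeff a" k] in linarith)
        qed simp
        moreover have "coeff a' (degree a) = 0"
          by (simp add: a'_def coeff_monom_mult dk)
        ultimately show ?thesis using 4(1)
          by (metis coeff_0 degree_0 le_neq_implies_less leading_coeff_0_iff)
      qed
      have H2: "1 \<le> 2 * H\<^sup>2" using one_le_power[OF H, of 2] by linarith
      have "\<bar>coeff a' n\<bar> \<le> 2 * H\<^sup>2" for n
      proof -
        have "\<bar>coeff a' n\<bar> \<le> \<bar>lead_coeff b * coeff a n\<bar> + \<bar>lead_coeff a\<bar> * \<bar>if n < k then 0 else coeff b (n - k)\<bar>"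
          unfolding a'_def coeff_diff coeff_smult coeff_monom_mult abs_mult[symmetric] by auto
        also have "\<dots> \<le> H * H + H * H"
          unfolding abs_mult using ha hb H by (intro add_mono mult_mono) auto
        finally show ?thesis by (simp add: power2_eq_square)
      qed
      moreover have "\<bar>coeff b n\<bar> \<le> 2 * H\<^sup>2" for n
      proof -
        have "H * 1 \<le> H * H" using H by (intro mult_left_mono) auto
        with hb[rule_format, of n] show ?thesis by (auto simp: power2_eq_square)
      qed
      moreover have "\<not> (\<exists>z. ipoly a' z = 0 \<and> ipoly b z = 0)"
      proof
        assume "\<exists>z. ipoly a' z = 0 \<and> ipoly b z = 0"
        then obtain z where z: "ipoly a' z = 0" "ipoly b z = 0" by blast
        then have "of_int (lead_coeff b) * ipoly a z = 0" by (simp add: a'_def)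
        with lb z nr show False by auto
      qed
      ultimately have lower: "c / of_int (2 * H\<^sup>2) ^ e \<le> max (norm (ipoly a' y)) (norm (ipoly b y))"
        using deg ds H2 by (intro IH) auto
      define m where "m = max (norm (ipoly a y)) (norm (ipoly b y))"
      have m0: "0 \<le> m" by (simp add: m_def le_max_iff_disj)
      have yk: "norm y ^ k \<le> Y"
      proof -
        have "norm y ^ k \<le> max 1 (norm y) ^ k" by (intro power_mono) auto
        also have "\<dots> \<le> Y" unfolding Y_def using ds dk by (intro power_increasing) auto
        finally show ?thesis .
      qed
      have nlc: "norm (of_int w :: complex) \<le> of_int H" if "\<bar>w\<bar> \<le> H" for w
        using that by (metis norm_of_int of_int_abs of_int_le_iff)
      have "norm (ipoly a' y) \<le> of_int H * m + (of_int H * Y) * m"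
      proof -
        have "norm (ipoly a' y) \<le> norm (of_int (lead_coeff b) * ipoly a y) +
            norm (of_int (lead_coeff a) * y ^ k * ipoly b y)"
          by (simp only: a'_def ipoly_simps) (rule norm_triangle_ineq4)
        also have "\<dots> \<le> of_int H * m + (of_int H * Y) * m"
          unfolding norm_mult norm_power using nlc ha hb yk H1 m0 Y1
          by (intro add_mono mult_mono) (auto simp: m_def)
        finally show ?thesis .
      qed
      also have "\<dots> \<le> of_int H * (2 * Y) * m"
      proof -
        have "of_int H * m * 1 \<le> of_int H * m * Y" using H1 m0 Y1 by (intro mult_left_mono) auto
        thus ?thesis by (simp add: algebra_simps)
      qed
      finally have "norm (ipoly a' y) \<le> of_int H * (2 * Y) * m" .
      moreover have "norm (ipoly b y) \<le> of_int H * (2 * Y) * m"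
      proof -
        have "1 * m \<le> of_int H * (2 * Y) * m"
          using H1 Y1 m0 by (intro mult_right_mono) (auto intro: order_trans[OF _ mult_mono[of 1 _ 1]])
        thus ?thesis by (simp add: m_def)
      qed
      ultimately have "c / of_int (2 * H\<^sup>2) ^ e \<le> of_int H * (2 * Y) * m" using lower by simp
      moreover have "of_int (2 * H\<^sup>2) ^ e * (of_int H * (2 * Y)) = 2 ^ e * (2 * Y) * (of_int H :: real) ^ (2 * e + 1)"
        by (simp add: power_mult_distrib power_mult[symmetric])
      ultimately have "c / (2 ^ e * (2 * Y) * of_int H ^ (2 * e + 1)) \<le> m"
        using H1 Y1 by (simp add: pos_divide_le_eq mult_ac)
      hence "c / (2 ^ e * (2 * Y)) / of_int H ^ (2 * e + 1) \<le> m" by simp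
      moreover have "c' / of_int H ^ (2 * e + 1) \<le> c / (2 ^ e * (2 * Y)) / of_int H ^ (2 * e + 1)"
        using H1 by (intro divide_right_mono) (auto simp: c'_def)
      ultimately show ?thesis unfolding m_def by linarith
    qed
  qed
  show ?case
  proof (intro exI[of _ c'] conjI c' exI[of _ "2 * e + 1"] allI impI, elim conjE)
    fix a b H
    assume *: "degree a + degree b \<le> Suc d" "1 \<le> H" "\<forall>k. \<bar>coeff a k\<bar> \<le> H" "\<forall>k. \<bar>coeff b k\<bar> \<le> H"
      "\<not> (\<exists>z. ipoly a z = 0 \<and> ipoly b z = 0)"
    show "c' / of_int H ^ (2 * e + 1) \<le> max (norm (ipoly a y)) (norm (ipoly b y))"
    proof (cases "degree b \<le> degree a")
      case True thus ?thesis using main * by blast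
    next
      case False
      have "\<not> (\<exists>z. ipoly b z = 0 \<and> ipoly a z = 0)" using *(5) by auto
      thus ?thesis using main[of b a H] * False by (simp add: max.commute add.commute)
    qed
  qed
qed

section \<open>Recurrences along the orbits of a similarity\<close>

definition cvec :: "real^'d::finite \<Rightarrow> complex^'d" where
  "cvec x = (\<chi> i. complex_of_real (x $ i))"

definition cmat :: "(real^'d::finite \<Rightarrow> real^'d) \<Rightarrow> complex^'d^'d" where
  "cmat L = (\<chi> i j. complex_of_real (matrix L $ i $ j))"

lemma cmat_mult_cvec: "linear L \<Longrightarrow> cmat L *v cvec x = cvec (L x)"
proof -
  assume "linear L"
  hence "L x = matrix L *v x" by (simp add: matrix_works)
  thus ?thesis by (simp add: cmat_def cvec_def vec_eq_iff matrix_vector_mult_def)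
qed

lemma norm_cvec_complex: "(norm (cvec x + \<i> *s cvec y))\<^sup>2 = (norm x)\<^sup>2 + (norm y)\<^sup>2"
proof -
  have "(cmod (of_real a + \<i> * of_real b))\<^sup>2 = a\<^sup>2 + b\<^sup>2" for a b :: real
    by (simp add: cmod_power2)
  thus ?thesis
    by (simp add: norm_vec_def L2_set_def sum_nonneg cvec_def sum.distrib)
qed

lemma norm_cmat_mult:
  assumes "linear L" "\<And>x. norm (L x) = c * norm x" "c \<ge> 0"
  shows "norm (cmat L *v z) = c * norm z"
proof -
  define x y where "x = (\<chi> i. Re (z $ i))" and "y = (\<chi> i. Im (z $ i))"
  have z: "z = cvec x + \<i> *s cvec y"
    by (simp add: vec_eq_iff cvec_def x_def y_def complex_eq_iff)
  have "cmat L *v z = cvec (L x) + \<i> *s cvec (L y)"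
    by (simp add: z matrix_vector_right_distrib vector_scalar_commute cmat_mult_cvec assms(1))
  hence "(norm (cmat L *v z))\<^sup>2 = (c * norm z)\<^sup>2"
    by (simp add: norm_cvec_complex assms(2) z power_mult_distrib algebra_simps)
  thus ?thesis using assms(3) by (simp add: power2_eq_iff_nonneg)
qed

definition mpoly_apply :: "complex^'d^'d::finite \<Rightarrow> complex poly \<Rightarrow> complex^'d \<Rightarrow> complex^'d" where
  "mpoly_apply M g u = (\<Sum>k\<le>degree g. coeff g k *s (((*v) M) ^^ k) u)"

lemma mpoly_apply_altdef:
  assumes "degree g \<le> N"
  shows "mpoly_apply M g u = (\<Sum>k\<le>N. coeff g k *s (((*v) M) ^^ k) u)"
  unfolding mpoly_apply_def using assms
  by (intro sum.mono_neutral_left) (auto simp: coeff_eq_0)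

lemma mpoly_apply_0 [simp]: "mpoly_apply M 0 u = 0"
  by (simp add: mpoly_apply_def)

lemma mpoly_apply_add: "mpoly_apply M (g + h) u = mpoly_apply M g u + mpoly_apply M h u"
proof -
  define N where "N = max (degree g) (degree h)"
  have "degree (g + h) \<le> N" "degree g \<le> N" "degree h \<le> N"
    by (auto simp: N_def degree_add_le_max)
  thus ?thesis by (simp add: mpoly_apply_altdef sum.distrib vec.scale_left_distrib)
qed

lemma mpoly_apply_smult: "mpoly_apply M (smult a g) u = a *s mpoly_apply M g u"
  by (simp add: mpoly_apply_altdef[of "smult a g" "degree g"] mpoly_apply_def
      vec.scale_sum_right degree_smult_le)

lemma mpoly_apply_sum: "mpoly_apply M (sum f A) u = (\<Sum>i\<in>A. mpoly_apply M (f i) u)"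
  by (induction A rule: infinite_finite_induct) (auto simp: mpoly_apply_add)

lemma mpoly_apply_pCons: "mpoly_apply M (pCons a g) u = a *s u + M *v mpoly_apply M g u"
proof -
  have "mpoly_apply M (pCons a g) u = (\<Sum>k\<le>Suc (degree g). coeff (pCons a g) k *s (((*v) M) ^^ k) u)"
    by (rule mpoly_apply_altdef) (simp add: degree_pCons_le)
  also have "\<dots> = a *s u + (\<Sum>k\<le>degree g. coeff g k *s (M *v (((*v) M) ^^ k) u))"
    by (subst sum.atMost_Suc_shift) simp
  also have "(\<Sum>k\<le>degree g. coeff g k *s (M *v (((*v) M) ^^ k) u)) = M *v mpoly_apply M g u"
    unfolding mpoly_apply_def
    by (simp add: vec.linear_sum[OF matrix_vector_mul_linear_gen] vector_scalar_commute)
  finally show ?thesis .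
qed

lemma mpoly_apply_monom: "mpoly_apply M (monom a k) u = a *s (((*v) M) ^^ k) u"
proof (induction k)
  case 0 thus ?case by (simp add: monom_0 mpoly_apply_pCons)
next
  case (Suc k) thus ?case by (simp add: monom_Suc mpoly_apply_pCons vector_scalar_commute)
qed

lemma mpoly_apply_linear_factor:
  "mpoly_apply M ([:- \<theta>, 1:] * g) u = M *v mpoly_apply M g u - \<theta> *s mpoly_apply M g u"
proof -
  have "[:- \<theta>, 1:] * g = smult (- \<theta>) g + pCons 0 g" by simp
  thus ?thesis by (simp only: mpoly_apply_add mpoly_apply_smult mpoly_apply_pCons) simp
qed

lemma mpoly_apply_mult_eq_0: "mpoly_apply M g u = 0 \<Longrightarrow> mpoly_apply M (s * g) u = 0"
proof (induction s)
  case (pCons a s)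
  have "pCons a s * g = smult a g + pCons 0 (s * g)" by simp
  with pCons show ?case by (simp only: mpoly_apply_add mpoly_apply_smult mpoly_apply_pCons) simp
qed simp

lemma mpoly_annihilator_exists: "\<exists>g. g \<noteq> 0 \<and> mpoly_apply M g (u :: complex^'d::finite) = 0"
proof -
  define f where "f = (\<lambda>k. (((*v) M) ^^ k) u)"
  define N where "N = DIM(complex^'d)"
  show ?thesis
  proof (cases "inj_on f {..N}")
    case False
    then obtain i j where "i \<noteq> j" "f i = f j" by (auto simp: inj_on_def)
    hence "mpoly_apply M (monom 1 i + monom (- 1) j) u = 0"
      by (simp add: mpoly_apply_add mpoly_apply_monom f_def)
    moreover have "coeff (monom 1 i + monom (- 1) j) i \<noteq> (0 :: complex)"
      using \<open>i \<noteq> j\<close> by simp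
    hence "monom 1 i + monom (- 1) j \<noteq> (0 :: complex poly)" by (metis coeff_0)
    ultimately show ?thesis by blast
  next
    case True
    have "card (f ` {..N}) > DIM(complex^'d)" using True by (simp add: card_image N_def)
    hence "dependent (f ` {..N})" by (intro dependent_biggerset) auto
    then obtain a v where a: "v \<in> f ` {..N}" "a v \<noteq> 0" "(\<Sum>v\<in>f ` {..N}. a v *\<^sub>R v) = 0"
      by (subst (asm) dependent_finite) auto
    define g where "g = (\<Sum>k\<le>N. monom (complex_of_real (a (f k))) k)"
    have sc: "r *\<^sub>R z = complex_of_real r *s z" for r and z :: "complex^'d"
      by (simp add: vec_eq_iff complex_eq_iff)
    have "mpoly_apply M g u = (\<Sum>k\<le>N. a (f k) *\<^sub>R f k)"
      by (simp add: g_def mpoly_apply_sum mpoly_apply_monom sc f_def)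
    also have "\<dots> = 0" using a(3) True by (simp add: sum.reindex)
    finally have "mpoly_apply M g u = 0" .
    moreover have "g \<noteq> 0"
    proof
      assume "g = 0"
      obtain k where k: "k \<le> N" "v = f k" using a(1) by auto
      have "coeff g k = of_real (a (f k))" using k(1)
        by (simp add: g_def coeff_sum)
      with \<open>g = 0\<close> a(2) k(2) show False by simp
    qed
    ultimately show ?thesis by blast
  qed
qed

text \<open>Over the complex numbers it is enough to split off one simple root after the other.\<close>

lemma simple_roots_imp_dvd:
  fixes g :: "complex poly"
  assumes "g \<noteq> 0" "\<And>\<theta>. poly g \<theta> = 0 \<Longrightarrow> poly P \<theta> = 0"
    and "\<And>\<theta> h. g \<noteq> [:- \<theta>, 1:] * ([:- \<theta>, 1:] * h)"
  shows "g dvd P"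
  using assms
proof (induction "degree g" arbitrary: g)
  case 0
  then obtain a where "g = [:a:]" "a \<noteq> 0" by (metis degree_eq_zeroE pCons_0_0)
  thus ?case by (simp add: const_poly_dvd_iff dvd_field_iff)
next
  case (Suc n)
  have "\<not> constant (poly g)" using Suc(2) by (simp add: constant_degree)
  then obtain \<theta> where \<theta>: "poly g \<theta> = 0" using fundamental_theorem_of_algebra by blast
  then obtain h where h: "g = [:- \<theta>, 1:] * h" unfolding poly_eq_0_iff_dvd dvd_def by blast
  have h0: "h \<noteq> 0" using h Suc(3) by auto
  have "degree g = 1 + degree h" unfolding h using h0 by (subst degree_mult_eq) auto
  hence dh: "n = degree h" using Suc(2) by simp
  have "h dvd P"
  proof (rule Suc(1)[OF dh h0])
    show "poly P t = 0" if "poly h t = 0" for t using that Suc(4) h by simp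
    show "h \<noteq> [:- t, 1:] * ([:- t, 1:] * k)" for t k
      using Suc(5)[of t "[:- \<theta>, 1:] * k"] by (auto simp only: h mult_ac)
  qed
  then obtain k where k: "P = h * k" by blast
  have "poly h \<theta> \<noteq> 0"
    using Suc(5)[of \<theta>] h unfolding poly_eq_0_iff_dvd dvd_def by blast
  moreover have "poly P \<theta> = 0" using Suc(4) \<theta> by blast
  ultimately have "poly k \<theta> = 0" using k by simp
  then obtain l where "k = [:- \<theta>, 1:] * l" unfolding poly_eq_0_iff_dvd dvd_def by blast
  hence "P = g * l" using k h by (simp only: mult_ac)
  thus ?case by simp
qed

text \<open>A Jordan block of size two would make \<open>M ^ n w\<close> grow like \<open>n c ^ n\<close>, but a similarity
  with ratio \<open>c\<close> multiplies norms by \<open>c ^ n\<close> exactly.\<close>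

lemma similarity_no_Jordan_block:
  fixes M :: "complex^'d^'d::finite"
  assumes M: "\<And>z. norm (M *v z) = c * norm z" and c: "c > 0"
    and w: "M *v w = \<theta> *s w + e" and e: "M *v e = \<theta> *s e"
  shows "e = 0"
proof (rule ccontr)
  assume e0: "e \<noteq> 0"
  have "norm (\<theta> *s e) = c * norm e" using M[of e] e by simp
  moreover have nsc: "norm (a *s z) = cmod a * norm z" for a and z :: "complex^'d"
    by (simp add: norm_vec_def norm_mult L2_set_left_distrib L2_set_right_distrib)
  ultimately have th: "cmod \<theta> = c" using e0 by simp
  have pw: "(((*v) M) ^^ n) w = \<theta> ^ n *s w + (of_nat n * \<theta> ^ (n - 1)) *s e" for n
  proof (induction n)
    case (Suc n)
    have "(((*v) M) ^^ Suc n) w = \<theta> ^ n *s (\<theta> *s w + e) + (of_nat n * \<theta> ^ (n - 1)) *s (\<theta> *s e)"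
      by (simp add: Suc matrix_vector_right_distrib vector_scalar_commute w e)
    also have "\<dots> = \<theta> ^ Suc n *s w + (of_nat (Suc n) * \<theta> ^ n) *s e"
      by (cases n) (simp_all add: vec_eq_iff algebra_simps)
    finally show ?case by simp
  qed simp
  have nm: "norm ((((*v) M) ^^ n) w) = c ^ n * norm w" for n
    by (induction n) (auto simp: M)
  have bound: "real n * norm e \<le> 2 * c * norm w" if n: "n > 0" for n
  proof -
    have "norm ((of_nat n * \<theta> ^ (n - 1)) *s e) = norm ((((*v) M) ^^ n) w - \<theta> ^ n *s w)"
      using pw[of n] by simp
    also have "\<dots> \<le> c ^ n * norm w + c ^ n * norm w"
      by (rule order_trans[OF norm_triangle_ineq4]) (simp add: nm nsc norm_power th)
    finally have "real n * c ^ (n - 1) * norm e \<le> 2 * c ^ n * norm w"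
      by (simp add: nsc norm_mult norm_power th ac_simps)
    also have "c ^ n = c ^ (n - 1) * c" using n by (cases n) auto
    finally have "c ^ (n - 1) * (real n * norm e) \<le> c ^ (n - 1) * (2 * c * norm w)"
      by (simp add: algebra_simps)
    thus ?thesis using c by (subst (asm) mult_le_cancel_left_pos) auto
  qed
  obtain n :: nat where "2 * c * norm w / norm e < real n" using reals_Archimedean2 by blast
  hence n: "2 * c * norm w < real n * norm e" using e0 by (simp add: field_simps)
  have "0 \<le> c * norm w" using c by simp
  with n have "n > 0" by (cases n) auto
  from bound[OF this] n show False by linarith
qed

text \<open>The minimal polynomial of \<open>L\<close> at \<open>u\<close> has no double roots since there are no Jordan blocks of size two,
  and its roots are eigenvalues, so it divides \<open>P\<close>.\<close>

lemma similarity_annihilated: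
  fixes L :: "real^'d::finite \<Rightarrow> real^'d"
  assumes L: "linear L" and sim: "\<And>x. norm (L x) = c * norm x" and c: "c > 0"
    and P: "\<And>\<theta>. \<theta> \<in> complex_eigenvalues L \<Longrightarrow> poly P \<theta> = 0"
  shows "mpoly_apply (cmat L) P u = 0"
proof -
  let ?M = "cmat L"
  define Ann where "Ann g \<longleftrightarrow> g \<noteq> 0 \<and> mpoly_apply ?M g u = 0" for g
  have "\<exists>g. Ann g" using mpoly_annihilator_exists[of ?M u] by (auto simp: Ann_def)
  then obtain g where g: "Ann g" and min: "\<And>h. Ann h \<Longrightarrow> degree g \<le> degree h"
    using ex_has_least_nat[of Ann _ degree] by blast
  have M: "norm (?M *v z) = c * norm z" for z
    using norm_cmat_mult[OF L sim] c by simp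
  have nz: "mpoly_apply ?M h u \<noteq> 0" if "h \<noteq> 0" "g = [:- \<theta>, 1:] * h" for h \<theta>
  proof
    assume "mpoly_apply ?M h u = 0"
    hence "degree g \<le> degree h" using min that by (auto simp: Ann_def)
    moreover have "degree g = 1 + degree h" using that by (subst that(2), subst degree_mult_eq) auto
    ultimately show False by simp
  qed
  have "g dvd P"
  proof (rule simple_roots_imp_dvd)
    show "g \<noteq> 0" using g by (simp add: Ann_def)
    show "poly P \<theta> = 0" if "poly g \<theta> = 0" for \<theta>
    proof -
      from that have "[:- \<theta>, 1:] dvd g" by (simp only: poly_eq_0_iff_dvd)
      then obtain h where h: "g = [:- \<theta>, 1:] * h" by (rule dvdE)
      hence "h \<noteq> 0" using g by (auto simp: Ann_def)
      moreover have "?M *v mpoly_apply ?M h u = \<theta> *s mpoly_apply ?M h u"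
        using g mpoly_apply_linear_factor[of ?M \<theta> h u] h by (simp add: Ann_def)
      ultimately have "\<theta> \<in> complex_eigenvalues L"
        using nz[OF _ h] unfolding complex_eigenvalues_def cmat_def by blast
      thus ?thesis by (rule P)
    qed
    show "g \<noteq> [:- \<theta>, 1:] * ([:- \<theta>, 1:] * h)" for \<theta> h
    proof
      assume gh: "g = [:- \<theta>, 1:] * ([:- \<theta>, 1:] * h)"
      have h0: "[:- \<theta>, 1:] * h \<noteq> 0" using gh g by (auto simp: Ann_def)
      define e where "e = mpoly_apply ?M ([:- \<theta>, 1:] * h) u"
      have "?M *v mpoly_apply ?M h u = \<theta> *s mpoly_apply ?M h u + e"
        unfolding e_def mpoly_apply_linear_factor by simp
      moreover have "?M *v e = \<theta> *s e"
        using g mpoly_apply_linear_factor[of ?M \<theta> "[:- \<theta>, 1:] * h" u]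
        by (simp only: Ann_def gh e_def) simp
      ultimately have "e = 0" using similarity_no_Jordan_block[OF M c] by blast
      with nz[OF h0 gh] show False by (simp add: e_def)
    qed
  qed
  then obtain s where "P = s * g" by (metis dvd_def mult.commute)
  thus ?thesis using g by (simp add: Ann_def mpoly_apply_mult_eq_0)
qed

lemma similarity_recurrence:
  fixes L :: "real^'d::finite \<Rightarrow> real^'d"
  assumes L: "linear L" and sim: "\<And>x. norm (L x) = c * norm x" and c: "c > 0"
    and P: "\<And>\<theta>. \<theta> \<in> complex_eigenvalues L \<Longrightarrow> poly P \<theta> = 0"
  shows "(\<Sum>k\<le>degree P. coeff P k * complex_of_real (\<omega> \<bullet> (L ^^ k) v)) = 0"
proof -
  have it: "(((*v) (cmat L)) ^^ k) (cvec v) = cvec ((L ^^ k) v)" for k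
    by (induction k) (auto simp: cmat_mult_cvec L)
  have "(\<Sum>k\<le>degree P. coeff P k *s cvec ((L ^^ k) v)) = 0"
    using similarity_annihilated[OF assms, of "cvec v"] by (simp add: mpoly_apply_def it)
  hence z: "(\<Sum>k\<le>degree P. coeff P k * of_real ((L ^^ k) v $ i)) = 0" for i
    by (auto simp: vec_eq_iff cvec_def)
  have "(\<Sum>k\<le>degree P. coeff P k * complex_of_real (\<omega> \<bullet> (L ^^ k) v)) =
     (\<Sum>k\<le>degree P. \<Sum>i\<in>UNIV. of_real (\<omega> $ i) * (coeff P k * of_real ((L ^^ k) v $ i)))"
    by (simp add: inner_vec_def sum_distrib_left mult.left_commute)
  also have "\<dots> = (\<Sum>i\<in>UNIV. of_real (\<omega> $ i) * (\<Sum>k\<le>degree P. coeff P k * of_real ((L ^^ k) v $ i)))"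
    by (subst sum.swap) (simp only: sum_distrib_left)
  finally show ?thesis using z by simp
qed

text \<open>If \<open>y\<close> is a root of \<open>P\<close>, the value of this polynomial at \<open>y\<close> is \<open>(P / (X - y)) (E) x\<close> at index 0, where
  \<open>E\<close> is the shift. As a polynomial in \<open>y\<close> it has integer coefficients if \<open>P\<close> and \<open>x\<close> have integer entries.\<close>

definition quotient_poly :: "'a::comm_ring_1 poly \<Rightarrow> (nat \<Rightarrow> 'a) \<Rightarrow> 'a poly" where
  "quotient_poly P x = (\<Sum>k\<le>degree P. \<Sum>j<k. monom (coeff P k * x j) (k - 1 - j))"

lemma poly_quotient_poly:
  "poly (quotient_poly P x) y = (\<Sum>k\<le>degree P. \<Sum>j<k. coeff P k * x j * y ^ (k - 1 - j))"
  by (simp add: quotient_poly_def poly_sum poly_monom)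

text \<open>With \<open>P (E) x = 0\<close> and \<open>P y = 0\<close> the last two terms vanish: the operator \<open>P / (X - y)\<close> turns solutions of the recurrence
  into geometric sequences of ratio \<open>y\<close>.\<close>

lemma poly_quotient_poly_shift:
  "poly (quotient_poly P (\<lambda>j. x (Suc j))) y =
     y * poly (quotient_poly P x) y + (\<Sum>k\<le>degree P. coeff P k * x k) - x 0 * poly P y"
proof -
  have "(\<Sum>j<k. x (Suc j) * y ^ (k - 1 - j)) = y * (\<Sum>j<k. x j * y ^ (k - 1 - j)) + x k - x 0 * y ^ k" for k
  proof -
    have "(\<Sum>j<Suc k. x j * y ^ (k - j)) = x 0 * y ^ k + (\<Sum>j<k. x (Suc j) * y ^ (k - 1 - j))"
      by (subst sum.lessThan_Suc_shift) simp
    moreover have "(\<Sum>j<Suc k. x j * y ^ (k - j)) = (\<Sum>j<k. x j * y ^ (k - j)) + x k" by simp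
    moreover have "(\<Sum>j<k. x j * y ^ (k - j)) = y * (\<Sum>j<k. x j * y ^ (k - 1 - j))"
      unfolding sum_distrib_left
    proof (rule sum.cong)
      fix j assume "j \<in> {..<k}"
      hence "k - j = Suc (k - 1 - j)" by auto
      thus "x j * y ^ (k - j) = y * (x j * y ^ (k - 1 - j))" by (simp add: algebra_simps)
    qed simp
    ultimately show ?thesis by (simp add: algebra_simps)
  qed
  hence "(\<Sum>j<k. coeff P k * x (Suc j) * y ^ (k - 1 - j)) =
      y * (\<Sum>j<k. coeff P k * x j * y ^ (k - 1 - j)) + coeff P k * x k - x 0 * (coeff P k * y ^ k)" for k
    by (simp add: mult.assoc sum_distrib_left[symmetric]) (simp add: algebra_simps sum_distrib_left)
  thus ?thesis
    by (simp add: poly_quotient_poly poly_altdef[of P y] sum.distrib sum_subtractf sum_distrib_left)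
qed

lemma coeff_quotient_poly:
  "coeff (quotient_poly P x) m = (\<Sum>k\<le>degree P. \<Sum>j<k. if k - 1 - j = m then coeff P k * x j else 0)"
  by (simp add: quotient_poly_def coeff_sum)

lemma degree_quotient_poly:
  assumes "degree P > 0" shows "degree (quotient_poly P x) < degree P"
proof -
  have "degree (quotient_poly P x) \<le> degree P - 1"
    by (rule degree_le) (auto simp: coeff_quotient_poly intro!: sum.neutral)
  with assms show ?thesis by linarith
qed

text \<open>If the quotient polynomial is zero, the sequence starts with 0; this recovers \<open>x 0\<close> from the values at the roots of \<open>P\<close>.\<close>

lemma lead_coeff_quotient_poly:
  assumes "degree P > 0"
  shows "coeff (quotient_poly P x) (degree P - 1) = lead_coeff P * x 0"
proof -
  have "coeff (quotient_poly P x) (degree P - 1) =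
      (\<Sum>k\<le>degree P. if k = degree P then coeff P k * x 0 else 0)"
    unfolding coeff_quotient_poly
  proof (rule sum.cong)
    fix k assume k: "k \<in> {..degree P}"
    show "(\<Sum>j<k. if k - 1 - j = degree P - 1 then coeff P k * x j else 0) =
        (if k = degree P then coeff P k * x 0 else 0)"
    proof (cases "k = degree P")
      case True
      have "(\<Sum>j<k. if k - 1 - j = degree P - 1 then coeff P k * x j else 0) =
          (\<Sum>j<k. if j = 0 then coeff P k * x j else 0)"
        using True by (intro sum.cong) auto
      thus ?thesis using True assms by simp
    next
      case False
      thus ?thesis using k assms by (auto intro!: sum.neutral)
    qed
  qed simp
  thus ?thesis by simp
qed

lemma abs_coeff_quotient_poly:
  assumes "\<And>j. j < degree P \<Longrightarrow> \<bar>x j\<bar> \<le> (B :: int)"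
  shows "\<bar>coeff (quotient_poly P x) m\<bar> \<le> (\<Sum>k\<le>degree P. of_nat k * \<bar>coeff P k\<bar>) * B"
proof -
  have "\<bar>coeff (quotient_poly P x) m\<bar> \<le> (\<Sum>k\<le>degree P. \<Sum>j<k. \<bar>coeff P k\<bar> * B)"
    unfolding coeff_quotient_poly
  proof (rule order_trans[OF sum_abs], rule sum_mono, rule order_trans[OF sum_abs], rule sum_mono)
    fix k j assume "k \<in> {..degree P}" "j \<in> {..<k}"
    hence "\<bar>x j\<bar> \<le> B" using assms[of j] by auto
    moreover from this have "0 \<le> B" by linarith
    ultimately show "\<bar>if k - 1 - j = m then coeff P k * x j else 0\<bar> \<le> \<bar>coeff P k\<bar> * B"
      by (auto simp: abs_mult intro: mult_left_mono)
  qed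
  thus ?thesis by (simp add: sum_distrib_right mult.assoc)
qed

lemma ipoly_quotient_poly:
  "ipoly (quotient_poly P x) y = poly (quotient_poly (map_poly of_int P) (\<lambda>j. of_int (x j))) y"
  by (simp add: quotient_poly_def poly_sum poly_monom degree_map_poly coeff_map_poly)

text \<open>Componentwise this value is a vector on which \<open>L\<close> acts as multiplication by \<open>y\<close>; it would be an
  eigenvector if it were not zero.\<close>

lemma quotient_poly_not_eigenvalue:
  fixes L :: "real^'d::finite \<Rightarrow> real^'d"
  assumes L: "linear L" and sim: "\<And>x. norm (L x) = c * norm x" and c: "c > 0"
    and P: "\<And>\<theta>. \<theta> \<in> complex_eigenvalues L \<Longrightarrow> poly P \<theta> = 0"
    and y: "poly P y = 0" "y \<notin> complex_eigenvalues L"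
  shows "poly (quotient_poly P (\<lambda>j. complex_of_real (\<omega> \<bullet> (L ^^ j) v))) y = 0"
proof -
  define u :: "complex^'d" where
    "u = (\<chi> i. poly (quotient_poly P (\<lambda>j. complex_of_real ((L ^^ j) v $ i))) y)"
  have lin: "(\<Sum>i\<in>UNIV. a i * u $ i) =
      poly (quotient_poly P (\<lambda>j. \<Sum>i\<in>UNIV. a i * complex_of_real ((L ^^ j) v $ i))) y" for a
  proof -
    have "(\<Sum>i\<in>UNIV. a i * u $ i) = (\<Sum>i\<in>UNIV. \<Sum>k\<le>degree P. \<Sum>j<k.
        coeff P k * (a i * complex_of_real ((L ^^ j) v $ i)) * y ^ (k - 1 - j))"
      by (simp add: u_def poly_quotient_poly sum_distrib_left algebra_simps)
    also have "\<dots> = (\<Sum>k\<le>degree P. \<Sum>j<k. \<Sum>i\<in>UNIV.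
        coeff P k * (a i * complex_of_real ((L ^^ j) v $ i)) * y ^ (k - 1 - j))"
      by (subst sum.swap, intro sum.cong refl, rule sum.swap)
    finally show ?thesis by (simp add: poly_quotient_poly sum_distrib_left sum_distrib_right)
  qed
  have "cmat L *v u = y *s u"
    unfolding vec_eq_iff
  proof
    fix i
    have mv: "(\<Sum>l\<in>UNIV. complex_of_real (matrix L $ i $ l) * of_real ((L ^^ j) v $ l)) =
        of_real ((L ^^ Suc j) v $ i)" for j
    proof -
      have "(L ^^ Suc j) v = matrix L *v (L ^^ j) v" using L by (simp add: matrix_works)
      thus ?thesis by (simp add: matrix_vector_mult_def)
    qed
    have "(cmat L *v u) $ i = (\<Sum>l\<in>UNIV. complex_of_real (matrix L $ i $ l) * u $ l)"
      by (simp add: cmat_def matrix_vector_mult_def)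
    also have "\<dots> = poly (quotient_poly P (\<lambda>j. of_real ((L ^^ Suc j) v $ i))) y"
      unfolding lin mv ..
    also have "\<dots> = y * u $ i"
    proof -
      have "(\<Sum>k\<le>degree P. coeff P k * complex_of_real ((L ^^ k) v $ i)) = 0"
        using similarity_recurrence[OF L sim c P, of "axis i 1" v] by (simp add: inner_axis')
      thus ?thesis
        using poly_quotient_poly_shift[of P "\<lambda>j. complex_of_real ((L ^^ j) v $ i)" y] y(1)
        by (simp add: u_def)
    qed
    finally show "(cmat L *v u) $ i = (y *s u) $ i" by simp
  qed
  hence "u = 0" using y(2) unfolding complex_eigenvalues_def cmat_def by blast
  with lin[of "\<lambda>i. of_real (\<omega> $ i)"] show ?thesis by (simp add: inner_vec_def)
qed

section \<open>Minimal polynomials\<close>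

lemma is_minimal_polyD:
  assumes "is_minimal_poly p x"
  shows "p \<noteq> 0" "rpoly p x = 0" "lead_coeff p = 1"
    and "\<And>q. q \<noteq> 0 \<Longrightarrow> rpoly q x = 0 \<Longrightarrow> degree p \<le> degree q"
  using assms unfolding is_minimal_poly_def by auto

lemma rpoly_eq_0_mod:
  assumes "rpoly p x = 0" "rpoly q x = 0"
  shows "rpoly (q mod p) x = 0"
proof -
  have "q = p * (q div p) + q mod p" by simp
  hence "rpoly q x = rpoly p x * rpoly (q div p) x + rpoly (q mod p) x"
    by (metis rpoly_add rpoly_mult)
  thus ?thesis using assms by simp
qed

lemma is_minimal_poly_dvd:
  assumes p: "is_minimal_poly p x" and q: "rpoly q x = 0"
  shows "p dvd q"
proof (rule ccontr)
  assume "\<not> p dvd q"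
  hence r: "q mod p \<noteq> 0" by (simp add: mod_eq_0_iff_dvd)
  hence "degree (q mod p) < degree p"
    using degree_mod_less[of p q] is_minimal_polyD(1)[OF p] by auto
  moreover have "rpoly (q mod p) x = 0" using rpoly_eq_0_mod is_minimal_polyD(2)[OF p] q .
  ultimately show False using is_minimal_polyD(4)[OF p r] by simp
qed

lemma rpoly_const: "rpoly [:a:] x = of_rat a"
  by (cases "a = 0") (simp_all add: map_poly_pCons)

text \<open>A nonzero polynomial of least degree at \<open>z\<close> divides \<open>p\<close>, and one of the two factors vanishes at \<open>x\<close>.\<close>

lemma is_minimal_poly_conjugate:
  assumes p: "is_minimal_poly p x" and z: "rpoly p z = 0"
  shows "is_minimal_poly p z"
proof -
  define Q where "Q r \<longleftrightarrow> r \<noteq> 0 \<and> rpoly r z = 0" for r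
  have "Q p" using is_minimal_polyD(1)[OF p] z by (simp add: Q_def)
  then obtain r where r: "Q r" and min: "\<And>s. Q s \<Longrightarrow> degree r \<le> degree s"
    using ex_has_least_nat[of Q p degree] by blast
  have r0: "r \<noteq> 0" using r by (simp add: Q_def)
  have "p mod r = 0"
  proof (rule ccontr)
    assume n: "p mod r \<noteq> 0"
    hence "Q (p mod r)" using rpoly_eq_0_mod r z by (simp add: Q_def)
    from min[OF this] degree_mod_less[OF r0, of p] n show False by simp
  qed
  then obtain s where s: "p = r * s" by (metis dvdE mod_eq_0_iff_dvd)
  have s0: "s \<noteq> 0" using s is_minimal_polyD(1)[OF p] by auto
  have dg: "degree p = degree r + degree s" using s r0 s0 by (simp add: degree_mult_eq)
  have "rpoly r x * rpoly s x = 0"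
    using is_minimal_polyD(2)[OF p] s by (simp add: rpoly_mult)
  hence "rpoly r x = 0 \<or> rpoly s x = 0" by simp
  hence "degree p \<le> degree r"
  proof (rule disjE)
    assume "rpoly s x = 0"
    hence "degree r = 0" using is_minimal_polyD(4)[OF p s0] dg by simp
    then obtain a where a: "r = [:a:]" by (metis degree_eq_zeroE)
    hence "rpoly r z \<noteq> 0" using r0 by (simp add: rpoly_const)
    thus ?thesis using r by (simp add: Q_def)
  qed (use is_minimal_polyD(4)[OF p r0] in simp)
  thus ?thesis
    using min z is_minimal_polyD(3)[OF p] unfolding is_minimal_poly_def Q_def
    by (meson order_trans)
qed

lemma is_minimal_poly_unique:
  assumes p: "is_minimal_poly p x" and q: "is_minimal_poly q x"
  shows "p = q"
proof -
  obtain s where s: "q = p * s"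
    using is_minimal_poly_dvd[OF p is_minimal_polyD(2)[OF q]] by blast
  have s0: "s \<noteq> 0" using s is_minimal_polyD(1)[OF q] by auto
  have "degree q = degree p + degree s"
    using s s0 is_minimal_polyD(1)[OF p] by (simp add: degree_mult_eq)
  moreover have "degree q \<le> degree p"
    using is_minimal_polyD(4)[OF q is_minimal_polyD(1,2)[OF p]] .
  ultimately obtain a where a: "s = [:a:]" by (metis degree_eq_zeroE add_le_same_cancel1 le_zero_eq)
  hence "a = 1"
    using is_minimal_polyD(3)[OF p] is_minimal_polyD(3)[OF q] s by (simp add: lead_coeff_mult split: if_splits)
  thus ?thesis using s a by simp
qed

text \<open>Distinct minimal polynomials have no common root, so they can be divided out one by one.\<close>

lemma prod_minimal_polys_dvd:
  assumes "finite S" "\<And>p. p \<in> S \<Longrightarrow> is_minimal_poly p (y p)" "\<And>p. p \<in> S \<Longrightarrow> rpoly q (y p) = 0"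
  shows "\<Prod>S dvd q"
  using assms
proof (induction S rule: finite_induct)
  case (insert p S)
  have "\<Prod>S dvd q" using insert by auto
  then obtain s where s: "q = \<Prod>S * s" by blast
  have "rpoly (\<Prod>S) (y p) \<noteq> 0"
  proof
    assume "rpoly (\<Prod>S) (y p) = 0"
    then obtain p' where p': "p' \<in> S" "rpoly p' (y p) = 0"
      using insert.hyps(1) by (auto simp: rpoly_prod)
    hence "is_minimal_poly p' (y p)" using is_minimal_poly_conjugate insert.prems by blast
    hence "p' = p" using is_minimal_poly_unique insert.prems by blast
    with p' insert.hyps show False by simp
  qed
  moreover have "rpoly q (y p) = 0" using insert.prems by blast
  ultimately have "rpoly s (y p) = 0" using s by (simp add: rpoly_mult)
  hence "p dvd s" using is_minimal_poly_dvd insert.prems by blast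
  thus ?case using s insert.hyps by (auto simp: mult.commute intro: mult_dvd_mono)
qed simp

lemma clear_denominators:
  "\<exists>c q. c \<noteq> 0 \<and> (map_poly of_int q :: rat poly) = smult (of_int c) p"
proof (induction p)
  case 0
  show ?case by (intro exI[of _ 1] exI[of _ 0]) simp
next
  case (pCons a p)
  then obtain c q where cq: "c \<noteq> 0" "(map_poly of_int q :: rat poly) = smult (of_int c) p" by blast
  obtain n d where nd: "a = of_int n / of_int d" "d > 0"
    by (metis Rat_cases Fract_of_int_quotient)
  have "map_poly of_int (pCons (c * n) (smult d q)) = smult (of_int (c * d)) (pCons a p)"
  proof (rule poly_eqI)
    fix k
    show "coeff (map_poly of_int (pCons (c * n) (smult d q))) k = coeff (smult (of_int (c * d)) (pCons a p)) k"
    proof (cases k)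
      case 0 thus ?thesis using nd by (simp add: coeff_map_poly)
    next
      case (Suc j)
      have "of_int (coeff q j) = of_int c * coeff p j"
        using arg_cong[OF cq(2), of "\<lambda>r. coeff r j"] by (simp add: coeff_map_poly)
      thus ?thesis using Suc by (simp add: coeff_map_poly)
    qed
  qed
  moreover have "c * d \<noteq> 0" using cq nd by simp
  ultimately show ?case by blast
qed

lemma clear_denominators_rpoly:
  assumes "(map_poly of_int q :: rat poly) = smult (of_int c) p"
  shows "ipoly q y = of_int c * rpoly p y"
proof -
  have "map_poly of_int q = (map_poly of_rat (map_poly of_int q :: rat poly) :: complex poly)"
    by (rule poly_eqI) (simp add: coeff_map_poly)
  also have "\<dots> = smult (of_int c) (map_poly of_rat p)"
    unfolding assms by (rule poly_eqI) (simp add: coeff_map_poly of_rat_mult)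
  finally show ?thesis by simp
qed

lemma ipoly_eq_rpoly: "ipoly q y = rpoly (map_poly of_int q) y"
  using clear_denominators_rpoly[of q 1 "map_poly of_int q" y] by simp

lemma strongly_totally_non_pisot_conjugate:
  assumes A: "strongly_totally_non_pisot A" and x: "x \<in> A"
  shows "\<exists>p y. is_minimal_poly p x \<and> rpoly p y = 0 \<and> norm y > 1 \<and> y \<notin> A"
proof -
  define r where "r = {(x, y) \<in> A \<times> A. \<exists>p. is_minimal_poly p x \<and> is_minimal_poly p y}"
  define C where "C = r `` {x}"
  have C: "C \<in> minimal_poly_classes A"
    unfolding minimal_poly_classes_def r_def[symmetric] C_def using x by (rule quotientI)
  (* the empty family is a Pisot family, so no class is empty *)
  have "\<not> pisot_family C"
    using A C by (auto simp: strongly_totally_non_pisot_def totally_non_pisot_def non_pisot_family_def)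
  hence "C \<noteq> {}" by (auto simp: pisot_family_def expanding_algebraic_integers_def)
  then obtain p0 where "is_minimal_poly p0 x" by (auto simp: C_def r_def)
  hence "x \<in> C" using x by (auto simp: C_def r_def)
  with A C obtain y where y: "y \<in> galois_conjugates x" "norm y > 1" "y \<notin> C"
    unfolding strongly_totally_non_pisot_def by blast
  then obtain p where p: "is_minimal_poly p x" "rpoly p y = 0"
    by (auto simp: galois_conjugates_def)
  have "y \<notin> A"
    using is_minimal_poly_conjugate[OF p] p(1) x y(3) by (auto simp: C_def r_def)
  thus ?thesis using p y by blast
qed

text \<open>\<open>P\<close> is the product of the minimal polynomials of the elements of \<open>A\<close> with denominators cleared; \<open>Y\<close> contains one
  expanding conjugate outside \<open>A\<close> for each factor, and \<open>m y\<close> is a multiple of the factor that belongs to \<open>y\<close>.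
  A polynomial that vanishes on \<open>Y\<close> is divisible by every factor, hence by \<open>P\<close>.\<close>

lemma integer_annihilator:
  assumes A: "strongly_totally_non_pisot A" and fin: "finite A" and ne: "A \<noteq> {}"
  obtains P :: "int poly" and Y m where "degree P > 0" "\<And>x. x \<in> A \<Longrightarrow> ipoly P x = 0" "finite Y"
    "\<And>y. y \<in> Y \<Longrightarrow> norm y > 1 \<and> y \<notin> A \<and> ipoly P y = 0"
    "\<And>q. degree q < degree P \<Longrightarrow> (\<And>y. y \<in> Y \<Longrightarrow> ipoly q y = 0) \<Longrightarrow> q = 0"
    "\<And>y. y \<in> Y \<Longrightarrow> ipoly (m y) y = 0"
    "\<And>y q z. y \<in> Y \<Longrightarrow> ipoly (m y) z = 0 \<Longrightarrow> ipoly q z = 0 \<Longrightarrow> ipoly q y = 0"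
proof -
  have "\<forall>x\<in>A. \<exists>p y. is_minimal_poly p x \<and> rpoly p y = 0 \<and> norm y > 1 \<and> y \<notin> A"
    using strongly_totally_non_pisot_conjugate[OF A] by blast
  then obtain f where "\<forall>x\<in>A. \<exists>y. is_minimal_poly (f x) x \<and> rpoly (f x) y = 0 \<and> norm y > 1 \<and> y \<notin> A"
    by metis
  hence f: "is_minimal_poly (f x) x" and fy: "\<exists>y. rpoly (f x) y = 0 \<and> norm y > 1 \<and> y \<notin> A"
    if "x \<in> A" for x using that by blast+
  define S where "S = f ` A"
  have finS: "finite S" using fin by (simp add: S_def)
  have "\<forall>p\<in>S. \<exists>y. rpoly p y = 0 \<and> norm y > 1 \<and> y \<notin> A" using fy by (auto simp: S_def)
  then obtain y where y: "\<And>p. p \<in> S \<Longrightarrow> rpoly (p) (y p) = 0 \<and> norm (y p) > 1 \<and> y p \<notin> A" by metis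
  have miny: "is_minimal_poly p (y p)" if p: "p \<in> S" for p
    using is_minimal_poly_conjugate f y[OF p] p by (auto simp: S_def)
  define R where "R = \<Prod>S"
  obtain c P where cP: "c \<noteq> 0" "(map_poly of_int P :: rat poly) = smult (of_int c) R"
    using clear_denominators by blast
  have evP: "ipoly P z = of_int c * rpoly R z" for z by (rule clear_denominators_rpoly[OF cP(2)])
  have "degree (map_poly of_int P :: rat poly) = degree P" by (simp add: degree_map_poly)
  hence degP: "degree P = degree R" using cP by simp
  have nz: "p \<noteq> 0" if "p \<in> S" for p using miny[OF that] is_minimal_polyD(1) by blast
  have evR: "rpoly R z = 0 \<longleftrightarrow> (\<exists>p\<in>S. rpoly p z = 0)" for z
    using finS by (simp add: R_def rpoly_prod)
  have "\<forall>p\<in>S. \<exists>q. \<exists>c. c \<noteq> 0 \<and> (map_poly of_int q :: rat poly) = smult (of_int c) p"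
    using clear_denominators by blast
  then obtain mp where mp: "\<And>p. p \<in> S \<Longrightarrow> \<exists>c. c \<noteq> 0 \<and> (map_poly of_int (mp p) :: rat poly) = smult (of_int c) p"
    by metis
  have evm: "ipoly (mp p) z = 0 \<longleftrightarrow> rpoly p z = 0" if p: "p \<in> S" for p z
  proof -
    obtain c where "c \<noteq> 0" "(map_poly of_int (mp p) :: rat poly) = smult (of_int c) p" using mp[OF p] by blast
    thus ?thesis using clear_denominators_rpoly by simp
  qed
  define g where "g z = (SOME p. p \<in> S \<and> y p = z)" for z
  have g: "g z \<in> S \<and> y (g z) = z" if "z \<in> y ` S" for z
    unfolding g_def by (rule someI_ex) (use that in auto)
  show ?thesis
  proof (rule that[of P "y ` S" "\<lambda>z. mp (g z)"])
    show zero: "ipoly P x = 0" if "x \<in> A" for x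
      using f[OF that] that is_minimal_polyD(2) by (auto simp: evP evR S_def)
    show "degree P > 0"
    proof (rule ccontr)
      assume "\<not> degree P > 0"
      then obtain a where a: "P = [:a:]" using degree_eq_zeroE by blast
      obtain x where "x \<in> A" using ne by blast
      from zero[OF this] a have "a = 0" by (cases "a = 0") (simp_all add: map_poly_pCons)
      hence "smult (of_int c) R = 0" using a cP(2) by simp
      hence "R = 0" using cP(1) by simp
      thus False using nz finS by (auto simp: R_def)
    qed
    show "finite (y ` S)" using finS by simp
    show "norm z > 1 \<and> z \<notin> A \<and> ipoly P z = 0" if "z \<in> y ` S" for z
      using y that by (auto simp: evP evR)
    show "q = 0" if "degree q < degree P" "\<And>z. z \<in> y ` S \<Longrightarrow> ipoly q z = 0" for q
    proof -
      have "R dvd map_poly of_int q" unfolding R_def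
      proof (rule prod_minimal_polys_dvd[OF finS miny])
        show "rpoly (map_poly of_int q) (y p) = 0" if "p \<in> S" for p
          using \<open>\<And>z. z \<in> y ` S \<Longrightarrow> ipoly q z = 0\<close> that by (simp flip: ipoly_eq_rpoly)
      qed
      moreover have "degree (map_poly of_int q :: rat poly) < degree R"
        using that(1) degP by (simp add: degree_map_poly)
      ultimately have "(map_poly of_int q :: rat poly) = 0"
        by (metis dvd_imp_degree_le not_le)
      thus "q = 0" by (simp add: map_poly_eq_0_iff)
    qed
    show "ipoly (mp (g z)) z = 0" if "z \<in> y ` S" for z
      using g[OF that] evm y by metis
    show "ipoly q z = 0" if z: "z \<in> y ` S" "ipoly (mp (g z)) w = 0" "ipoly q w = 0" for z q w
    proof -
      have gz: "g z \<in> S" "y (g z) = z" using g[OF z(1)] by auto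
      have "rpoly (g z) w = 0" using evm[OF gz(1)] z(2) by simp
      hence "is_minimal_poly (g z) w" by (rule is_minimal_poly_conjugate[OF miny[OF gz(1)]])
      hence "g z dvd map_poly of_int q" using z(3) by (intro is_minimal_poly_dvd) (simp_all flip: ipoly_eq_rpoly)
      then obtain t where "map_poly of_int q = g z * t" by blast
      hence "rpoly (map_poly of_int q) z = rpoly (g z) z * rpoly t z" by (simp add: rpoly_mult)
      thus ?thesis using y[OF gz(1)] gz(2) by (simp add: ipoly_eq_rpoly)
    qed
  qed
qed

section \<open>Eigenvalues\<close>

lemma mpoly_apply_eigenvector: "M *v u = \<theta> *s u \<Longrightarrow> mpoly_apply M g u = poly g \<theta> *s u"
  by (induction g) (auto simp: mpoly_apply_pCons vector_scalar_commute vec.scale_left_distrib)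

lemma mpoly_apply_vec_sum:
  "mpoly_apply M g (\<Sum>i\<in>A. a i *s u i) = (\<Sum>i\<in>A. a i *s mpoly_apply M g (u i))"
  by (induction g) (auto simp: mpoly_apply_pCons vec.linear_sum[OF matrix_vector_mul_linear_gen]
      vector_scalar_commute vec.scale_sum_right sum.distrib vec.scale_right_distrib mult.commute)

text \<open>Eigenvalues are roots of a polynomial that annihilates all coordinate vectors.\<close>

lemma finite_complex_eigenvalues: "finite (complex_eigenvalues (L :: real^'d::finite \<Rightarrow> real^'d))"
proof -
  have "\<exists>g. \<forall>i. g i \<noteq> 0 \<and> mpoly_apply (cmat L) (g i) (axis i 1 :: complex^'d) = 0"
    using mpoly_annihilator_exists by (intro choice allI) blast
  then obtain g where g: "\<And>i. g i \<noteq> 0 \<and> mpoly_apply (cmat L) (g i) (axis i 1) = 0" by blast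
  define G where "G = (\<Prod>i\<in>UNIV. g i)"
  have G0: "G \<noteq> 0" using g by (simp add: G_def)
  have Gi: "mpoly_apply (cmat L) G (axis i 1) = 0" for i
  proof -
    have "G = (\<Prod>j\<in>UNIV - {i}. g j) * g i"
      unfolding G_def by (subst prod.remove[of _ i]) (auto simp: mult.commute)
    thus ?thesis using g by (simp add: mpoly_apply_mult_eq_0)
  qed
  have "complex_eigenvalues L \<subseteq> {x. poly G x = 0}"
  proof
    fix x assume "x \<in> complex_eigenvalues L"
    then obtain v where v: "v \<noteq> 0" "cmat L *v v = x *s v"
      by (auto simp: complex_eigenvalues_def cmat_def)
    have "mpoly_apply (cmat L) G v = mpoly_apply (cmat L) G (\<Sum>i\<in>UNIV. (v $ i) *s axis i 1)"
      by (simp add: basis_expansion)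
    also have "\<dots> = 0" unfolding mpoly_apply_vec_sum by (simp add: Gi)
    finally have "poly G x *s v = 0" by (simp add: mpoly_apply_eigenvector[OF v(2)])
    thus "x \<in> {x. poly G x = 0}" using v(1) by simp
  qed
  thus ?thesis using poly_roots_finite[OF G0] finite_subset by blast
qed

lemma complex_eigenvalues_nonempty:
  fixes L :: "real^'d::finite \<Rightarrow> real^'d"
  assumes "linear L" "\<And>x. norm (L x) = c * norm x" "c > 0"
  shows "complex_eigenvalues L \<noteq> {}"
proof
  assume "complex_eigenvalues L = {}"
  hence "mpoly_apply (cmat L) 1 (1 :: complex^'d) = 0"
    by (intro similarity_annihilated[OF assms]) auto
  thus False by (simp add: mpoly_apply_def)
qed

section \<open>Non-Pisot recurrences stay away from the integers\<close>

lemma norm_poly_quotient_poly_le: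
  assumes "\<And>j. j < degree P \<Longrightarrow> norm (x j) \<le> B"
  shows "norm (poly (quotient_poly P x) (y :: complex)) \<le>
    (\<Sum>k\<le>degree P. \<Sum>j<k. norm (coeff P k) * norm y ^ (k - 1 - j)) * B"
proof -
  have "norm (poly (quotient_poly P x) y) \<le>
      (\<Sum>k\<le>degree P. \<Sum>j<k. norm (coeff P k * x j * y ^ (k - 1 - j)))"
    unfolding poly_quotient_poly by (intro order_trans[OF norm_sum] sum_mono order_refl)
  also have "\<dots> \<le> (\<Sum>k\<le>degree P. \<Sum>j<k. norm (coeff P k) * norm y ^ (k - 1 - j) * B)"
  proof (intro sum_mono)
    fix k j assume "k \<in> {..degree P}" "j \<in> {..<k}"
    hence "norm (coeff P k) * norm (y ^ (k - 1 - j)) * norm (x j) \<le> norm (coeff P k) * norm (y ^ (k - 1 - j)) * B"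
      using assms[of j] by (intro mult_left_mono) auto
    thus "norm (coeff P k * x j * y ^ (k - 1 - j)) \<le> norm (coeff P k) * norm y ^ (k - 1 - j) * B"
      by (simp add: norm_mult norm_power mult_ac)
  qed
  finally show ?thesis by (simp add: sum_distrib_right)
qed

lemma poly_quotient_poly_diff:
  "poly (quotient_poly P (\<lambda>j. a j - b j)) y = poly (quotient_poly P a) y - poly (quotient_poly P b) y"
  by (simp add: poly_quotient_poly algebra_simps sum_subtractf)

lemma norm_similarity_power:
  fixes L :: "'a::real_normed_vector \<Rightarrow> 'a"
  assumes "\<And>x. norm (L x) = c * norm x"
  shows "norm ((L ^^ n) x) = c ^ n * norm x"
  by (induction n) (auto simp: assms)

locale integer_recurrence =
  fixes L :: "real^'d::finite \<Rightarrow> real^'d" and c :: real and P :: "int poly" and \<delta> B :: real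
  assumes L: "linear L" and sim: "\<And>x. norm (L x) = c * norm x" and c: "c > 1"
    and degP: "degree P > 0" and P: "\<And>x. x \<in> complex_eigenvalues L \<Longrightarrow> ipoly P x = 0"
    and \<delta>: "0 < \<delta>" "\<delta> \<le> 1" "\<delta> * (\<Sum>k\<le>degree P. \<bar>of_int (coeff P k)\<bar>) < 1"
begin

text \<open>The recurrence applied to the nearest integers gives an integer of absolute value less than 1.\<close>

lemma nearest_integers_recurrence:
  assumes near: "\<And>j. j \<le> degree P \<Longrightarrow> \<bar>\<omega> \<bullet> (L ^^ (n + j)) v - of_int (K (n + j))\<bar> \<le> \<delta>"
  shows "(\<Sum>k\<le>degree P. coeff P k * K (n + k)) = 0"
proof -
  define I where "I = (\<Sum>k\<le>degree P. coeff P k * K (n + k))"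
  have "(\<Sum>k\<le>degree P. complex_of_int (coeff P k) * complex_of_real (\<omega> \<bullet> (L ^^ k) ((L ^^ n) v))) = 0"
    using similarity_recurrence[OF L sim, of "map_poly of_int P" \<omega> "(L ^^ n) v"] c P
    by (simp add: degree_map_poly coeff_map_poly)
  hence "complex_of_real (\<Sum>k\<le>degree P. of_int (coeff P k) * (\<omega> \<bullet> (L ^^ k) ((L ^^ n) v))) = 0"
    by simp
  hence "(\<Sum>k\<le>degree P. of_int (coeff P k) * (\<omega> \<bullet> (L ^^ k) ((L ^^ n) v))) = 0"
    by (simp only: of_real_eq_0_iff)
  hence "(\<Sum>k\<le>degree P. of_int (coeff P k) * (\<omega> \<bullet> (L ^^ (n + k)) v)) = 0"
    by (simp add: funpow_add add.commute[of n])
  hence "of_int I = - (\<Sum>k\<le>degree P. of_int (coeff P k) * (\<omega> \<bullet> (L ^^ (n + k)) v - of_int (K (n + k))))"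
    by (simp add: I_def right_diff_distrib sum_subtractf)
  hence "\<bar>of_int I\<bar> \<le> (\<Sum>k\<le>degree P. \<bar>of_int (coeff P k) * (\<omega> \<bullet> (L ^^ (n + k)) v - of_int (K (n + k)))\<bar>)"
    by (simp only: abs_minus_cancel sum_abs)
  also have "\<dots> \<le> (\<Sum>k\<le>degree P. \<bar>of_int (coeff P k)\<bar> * \<delta>)"
    unfolding abs_mult using near by (intro sum_mono mult_left_mono) auto
  also have "\<dots> = \<delta> * (\<Sum>k\<le>degree P. \<bar>of_int (coeff P k)\<bar>)"
    by (simp add: sum_distrib_left mult.commute)
  also have "\<dots> < 1" by (rule \<delta>(3))
  finally have "\<bar>I\<bar> < 1" by linarith
  thus ?thesis by (simp add: I_def)
qed

text \<open>As long as the nearest integers satisfy the recurrence, \<open>(P / (X - y)) (E)\<close> applied to them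
  is a geometric sequence of ratio \<open>y\<close>. It is also bounded, since the same operator annihilates
  the orbit itself. Over a long window its first term is therefore too small for
  a nonzero value at \<open>y\<close> of an integer polynomial of this height.\<close>

lemma quotient_poly_nearest_integers_eq_0:
  assumes y: "norm y > 1" "y \<notin> complex_eigenvalues L" "ipoly P y = 0"
    and m: "ipoly m y = 0" "\<And>q z. ipoly m z = 0 \<Longrightarrow> ipoly q z = 0 \<Longrightarrow> ipoly q y = 0"
  shows "\<exists>C>0. \<forall>\<omega> K v. norm \<omega> \<ge> 1 \<longrightarrow> norm v \<le> B \<longrightarrow>
     (\<forall>n. real n \<le> C * (1 + ln (norm \<omega>)) \<longrightarrow> \<bar>\<omega> \<bullet> (L ^^ n) v - of_int (K n)\<bar> \<le> \<delta>) \<longrightarrow>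
     ipoly (quotient_poly P K) y = 0"
proof -
  define D where "D = degree P"
  define Pc where "Pc = (map_poly of_int P :: complex poly)"
  have degPc: "degree Pc = D" by (simp add: Pc_def D_def degree_map_poly)
  define E where "E = 1 + (\<Sum>k\<le>degree Pc. \<Sum>j<k. norm (coeff Pc k) * norm y ^ (k - 1 - j))"
  have E: "E \<ge> 1" unfolding E_def by (simp add: sum_nonneg)
  obtain cL e where cL: "cL > 0" and liouville: "\<And>a b H. degree a + degree b \<le> degree m + D \<Longrightarrow>
     1 \<le> H \<Longrightarrow> (\<And>k. \<bar>coeff a k\<bar> \<le> H) \<Longrightarrow> (\<And>k. \<bar>coeff b k\<bar> \<le> H) \<Longrightarrow> \<not> (\<exists>z. ipoly a z = 0 \<and> ipoly b z = 0) \<Longrightarrow>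
     cL / of_int H ^ e \<le> max (norm (ipoly a y)) (norm (ipoly b y))"
    using ipoly_pair_lower_bound[of "degree m + D" y] by blast
  define S where "S = (\<Sum>k\<le>D. of_nat k * \<bar>coeff P k\<bar>)"
  have S0: "S \<ge> 0" unfolding S_def by (intro sum_nonneg) auto
  define Hm where "Hm = (\<Sum>k\<le>degree m. \<bar>coeff m k\<bar>)"
  have Hm: "\<bar>coeff m k\<bar> \<le> Hm" for k
  proof (cases "k \<le> degree m")
    case True
    thus ?thesis unfolding Hm_def by (intro member_le_sum) auto
  next
    case False
    thus ?thesis unfolding Hm_def by (simp add: coeff_eq_0 sum_nonneg)
  qed
  have Hm0: "Hm \<ge> 0" using Hm[of 0] by linarith
  define H1 where "H1 = of_int S * (c ^ D * \<bar>B\<bar> + 3) + of_int Hm + 1"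
  have cD: "c ^ D \<ge> 1" using c by (intro one_le_power) auto
  have H1: "H1 \<ge> 1" unfolding H1_def using S0 Hm0 c by (simp add: add_nonneg_nonneg)
  define A0 where "A0 = \<bar>ln (E * H1 ^ e / cL)\<bar>"
  have lny: "ln (norm y) > 0" using y(1) by (rule ln_gt_zero)
  (* long enough for the geometric growth with ratio y to beat the Liouville bound of exponent e; D + 2 pays for the boundary of the window and for rounding *)
  define C where "C = real D + 2 + (A0 + real e + 1) / ln (norm y)"
  have quot_nonneg: "(A0 + real e + 1) / ln (norm y) \<ge> 0"
    using lny by (intro divide_nonneg_nonneg) (auto simp: A0_def)
  hence C0: "C > 0" unfolding C_def by linarith
  have goal: "ipoly (quotient_poly P K) y = 0"
    if \<omega>: "norm \<omega> \<ge> 1" and v: "norm v \<le> B"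
      and near: "\<And>n. real n \<le> C * (1 + ln (norm \<omega>)) \<Longrightarrow> \<bar>\<omega> \<bullet> (L ^^ n) v - of_int (K n)\<bar> \<le> \<delta>"
    for \<omega> K v
  proof (rule ccontr)
    assume nz: "ipoly (quotient_poly P K) y \<noteq> 0"
    define l where "l = ln (norm \<omega>)"
    have l0: "l \<ge> 0" using \<omega> by (simp add: l_def)
    define N where "N = nat \<lfloor>C * (1 + l)\<rfloor>"
    have C1: "C * 1 \<le> C * (1 + l)" using C0 l0 by (intro mult_left_mono) auto
    have N: "real N \<le> C * (1 + l)" "C * (1 + l) < real N + 1"
      using C1 C0 unfolding N_def by linarith+
    have nearN: "\<bar>\<omega> \<bullet> (L ^^ n) v - of_int (K n)\<bar> \<le> \<delta>" if "n \<le> N" for n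
      using near[of n] N(1) that by (simp add: l_def)
    have "C \<ge> real D + 2" using quot_nonneg by (simp add: C_def)
    hence "real N > real D + 1" using N(2) C1 by linarith
    hence ND: "N \<ge> D + 1" by linarith
    define z where "z n = poly (quotient_poly Pc (\<lambda>j. of_int (K (n + j)))) y" for n
    have z0: "z 0 = ipoly (quotient_poly P K) y"
      by (simp add: z_def ipoly_quotient_poly Pc_def)
    have step: "z (Suc n) = y * z n" if "n + D \<le> N" for n
    proof -
      have "(\<Sum>k\<le>degree P. coeff P k * K (n + k)) = 0"
        using that by (intro nearest_integers_recurrence[where \<omega> = \<omega> and v = v] nearN) (simp add: D_def)
      hence "complex_of_int (\<Sum>k\<le>degree P. coeff P k * K (n + k)) = 0" by simp
      hence "(\<Sum>k\<le>degree Pc. coeff Pc k * of_int (K (n + k))) = 0"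
        by (simp add: degPc D_def) (simp add: Pc_def coeff_map_poly)
      thus ?thesis
        using poly_quotient_poly_shift[of Pc "\<lambda>j. of_int (K (n + j))" y] y(3)
        by (simp add: z_def Pc_def)
    qed
    have geom: "n + D \<le> N + 1 \<Longrightarrow> z n = y ^ n * z 0" for n
      by (induction n) (auto simp: step)
    have zle: "norm (z n) \<le> E" if "n + D \<le> N" for n
    proof -
      define d where "d = (\<lambda>j. complex_of_real (\<omega> \<bullet> (L ^^ j) ((L ^^ n) v)) - of_int (K (n + j)))"
      have "poly (quotient_poly Pc (\<lambda>j. complex_of_real (\<omega> \<bullet> (L ^^ j) ((L ^^ n) v)))) y = 0"
        by (rule quotient_poly_not_eigenvalue[OF L sim]) (use c y P in \<open>auto simp: Pc_def\<close>)
      hence "poly (quotient_poly Pc d) y = - z n"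
        unfolding d_def by (simp add: poly_quotient_poly_diff z_def)
      moreover have "norm (poly (quotient_poly Pc d) y) \<le> (E - 1) * 1"
        unfolding E_def
      proof (simp only: add_diff_cancel_left', rule norm_poly_quotient_poly_le)
        fix j assume "j < degree Pc"
        hence "\<bar>\<omega> \<bullet> (L ^^ (n + j)) v - of_int (K (n + j))\<bar> \<le> \<delta>"
          using that degPc by (intro nearN) auto
        moreover have "d j = complex_of_real (\<omega> \<bullet> (L ^^ (n + j)) v - of_int (K (n + j)))"
          by (simp add: d_def funpow_add add.commute[of n])
        ultimately show "norm (d j) \<le> 1" using \<delta>(2) by (simp only: norm_of_real)
      qed
      ultimately show ?thesis by simp
    qed
    have upper: "norm y ^ (N - D) * norm (z 0) \<le> E"
      using zle[of "N - D"] geom[of "N - D"] ND by (simp add: norm_mult norm_power)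
    define q where "q = quotient_poly P K"
    define BK where "BK = \<lceil>c ^ D * \<bar>B\<bar> * norm \<omega> + 1\<rceil>"
    have K: "\<bar>K j\<bar> \<le> BK" if "j < degree P" for j
    proof -
      have "\<bar>\<omega> \<bullet> (L ^^ j) v\<bar> \<le> norm \<omega> * (c ^ j * norm v)"
        using Cauchy_Schwarz_ineq2[of \<omega> "(L ^^ j) v"] by (simp add: norm_similarity_power[OF sim])
      also have "\<dots> \<le> norm \<omega> * (c ^ D * \<bar>B\<bar>)"
        using that c v by (intro mult_left_mono mult_mono power_increasing) (auto simp: D_def)
      finally have "\<bar>\<omega> \<bullet> (L ^^ j) v\<bar> \<le> c ^ D * \<bar>B\<bar> * norm \<omega>" by (simp add: mult_ac)
      moreover have "\<bar>\<omega> \<bullet> (L ^^ j) v - of_int (K j)\<bar> \<le> \<delta>"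
        using that ND by (intro nearN) (auto simp: D_def)
      ultimately have "\<bar>of_int (K j)\<bar> \<le> c ^ D * \<bar>B\<bar> * norm \<omega> + 1" using \<delta>(2) by linarith
      thus ?thesis unfolding BK_def by linarith
    qed
    define H where "H = S * BK + Hm + 1"
    have BK0: "BK \<ge> 0" using K[of 0] degP by linarith
    have SBK: "S * BK \<ge> 0" using S0 BK0 by simp
    have HH: "of_int H \<le> H1 * norm \<omega>"
    proof -
      have "of_int BK \<le> c ^ D * \<bar>B\<bar> * norm \<omega> + 2" unfolding BK_def by linarith
      also have "\<dots> \<le> (c ^ D * \<bar>B\<bar> + 3) * norm \<omega>" using \<omega> by (simp add: algebra_simps)
      finally have "of_int S * of_int BK \<le> of_int S * ((c ^ D * \<bar>B\<bar> + 3) * norm \<omega>)"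
        using S0 by (intro mult_left_mono) auto
      moreover have "of_int Hm + 1 \<le> (of_int Hm + 1) * norm \<omega>"
        using Hm0 \<omega> mult_left_mono[of 1 "norm \<omega>" "of_int Hm + 1"] by simp
      ultimately show ?thesis by (simp add: H_def H1_def algebra_simps)
    qed
    have "cL / of_int H ^ e \<le> max (norm (ipoly m y)) (norm (ipoly q y))"
    proof (rule liouville)
      show "degree m + degree q \<le> degree m + D"
        using degree_quotient_poly[OF degP, of K] by (simp add: q_def D_def)
      show "1 \<le> H" using SBK Hm0 by (simp add: H_def)
      show "\<bar>coeff m k\<bar> \<le> H" for k using Hm[of k] SBK by (simp add: H_def)
      show "\<bar>coeff q k\<bar> \<le> H" for k
        using abs_coeff_quotient_poly[of P K BK k, OF K] Hm0 unfolding q_def H_def S_def D_def by linarith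
      show "\<not> (\<exists>z. ipoly m z = 0 \<and> ipoly q z = 0)" using m(2) nz by (auto simp: q_def)
    qed
    also have "\<dots> = norm (z 0)" by (simp add: m(1) z0 q_def)
    finally have lower0: "cL / of_int H ^ e \<le> norm (z 0)" .
    have "H \<ge> 1" using SBK Hm0 by (simp add: H_def)
    hence Hpos: "(of_int H :: real) > 0" by simp
    have HW: "(H1 * norm \<omega>) ^ e > 0" using HH Hpos by (intro zero_less_power) linarith
    have "of_int H ^ e \<le> (H1 * norm \<omega>) ^ e" using HH Hpos by (intro power_mono) auto
    hence "cL / (H1 * norm \<omega>) ^ e \<le> cL / of_int H ^ e"
      using HW Hpos cL by (intro divide_left_mono mult_pos_pos) auto
    hence lower: "cL / (H1 * norm \<omega>) ^ e \<le> norm (z 0)" using lower0 by linarith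
    have "norm y ^ (N - D) * (cL / (H1 * norm \<omega>) ^ e) \<le> E"
      using lower by (intro order_trans[OF _ upper] mult_left_mono) auto
    hence "norm y ^ (N - D) \<le> E * H1 ^ e / cL * norm \<omega> ^ e"
      using cL HW by (simp add: field_simps power_mult_distrib)
    moreover have "norm y ^ (N - D) > 0" using y by (intro zero_less_power) auto
    ultimately have "ln (norm y ^ (N - D)) \<le> ln (E * H1 ^ e / cL * norm \<omega> ^ e)" by (intro ln_mono) auto
    also have "\<dots> = ln (E * H1 ^ e / cL) + real e * l"
    proof -
      have "E * H1 ^ e / cL > 0" using E H1 cL by simp
      moreover have n0: "norm \<omega> > 0" using \<omega> by linarith
      ultimately have "ln (E * H1 ^ e / cL * norm \<omega> ^ e) = ln (E * H1 ^ e / cL) + ln (norm \<omega> ^ e)"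
        by (intro ln_mult_pos) auto
      thus ?thesis using n0 by (simp only: ln_realpow l_def)
    qed
    also have "\<dots> \<le> A0 + real e * l" by (simp add: A0_def)
    also have "\<dots> \<le> (A0 + real e) * (1 + l)" using l0 by (simp add: algebra_simps A0_def)
    finally have up: "real (N - D) * ln (norm y) \<le> (A0 + real e) * (1 + l)"
      using y by (simp add: ln_realpow)
    have "(real N - real D) \<ge> (A0 + real e + 1) / ln (norm y) * (1 + l)"
    proof -
      define Q where "Q = (A0 + real e + 1) / ln (norm y)"
      have "real D + 2 + Q * (1 + l) \<le> (real D + 2) * (1 + l) + Q * (1 + l)"
        using l0 by (intro add_right_mono) (simp add: algebra_simps)
      also have "\<dots> = C * (1 + l)" by (simp add: C_def Q_def distrib_right)
      also have "\<dots> < real N + 1" by (rule N(2))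
      finally show ?thesis unfolding Q_def[symmetric] by linarith
    qed
    hence "(real N - real D) * ln (norm y) \<ge> (A0 + real e + 1) / ln (norm y) * (1 + l) * ln (norm y)"
      using lny by (intro mult_right_mono) auto
    also have "(A0 + real e + 1) / ln (norm y) * (1 + l) * ln (norm y) = (A0 + real e + 1) * (1 + l)"
      using lny by simp
    finally have "(A0 + real e + 1) * (1 + l) \<le> real (N - D) * ln (norm y)"
      using ND by (simp add: of_nat_diff)
    with up have "(A0 + real e + 1) * (1 + l) \<le> (A0 + real e) * (1 + l)" by linarith
    thus False using l0 by (simp add: algebra_simps)
  qed
  show ?thesis using C0 goal by blast
qed

end

text \<open>The window after which \<open>\<omega> \<bullet> L ^ m v\<close> must have left a fixed neighbourhood of the integers,
  for one of the vectors \<open>v\<close>, is logarithmic in \<open>\<omega>\<close>.\<close>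

lemma exists_far_from_integers:
  fixes L :: "real^'d::finite \<Rightarrow> real^'d"
  assumes L: "linear L" and sim: "\<And>x. norm (L x) = c * norm x" and c: "c > 1"
    and np: "strongly_totally_non_pisot (complex_eigenvalues L)"
    and V: "finite V" "\<kappa> > 0" "\<And>\<omega> \<epsilon>. (\<forall>v\<in>V. \<bar>\<omega> \<bullet> v\<bar> \<le> \<epsilon>) \<Longrightarrow> norm \<omega> \<le> \<kappa> * \<epsilon>"
  shows "\<exists>\<delta>>0. \<exists>C>0. \<forall>\<omega>. norm \<omega> \<ge> 1 \<longrightarrow>
    (\<exists>m. \<exists>v\<in>V. real m \<le> C * (1 + ln (norm \<omega>)) \<and> (\<forall>k::int. \<bar>\<omega> \<bullet> (L ^^ m) v - of_int k\<bar> > \<delta>))"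
proof -
  have c0: "c > 0" using c by simp
  obtain P Y m where P: "degree P > 0" "\<And>x. x \<in> complex_eigenvalues L \<Longrightarrow> ipoly P x = 0" "finite Y"
    "\<And>y. y \<in> Y \<Longrightarrow> norm y > 1 \<and> y \<notin> complex_eigenvalues L \<and> ipoly P y = 0"
    "\<And>q. degree q < degree P \<Longrightarrow> (\<And>y. y \<in> Y \<Longrightarrow> ipoly q y = 0) \<Longrightarrow> q = 0"
    "\<And>y. y \<in> Y \<Longrightarrow> ipoly (m y) y = 0"
    "\<And>y q z. y \<in> Y \<Longrightarrow> ipoly (m y) z = 0 \<Longrightarrow> ipoly q z = 0 \<Longrightarrow> ipoly q y = 0"
  proof (rule integer_annihilator[OF np finite_complex_eigenvalues complex_eigenvalues_nonempty[OF L sim c0]], goal_cases)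
    case prems: (1 P Y m)
    show ?case by (rule prems(1)[OF prems(2-8)])
  qed
  define S where "S = (\<Sum>k\<le>degree P. \<bar>of_int (coeff P k)\<bar> :: real)"
  have S0: "S \<ge> 0" by (simp add: S_def sum_nonneg)
  (* S is for rounding errors in the recurrence, \<kappa> forces norm \<omega> < 1 in the end *)
  define \<delta> where "\<delta> = 1 / (S + \<kappa> + 1)"
  have \<delta>: "0 < \<delta>" "\<delta> \<le> 1" "\<delta> * S < 1" "\<kappa> * \<delta> < 1"
    using S0 V(2) by (auto simp: \<delta>_def field_simps)
  define B where "B = (\<Sum>v\<in>V. norm v)"
  have B: "norm v \<le> B" if "v \<in> V" for v
    unfolding B_def using V(1) that by (intro member_le_sum) auto
  interpret R: integer_recurrence L c P \<delta> B
    by (rule integer_recurrence.intro) (use L sim c P(1,2) \<delta>(1-3) in \<open>simp_all add: S_def\<close>)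
  have "\<forall>y\<in>Y. \<exists>C>0. \<forall>\<omega> K v. norm \<omega> \<ge> 1 \<longrightarrow> norm v \<le> B \<longrightarrow>
     (\<forall>n. real n \<le> C * (1 + ln (norm \<omega>)) \<longrightarrow> \<bar>\<omega> \<bullet> (L ^^ n) v - of_int (K n)\<bar> \<le> \<delta>) \<longrightarrow>
     ipoly (quotient_poly P K) y = 0"
  proof
    fix y assume y: "y \<in> Y"
    show "\<exists>C>0. \<forall>\<omega> K v. norm \<omega> \<ge> 1 \<longrightarrow> norm v \<le> B \<longrightarrow>
     (\<forall>n. real n \<le> C * (1 + ln (norm \<omega>)) \<longrightarrow> \<bar>\<omega> \<bullet> (L ^^ n) v - of_int (K n)\<bar> \<le> \<delta>) \<longrightarrow>
     ipoly (quotient_poly P K) y = 0"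
    proof (rule R.quotient_poly_nearest_integers_eq_0)
      show "norm y > 1" "y \<notin> complex_eigenvalues L" "ipoly P y = 0" using P(4)[OF y] by auto
      show "ipoly (m y) y = 0" by (rule P(6)[OF y])
      show "ipoly q y = 0" if "ipoly (m y) z = 0" "ipoly q z = 0" for q z using P(7)[OF y that] .
    qed
  qed
  from bchoice[OF this] obtain Cy where Cy': "\<forall>y\<in>Y. Cy y > 0 \<and> (\<forall>\<omega> K v. norm \<omega> \<ge> 1 \<longrightarrow> norm v \<le> B \<longrightarrow>
     (\<forall>n. real n \<le> Cy y * (1 + ln (norm \<omega>)) \<longrightarrow> \<bar>\<omega> \<bullet> (L ^^ n) v - of_int (K n)\<bar> \<le> \<delta>) \<longrightarrow>
     ipoly (quotient_poly P K) y = 0)" by blast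
  have Cy: "y \<in> Y \<Longrightarrow> Cy y > 0"
    "y \<in> Y \<Longrightarrow> norm \<omega> \<ge> 1 \<Longrightarrow> norm v \<le> B \<Longrightarrow>
     (\<forall>n. real n \<le> Cy y * (1 + ln (norm \<omega>)) \<longrightarrow> \<bar>\<omega> \<bullet> (L ^^ n) v - of_int (K n)\<bar> \<le> \<delta>) \<Longrightarrow>
     ipoly (quotient_poly P K) y = 0" for y \<omega> K v
    using Cy' by blast+
  define C where "C = 1 + (\<Sum>y\<in>Y. Cy y)"
  have Cy_le: "Cy y \<le> C" if "y \<in> Y" for y
    using member_le_sum[of y Y Cy] that P(3) Cy(1) unfolding C_def by (smt (verit) DiffD1)
  have C0: "C > 0" unfolding C_def using Cy(1) by (intro add_pos_nonneg sum_nonneg) (auto intro: less_imp_le)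
  have "\<exists>m. \<exists>v\<in>V. real m \<le> C * (1 + ln (norm \<omega>)) \<and> (\<forall>k::int. \<bar>\<omega> \<bullet> (L ^^ m) v - of_int k\<bar> > \<delta>)"
    if \<omega>: "norm \<omega> \<ge> 1" for \<omega>
  proof (rule ccontr)
    assume "\<not> ?thesis"
    hence "\<And>m v. v \<in> V \<Longrightarrow> real m \<le> C * (1 + ln (norm \<omega>)) \<Longrightarrow> \<exists>k::int. \<bar>\<omega> \<bullet> (L ^^ m) v - of_int k\<bar> \<le> \<delta>"
      by (meson not_less)
    then have "\<forall>v n. \<exists>k::int. v \<in> V \<and> real n \<le> C * (1 + ln (norm \<omega>)) \<longrightarrow> \<bar>\<omega> \<bullet> (L ^^ n) v - of_int k\<bar> \<le> \<delta>"
      by blast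
    then obtain K where K: "\<And>v n. v \<in> V \<Longrightarrow> real n \<le> C * (1 + ln (norm \<omega>)) \<Longrightarrow>
        \<bar>\<omega> \<bullet> (L ^^ n) v - of_int (K v n :: int)\<bar> \<le> \<delta>"
      by metis
    have "\<bar>\<omega> \<bullet> v\<bar> \<le> \<delta>" if v: "v \<in> V" for v
    proof -
      have "quotient_poly P (K v) = 0"
      proof (rule P(5))
        show "degree (quotient_poly P (K v)) < degree P" by (rule degree_quotient_poly[OF P(1)])
        fix y assume y: "y \<in> Y"
        have "Cy y * (1 + ln (norm \<omega>)) \<le> C * (1 + ln (norm \<omega>))"
          using Cy_le[OF y] \<omega> by (intro mult_right_mono) auto
        thus "ipoly (quotient_poly P (K v)) y = 0"
          using K[OF v] by (intro Cy(2)[OF y \<omega> B[OF v]]) auto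
      qed
      hence "lead_coeff P * K v 0 = 0"
        using lead_coeff_quotient_poly[OF P(1), of "K v"] by simp
      moreover have "lead_coeff P \<noteq> 0" using P(1) by auto
      ultimately have "K v 0 = 0" by simp
      moreover have "0 \<le> C * (1 + ln (norm \<omega>))" using C0 \<omega> by simp
      ultimately show ?thesis using K[OF v, of 0] by simp
    qed
    hence "norm \<omega> \<le> \<kappa> * \<delta>" using V(3) by blast
    thus False using \<delta>(4) \<omega> by linarith
  qed
  thus ?thesis using \<delta>(1) C0 by blast
qed

section \<open>Supertiles\<close>

lemma shift_shift: "shift a (shift b t) = shift (a + b) t"
  by (auto simp: shift_def image_image add_ac)

lemma shift_0 [simp]: "shift 0 t = t"
  by (simp add: shift_def)

lemma in_shift_image_iff: "t \<in> shift a ` X \<longleftrightarrow> shift (- a) t \<in> X"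
proof
  assume "shift (- a) t \<in> X"
  hence "shift a (shift (- a) t) \<in> shift a ` X" by blast
  thus "t \<in> shift a ` X" by (simp add: shift_shift)
qed (auto simp: shift_shift)

locale self_similar_substitution =
  fixes T :: "'m::finite \<Rightarrow> 'd::finite tile"
    and \<zeta> :: "'m \<Rightarrow> 'd tile set"
    and L :: "real^'d \<Rightarrow> real^'d"
    and c :: real
  assumes alph: "alphabet T"
    and subst: "substitution T \<zeta> L"
    and prim: "primitive_matrix (substitution_matrix T \<zeta>)"
    and c: "c > 1"
    and sim: "\<And>x. norm (L x) = c * norm x"
begin

lemma linear_L: "linear L"
  using subst by (simp add: substitution_def)

lemma linear_Ln: "linear (L ^^ n)"
proof (induction n)
  case (Suc n)
  show ?case using linear_compose[OF Suc linear_L] by (simp add: o_def)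
qed (simp add: linear_ident)

lemma norm_Ln: "norm ((L ^^ n) x) = c ^ n * norm x"
  using norm_similarity_power[of L c] sim by blast

lemma inj_Ln: "inj (L ^^ n)"
  using linear_injective_0[OF linear_Ln] norm_Ln c
  by (metis less_numeral_extra(1) mult_eq_0_iff norm_eq_zero not_less_iff_gr_or_eq order.strict_trans power_not_zero)

lemma bij_Ln: "bij (L ^^ n)"
  using inj_Ln linear_injective_imp_surjective[OF linear_Ln inj_Ln] by (simp add: bij_def)

lemma L_add: "L (x + y) = L x + L y" and L_diff: "L (x - y) = L x - L y" and L_0 [simp]: "L 0 = 0"
  using linear_add[OF linear_L] linear_diff[OF linear_L] linear_0[OF linear_L] by auto

lemma Ln_add: "(L ^^ n) (x + y) = (L ^^ n) x + (L ^^ n) y"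
  and Ln_diff: "(L ^^ n) (x - y) = (L ^^ n) x - (L ^^ n) y"
  using linear_add[OF linear_Ln] linear_diff[OF linear_Ln] by auto

abbreviation supp :: "'m \<Rightarrow> (real^'d) set" where "supp i \<equiv> fst (T i)"

lemma compact_supp: "compact (supp i)" and supp_closure: "supp i = closure (interior (supp i))"
  and zero_interior: "0 \<in> interior (supp i)" and punc_0: "snd (T i) = 0"
  using alph unfolding alphabet_def tile_def by (metis)+

lemma zero_supp: "0 \<in> supp i"
  using zero_interior interior_subset by blast

lemma shift_T_eq_iff: "shift p (T i) = shift q (T j) \<longleftrightarrow> i = j \<and> p = q"
proof
  assume eq: "shift p (T i) = shift q (T j)"
  hence "shift (- p) (shift p (T i)) = shift (- p) (shift q (T j))" by simp
  hence "T i = shift (- p + q) (T j)" by (simp add: shift_shift)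
  hence "i = j" using alph by (auto simp: alphabet_def)
  moreover have "snd (shift p (T i)) = snd (shift q (T j))" using eq by simp
  ultimately show "i = j \<and> p = q" by (simp add: shift_def punc_0)
qed simp

lemma fst_shift_T: "x \<in> fst (shift p (T i)) \<longleftrightarrow> x - p \<in> supp i"
  unfolding shift_def by (auto simp: image_iff intro!: bexI[of _ "x - p"])

lemma interior_shift_T: "x \<in> interior (fst (shift p (T i))) \<longleftrightarrow> x - p \<in> interior (supp i)"
proof -
  have "(\<lambda>x. x + p) ` supp i = (+) p ` supp i" by (simp add: add.commute)
  hence "interior (fst (shift p (T i))) = (+) p ` interior (supp i)"
    by (simp add: shift_def interior_translation)
  thus ?thesis by (auto simp: image_iff intro!: bexI[of _ "x - p"])
qed

text \<open>The pair \<open>(i, p)\<close> stands for the tile \<open>T i + p\<close>.\<close>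

definition supertile :: "nat \<Rightarrow> 'm \<Rightarrow> ('m \<times> (real^'d)) set" where
  "supertile n j = {(i, p). shift p (T i) \<in> (subst_ext T \<zeta> L ^^ n) {T j}}"

definition step :: "'m \<Rightarrow> ('m \<times> (real^'d)) set" where
  "step j = {(i, p). shift p (T i) \<in> \<zeta> j}"

lemma in_subst_ext_iff:
  "t \<in> subst_ext T \<zeta> L X \<longleftrightarrow> (\<exists>i s. shift s (T i) \<in> X \<and> shift (- L s) t \<in> \<zeta> i)"
  by (auto simp: subst_ext_def in_shift_image_iff)

lemma supertile_0: "supertile 0 j = {(j, 0)}"
  using shift_T_eq_iff[of _ _ 0 j] by (auto simp: supertile_def)

lemma in_supertile_Suc_iff:
  "(i, p) \<in> supertile (Suc n) j \<longleftrightarrow> (\<exists>i' p'. (i', p') \<in> supertile n j \<and> (i, p - L p') \<in> step i')"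
  by (auto simp: supertile_def step_def in_subst_ext_iff shift_shift)

lemma supertile_SucI:
  "(i', p') \<in> supertile n j \<Longrightarrow> (i, q) \<in> step i' \<Longrightarrow> (i, L p' + q) \<in> supertile (Suc n) j"
  unfolding in_supertile_Suc_iff by (intro exI[of _ i'] exI[of _ p']) simp

lemma in_supertile_add_iff:
  "(i, p) \<in> supertile (n + k) j \<longleftrightarrow> (\<exists>i' p'. (i', p') \<in> supertile k j \<and> (i, p - (L ^^ n) p') \<in> supertile n i')"
proof (induction n arbitrary: i p)
  case 0
  show ?case by (auto simp: supertile_0)
next
  case (Suc n)
  have "(i, p) \<in> supertile (Suc n + k) j \<longleftrightarrow>
     (\<exists>i1 p1 i' p'. (i', p') \<in> supertile k j \<and> (i1, p1 - (L ^^ n) p') \<in> supertile n i' \<and> (i, p - L p1) \<in> step i1)"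
    by (simp add: in_supertile_Suc_iff Suc) blast
  also have "\<dots> \<longleftrightarrow> (\<exists>i' p'. (i', p') \<in> supertile k j \<and>
      (\<exists>i1 p2. (i1, p2) \<in> supertile n i' \<and> (i, p - (L ^^ Suc n) p' - L p2) \<in> step i1))"
    (is "?A \<longleftrightarrow> ?B")
  proof
    assume ?A
    then obtain i1 p1 i' p' where *: "(i', p') \<in> supertile k j" "(i1, p1 - (L ^^ n) p') \<in> supertile n i'"
      "(i, p - L p1) \<in> step i1" by blast
    have "p - (L ^^ Suc n) p' - L (p1 - (L ^^ n) p') = p - L p1" by (simp add: L_diff)
    with * show ?B by metis
  next
    assume ?B
    then obtain i' p' i1 p2 where *: "(i', p') \<in> supertile k j" "(i1, p2) \<in> supertile n i'"
      "(i, p - (L ^^ Suc n) p' - L p2) \<in> step i1" by blast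
    have "(i1, ((L ^^ n) p' + p2) - (L ^^ n) p') \<in> supertile n i'" using * by simp
    moreover have "(i, p - L ((L ^^ n) p' + p2)) \<in> step i1" using * by (simp add: L_add algebra_simps)
    ultimately show ?A using *(1) by blast
  qed
  finally show ?case by (simp add: in_supertile_Suc_iff)
qed

lemma supertile_addI:
  "(i', p') \<in> supertile k j \<Longrightarrow> (i, q) \<in> supertile n i' \<Longrightarrow> (i, (L ^^ n) p' + q) \<in> supertile (n + k) j"
  unfolding in_supertile_add_iff by force

lemma finite_supertile: "finite (supertile n j)"
proof (induction n)
  case (Suc n)
  have fs: "finite (step i)" for i
  proof -
    have "finite (\<zeta> i)" using subst by (simp add: substitution_def patch_def)
    moreover have "(\<lambda>(i, p). shift p (T i)) ` step i \<subseteq> \<zeta> i" by (auto simp: step_def)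
    moreover have "inj_on (\<lambda>(i, p). shift p (T i)) (step i)"
      by (auto simp: inj_on_def shift_T_eq_iff)
    ultimately show ?thesis using finite_imageD finite_subset by blast
  qed
  have "supertile (Suc n) j \<subseteq> (\<Union>(i', p')\<in>supertile n j. (\<lambda>(i, q). (i, L p' + q)) ` step i')"
  proof
    fix x assume "x \<in> supertile (Suc n) j"
    then obtain i p i' p' where x: "x = (i, p)" "(i', p') \<in> supertile n j" "(i, p - L p') \<in> step i'"
      by (cases x) (auto simp: in_supertile_Suc_iff)
    hence "x \<in> (\<lambda>(i, q). (i, L p' + q)) ` step i'"
      by (auto simp: image_iff intro!: bexI[of _ "(i, p - L p')"])
    thus "x \<in> (\<Union>(i', p')\<in>supertile n j. (\<lambda>(i, q). (i, L p' + q)) ` step i')" using x(2) by blast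
  qed
  thus ?case by (rule finite_subset) (use Suc fs in auto)
qed (simp add: supertile_0)

lemma supertile_supp: "(\<exists>(i, p)\<in>supertile n j. x - p \<in> supp i) \<longleftrightarrow> x \<in> (L ^^ n) ` supp j"
proof (induction n arbitrary: x)
  case 0
  show ?case by (simp add: supertile_0)
next
  case (Suc n)
  have st: "(\<exists>(i, p)\<in>step j. x - p \<in> supp i) \<longleftrightarrow> x \<in> L ` supp j" for x j
  proof -
    have eq: "psupp (\<zeta> j) = L ` supp j" and oa: "over_alphabet T (\<zeta> j)"
      using subst by (auto simp: substitution_def)
    have "(\<exists>(i, p)\<in>step j. x - p \<in> supp i) \<longleftrightarrow> (\<exists>t\<in>\<zeta> j. x \<in> fst t)"
    proof
      assume "\<exists>(i, p)\<in>step j. x - p \<in> supp i"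
      then obtain i p where "shift p (T i) \<in> \<zeta> j" "x \<in> fst (shift p (T i))"
        by (auto simp: step_def fst_shift_T)
      thus "\<exists>t\<in>\<zeta> j. x \<in> fst t" by blast
    next
      assume "\<exists>t\<in>\<zeta> j. x \<in> fst t"
      then obtain t i p where "t \<in> \<zeta> j" "x \<in> fst t" "t = shift p (T i)"
        using oa unfolding over_alphabet_def by blast
      hence "(i, p) \<in> step j" "x - p \<in> supp i" by (simp_all add: step_def fst_shift_T)
      thus "\<exists>(i, p)\<in>step j. x - p \<in> supp i" by blast
    qed
    also have "\<dots> \<longleftrightarrow> x \<in> psupp (\<zeta> j)" by (simp add: psupp_def)
    finally show ?thesis using eq by simp
  qed
  have "(\<exists>(i, p)\<in>supertile (Suc n) j. x - p \<in> supp i) \<longleftrightarrow>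
      (\<exists>(i', p')\<in>supertile n j. \<exists>(i, q)\<in>step i'. x - L p' - q \<in> supp i)" (is "?A \<longleftrightarrow> ?B")
  proof
    assume ?A
    then obtain i p i' p' where "x - p \<in> supp i" "(i', p') \<in> supertile n j" "(i, p - L p') \<in> step i'"
      by (auto simp: in_supertile_Suc_iff)
    thus ?B by (intro bexI[of _ "(i', p')"]) (auto intro!: bexI[of _ "(i, p - L p')"])
  next
    assume ?B
    then obtain i q i' p' where *: "x - L p' - q \<in> supp i" "(i', p') \<in> supertile n j" "(i, q) \<in> step i'"
      by auto
    hence "(i, L p' + q) \<in> supertile (Suc n) j" by (intro supertile_SucI)
    thus ?A using * by (intro bexI[of _ "(i, L p' + q)"]) (auto simp: algebra_simps)
  qed
  also have "\<dots> \<longleftrightarrow> (\<exists>(i', p')\<in>supertile n j. x - L p' \<in> L ` supp i')"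
    using st by simp
  also have "\<dots> \<longleftrightarrow> (\<exists>y. x = L y \<and> (\<exists>(i', p')\<in>supertile n j. y - p' \<in> supp i'))"
  proof -
    have "x - L p' \<in> L ` supp i' \<longleftrightarrow> (\<exists>y. x = L y \<and> y - p' \<in> supp i')" for p' i'
    proof
      assume "x - L p' \<in> L ` supp i'"
      then obtain z where z: "z \<in> supp i'" "x - L p' = L z" by blast
      hence "x = L (p' + z)" by (simp add: L_add algebra_simps)
      thus "\<exists>y. x = L y \<and> y - p' \<in> supp i'" using z by (intro exI[of _ "p' + z"]) auto
    next
      assume "\<exists>y. x = L y \<and> y - p' \<in> supp i'"
      then obtain y where y: "x = L y" "y - p' \<in> supp i'" by blast
      hence "x - L p' = L (y - p')" by (simp add: L_diff)
      thus "x - L p' \<in> L ` supp i'" using y by blast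
    qed
    thus ?thesis by auto
  qed
  also have "\<dots> \<longleftrightarrow> x \<in> (L ^^ Suc n) ` supp j"
    unfolding Suc by auto
  finally show ?case .
qed

lemma supertile_interior_subset:
  assumes "(i, p) \<in> supertile n j" "x - p \<in> interior (supp i)"
  shows "x \<in> (L ^^ n) ` interior (supp j)"
proof -
  have "(+) p ` interior (supp i) \<subseteq> (L ^^ n) ` supp j"
  proof
    fix y assume "y \<in> (+) p ` interior (supp i)"
    then obtain z where "y = p + z" "z \<in> interior (supp i)" by blast
    hence "y - p \<in> supp i" using interior_subset by auto
    thus "y \<in> (L ^^ n) ` supp j" using assms(1) supertile_supp[of n j y] by auto
  qed
  hence "(+) p ` interior (supp i) \<subseteq> interior ((L ^^ n) ` supp j)"
    by (intro interior_maximal open_translation) auto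
  also have "\<dots> = (L ^^ n) ` interior (supp j)"
    by (rule interior_bijective_linear_image[OF linear_Ln bij_Ln])
  finally have "(+) p ` interior (supp i) \<subseteq> (L ^^ n) ` interior (supp j)" .
  moreover have "x \<in> (+) p ` interior (supp i)"
    using assms(2) by (auto simp: image_iff intro!: bexI[of _ "x - p"])
  ultimately show ?thesis by blast
qed

text \<open>By induction on the level: a common interior point of two tiles is interior to the images of the two tiles
  they stem from, so these coincide, and the tiles belong to one patch \<open>\<zeta> i\<close>.\<close>

lemma supertile_disjoint:
  assumes "(i, p) \<in> supertile n j" "(i', p') \<in> supertile n j"
    and "x - p \<in> interior (supp i)" "x - p' \<in> interior (supp i')"
  shows "(i, p) = (i', p')"
  using assms
proof (induction n arbitrary: i p i' p' x)
  case 0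
  thus ?case by (simp add: supertile_0)
next
  case (Suc n)
  obtain i1 p1 where 1: "(i1, p1) \<in> supertile n j" "(i, p - L p1) \<in> step i1"
    using Suc.prems(1) by (auto simp: in_supertile_Suc_iff)
  obtain i2 p2 where 2: "(i2, p2) \<in> supertile n j" "(i', p' - L p2) \<in> step i2"
    using Suc.prems(2) by (auto simp: in_supertile_Suc_iff)
  have s1: "step i = supertile 1 i" for i
    by (auto simp: in_supertile_Suc_iff supertile_0)
  have "x - L p1 \<in> L ` interior (supp i1)"
    using supertile_interior_subset[of i "p - L p1" 1 i1 "x - L p1"] 1 Suc.prems by (simp add: s1)
  then obtain y1 where y1: "y1 \<in> interior (supp i1)" "x - L p1 = L y1" by blast
  have "x - L p2 \<in> L ` interior (supp i2)"
    using supertile_interior_subset[of i' "p' - L p2" 1 i2 "x - L p2"] 2 Suc.prems by (simp add: s1)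
  then obtain y2 where y2: "y2 \<in> interior (supp i2)" "x - L p2 = L y2" by blast
  have "L (p1 + y1) = L (p2 + y2)" using y1(2) y2(2) by (simp add: L_add algebra_simps)
  hence eq: "p1 + y1 = p2 + y2" using inj_Ln[of 1] by (auto dest: injD)
  have "(p1 + y1) - p1 \<in> interior (supp i1)" "(p1 + y1) - p2 \<in> interior (supp i2)"
    using y1(1) y2(1) by (simp, simp add: eq)
  from Suc.IH[OF 1(1) 2(1) this] have "(i1, p1) = (i2, p2)" .
  hence eq2: "i1 = i2" "p1 = p2" by auto
  let ?t = "shift (p - L p1) (T i)" and ?t' = "shift (p' - L p1) (T i')"
  have "?t \<in> \<zeta> i1" "?t' \<in> \<zeta> i1" using 1(2) 2(2) eq2 by (auto simp: step_def)
  moreover have "x - L p1 \<in> interior (fst ?t)" "x - L p1 \<in> interior (fst ?t')"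
    using Suc.prems(3,4) by (simp_all only: interior_shift_T) auto
  moreover have "patch (\<zeta> i1)" using subst by (simp add: substitution_def)
  ultimately have "?t = ?t'" unfolding patch_def by blast
  thus ?case by (simp add: shift_T_eq_iff)
qed

text \<open>Interiors of distinct tiles are disjoint, and a tile is the closure of its interior; so a point
  of an interior belongs to no other tile.\<close>

lemma supertile_interior_unique:
  assumes "(i, p) \<in> supertile n j" "(i', p') \<in> supertile n j"
    and "x - p \<in> interior (supp i)" "x - p' \<in> supp i'"
  shows "(i, p) = (i', p')"
proof -
  have "open ((+) (p - p') ` interior (supp i))" by (intro open_translation) auto
  moreover have "x - p' \<in> (+) (p - p') ` interior (supp i)"
    using assms(3) by (auto simp: image_iff intro!: bexI[of _ "x - p"])
  moreover have "x - p' \<in> closure (interior (supp i'))" using assms(4) supp_closure by blast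
  ultimately have "(+) (p - p') ` interior (supp i) \<inter> interior (supp i') \<noteq> {}"
    by (metis disjoint_iff open_Int_closure_eq_empty)
  then obtain z where z: "z \<in> interior (supp i)" "p - p' + z \<in> interior (supp i')" by blast
  have "(p + z) - p \<in> interior (supp i)" "(p + z) - p' \<in> interior (supp i')"
    using z by (simp_all add: algebra_simps)
  from supertile_disjoint[OF assms(1,2) this] show ?thesis .
qed

lemma inj_on_supertile_add:
  "inj_on (\<lambda>((i', p'), (i, q)). (i, (L ^^ n) p' + q)) (SIGMA (i', p'):supertile k j. supertile n i')"
proof (rule inj_onI, clarsimp)
  fix i1 p1 i2 p2 i q q'
  assume 1: "(i1, p1) \<in> supertile k j" "(i, q) \<in> supertile n i1"
    and 2: "(i2, p2) \<in> supertile k j" "(i, q') \<in> supertile n i2"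
    and eq: "(L ^^ n) p1 + q = (L ^^ n) p2 + q'"
  obtain y1 where y1: "y1 \<in> interior (supp i1)" "q = (L ^^ n) y1"
    using supertile_interior_subset[OF 1(2), of q] zero_interior by auto
  obtain y2 where y2: "y2 \<in> interior (supp i2)" "q' = (L ^^ n) y2"
    using supertile_interior_subset[OF 2(2), of q'] zero_interior by auto
  have "(L ^^ n) (p1 + y1) = (L ^^ n) (p2 + y2)" using eq y1 y2 by (simp add: Ln_add)
  hence eq': "p1 + y1 = p2 + y2" using inj_Ln by (auto dest: injD)
  have "(p1 + y1) - p1 \<in> interior (supp i1)" "(p1 + y1) - p2 \<in> interior (supp i2)"
    using y1(1) y2(1) by (simp, simp add: eq')
  from supertile_disjoint[OF 1(1) 2(1) this] have "(i1, p1) = (i2, p2)" .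
  thus "i1 = i2 \<and> p1 = p2 \<and> q = q'" using eq by simp
qed

lemma supertile_add_image:
  "supertile (n + k) j = (\<lambda>((i', p'), (i, q)). (i, (L ^^ n) p' + q)) ` (SIGMA (i', p'):supertile k j. supertile n i')"
proof (intro set_eqI iffI)
  fix x assume "x \<in> supertile (n + k) j"
  then obtain i p i' p' where x: "x = (i, p)" "(i', p') \<in> supertile k j" "(i, p - (L ^^ n) p') \<in> supertile n i'"
    by (cases x) (auto simp: in_supertile_add_iff)
  thus "x \<in> (\<lambda>((i', p'), (i, q)). (i, (L ^^ n) p' + q)) ` (SIGMA (i', p'):supertile k j. supertile n i')"
    by (intro image_eqI[of _ _ "((i', p'), (i, p - (L ^^ n) p'))"]) auto
qed (auto intro: supertile_addI)

lemma sum_supertile_add: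
  fixes g :: "'m \<times> (real^'d) \<Rightarrow> 'a::comm_monoid_add"
  shows "(\<Sum>t\<in>supertile (n + k) j. g t) = (\<Sum>(i', p')\<in>supertile k j. \<Sum>(i, q)\<in>supertile n i'. g (i, (L ^^ n) p' + q))"
proof -
  have "(\<Sum>t\<in>supertile (n + k) j. g t) =
      (\<Sum>((i', p'), (i, q))\<in>(SIGMA (i', p'):supertile k j. supertile n i'). g (i, (L ^^ n) p' + q))"
    unfolding supertile_add_image by (subst sum.reindex[OF inj_on_supertile_add]) (simp add: o_def case_prod_beta)
  also have "\<dots> = (\<Sum>x\<in>supertile k j. \<Sum>y\<in>(case x of (i', p') \<Rightarrow> supertile n i').
      (case (x, y) of ((i', p'), (i, q)) \<Rightarrow> g (i, (L ^^ n) p' + q)))"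
    by (subst sum.Sigma) (auto simp: finite_supertile case_prod_beta)
  also have "\<dots> = (\<Sum>(i', p')\<in>supertile k j. \<Sum>(i, q)\<in>supertile n i'. g (i, (L ^^ n) p' + q))"
    by (simp add: case_prod_beta)
  finally show ?thesis .
qed

lemma primitive_supertile: "\<exists>k>0. \<forall>i j. \<exists>p. (i, p) \<in> supertile k j"
proof -
  define M where "M = substitution_matrix T \<zeta>"
  obtain k where k: "k > 0" "\<And>i j. (((**) M ^^ k) (mat 1)) $ i $ j > 0"
    using prim by (auto simp: primitive_matrix_def M_def)
  have occ: "\<exists>p. (i, p) \<in> supertile n j" if "(((**) M ^^ n) (mat 1)) $ i $ j > 0" for n i j
    using that
  proof (induction n arbitrary: i)
    case 0
    thus ?case by (auto simp: mat_def supertile_0 split: if_splits)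
  next
    case (Suc n)
    define N where "N = ((**) M ^^ n) (mat 1)"
    have "(M ** N) $ i $ j > 0" using Suc.prems by (simp add: N_def)
    hence "(\<Sum>l\<in>UNIV. M $ i $ l * N $ l $ j) > 0" by (simp add: matrix_matrix_mult_def)
    then obtain l where l: "M $ i $ l * N $ l $ j > 0"
      by (metis (no_types, lifting) bot_nat_0.not_eq_extremum sum.neutral)
    then obtain p' where p': "(l, p') \<in> supertile n j" using Suc.IH[of l] by (auto simp: N_def)
    have "card {t \<in> \<zeta> l. \<exists>s. t = shift s (T i)} > 0"
      using l by (simp add: M_def substitution_matrix_def)
    hence "{t \<in> \<zeta> l. \<exists>s. t = shift s (T i)} \<noteq> {}" by (metis card.empty less_irrefl)
    then obtain q where "(i, q) \<in> step l" by (auto simp: step_def)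
    hence "(i, L p' + q) \<in> supertile (Suc n) j" by (rule supertile_SucI[OF p'])
    thus ?case by blast
  qed
  show ?thesis using k(1) by (intro exI[of _ k] conjI allI occ[OF k(2)])
qed

lemma supp_bounded: "\<exists>D>0. \<forall>i. supp i \<subseteq> cball 0 D"
proof -
  have "\<forall>i. \<exists>D>0. supp i \<subseteq> cball 0 D"
  proof
    fix i
    obtain b where "b > 0" "\<forall>x\<in>supp i. norm x \<le> b"
      using compact_imp_bounded[OF compact_supp, of i] unfolding bounded_pos by blast
    thus "\<exists>D>0. supp i \<subseteq> cball 0 D" by (intro exI[of _ b]) auto
  qed
  then obtain D where D: "\<And>i. D i > 0" "\<And>i. supp i \<subseteq> cball 0 (D i)" by metis
  have "supp i \<subseteq> cball 0 (\<Sum>i\<in>UNIV. D i)" for i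
  proof -
    have "D i \<le> (\<Sum>i\<in>UNIV. D i)" using D(1) by (intro member_le_sum) (auto intro: less_imp_le)
    thus ?thesis using D(2)[of i] by (meson order_trans subset_cball)
  qed
  moreover have "(\<Sum>i\<in>UNIV. D i) > 0" using D(1) by (intro sum_pos) auto
  ultimately show ?thesis by blast
qed

definition radius :: real where "radius = (SOME D. D > 0 \<and> (\<forall>i. supp i \<subseteq> cball 0 D))"

lemma radius_pos: "radius > 0" and supp_le_radius: "x \<in> supp i \<Longrightarrow> norm x \<le> radius"
  using someI_ex[OF supp_bounded] unfolding radius_def by (auto simp: subset_iff)

lemma supertile_supp_norm:
  assumes "(i, p) \<in> supertile n j" "x - p \<in> supp i" shows "norm x \<le> c ^ n * radius"
proof -
  have "x \<in> (L ^^ n) ` supp j" using assms supertile_supp[of n j x] by auto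
  then obtain y where "y \<in> supp j" "x = (L ^^ n) y" by blast
  thus ?thesis using supp_le_radius[of y j] c by (simp add: norm_Ln mult_left_mono)
qed

text \<open>In a large supertile, tiles of a fixed type are found near every point.  Differences of their
  positions approximate a large multiple of each coordinate vector, so these finitely many
  return vectors span the space, with a bound; by primitivity they occur in every supertile of some level.\<close>

lemma return_vectors:
  "\<exists>k i0 V \<kappa>. finite V \<and> \<kappa> > 0 \<and> (\<forall>\<omega> \<epsilon>. (\<forall>v\<in>V. \<bar>\<omega> \<bullet> v\<bar> \<le> \<epsilon>) \<longrightarrow> norm \<omega> \<le> \<kappa> * \<epsilon>) \<and>
     (\<forall>j. \<forall>v\<in>V. \<exists>p. (i0, p) \<in> supertile k j \<and> (i0, p + v) \<in> supertile k j) \<and>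
     (\<forall>i j. \<exists>p. (i, p) \<in> supertile k j)"
proof -
  obtain k0 where k0: "k0 > 0" "\<And>i j. \<exists>p. (i, p) \<in> supertile k0 j" using primitive_supertile by blast
  define i0 :: 'm where "i0 = undefined"
  define D' where "D' = 2 * radius * c ^ k0"
  have D': "D' > 0" using radius_pos c by (simp add: D'_def)
  define d where "d = real CARD('d)"
  have d: "d \<ge> 1" by (simp add: d_def Suc_le_eq)
  obtain \<rho> where \<rho>: "\<rho> > 0" "cball 0 \<rho> \<subseteq> supp i0"
    using zero_interior[of i0] by (meson mem_interior_cball)
  (* the errors D' of the positions must not spoil the approximate directions R axis b *)
  have "\<exists>m. 4 * d * D' / \<rho> < c ^ m" using c by (rule real_arch_pow)
  then obtain m where m: "4 * d * D' / \<rho> < c ^ m" by blast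
  define n where "n = k0 + m"
  define R where "R = \<rho> * c ^ n"
  have "c ^ m \<le> c ^ n" using c by (intro power_increasing) (auto simp: n_def)
  hence "4 * d * D' / \<rho> < c ^ n" using m by linarith
  hence R: "R > 4 * d * D'" using \<rho> by (simp add: R_def field_simps)
  have R0: "R > 0" using R d D' by (smt (verit) mult_pos_pos)
  have near: "\<exists>p. (i0, p) \<in> supertile n i0 \<and> norm (x - p) \<le> D'" if x: "norm x \<le> R" for x
  proof -
    obtain y where y: "x = (L ^^ n) y" using bij_Ln[of n] by (metis bij_pointE)
    have "c ^ n * norm y \<le> c ^ n * \<rho>" using x by (simp add: y norm_Ln R_def mult.commute)
    hence "norm y \<le> \<rho>" using c by (subst (asm) mult_le_cancel_left_pos) auto
    hence "y \<in> supp i0" using \<rho>(2) by auto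
    hence "(L ^^ m) y \<in> (L ^^ m) ` supp i0" by blast
    then obtain i1 p1 where 1: "(i1, p1) \<in> supertile m i0" "(L ^^ m) y - p1 \<in> supp i1"
      using supertile_supp[of m i0 "(L ^^ m) y"] by auto
    obtain q where q: "(i0, q) \<in> supertile k0 i1" using k0(2) by blast
    have "(i0, (L ^^ k0) p1 + q) \<in> supertile n i0" unfolding n_def by (rule supertile_addI[OF 1(1) q])
    moreover have "norm (x - ((L ^^ k0) p1 + q)) \<le> D'"
    proof -
      have "x - ((L ^^ k0) p1 + q) = (L ^^ k0) ((L ^^ m) y - p1) - q"
        by (simp add: y n_def funpow_add Ln_diff)
      also have "norm \<dots> \<le> norm ((L ^^ k0) ((L ^^ m) y - p1)) + norm q" by (rule norm_triangle_ineq4)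
      also have "norm ((L ^^ k0) ((L ^^ m) y - p1)) \<le> c ^ k0 * radius"
        using supp_le_radius[OF 1(2)] c by (simp add: norm_Ln mult_left_mono)
      also have "norm q \<le> c ^ k0 * radius"
        using supertile_supp_norm[OF q, of q] zero_supp by simp
      finally show ?thesis by (simp add: D'_def)
    qed
    ultimately show ?thesis by blast
  qed
  obtain p0 where p0: "(i0, p0) \<in> supertile n i0" "norm (0 - p0) \<le> D'" using near[of 0] R0 by auto
  have "\<forall>b::'d. \<exists>p. (i0, p) \<in> supertile n i0 \<and> norm (R *\<^sub>R axis b 1 - p) \<le> D'"
    using R0 by (intro allI near) simp
  then obtain p where p: "\<And>b::'d. (i0, p b) \<in> supertile n i0" "\<And>b. norm (R *\<^sub>R axis b 1 - p b) \<le> D'" by metis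
  define v where "v b = p b - p0" for b
  have span: "norm \<omega> \<le> (2 * d / R) * \<epsilon>" if "\<forall>w\<in>range v. \<bar>\<omega> \<bullet> w\<bar> \<le> \<epsilon>" for \<omega> \<epsilon>
  proof -
    have comp: "R * \<bar>\<omega> $ b\<bar> \<le> \<epsilon> + 2 * D' * norm \<omega>" for b
    proof -
      have "R * \<omega> $ b = \<omega> \<bullet> v b + \<omega> \<bullet> (R *\<^sub>R axis b 1 - p b) - \<omega> \<bullet> (0 - p0)"
        by (simp add: v_def inner_diff_right inner_axis)
      moreover have "\<bar>\<omega> \<bullet> v b\<bar> \<le> \<epsilon>" using that by auto
      moreover have "\<bar>\<omega> \<bullet> (R *\<^sub>R axis b 1 - p b)\<bar> \<le> norm \<omega> * D'"
        using Cauchy_Schwarz_ineq2[of \<omega> "R *\<^sub>R axis b 1 - p b"] mult_left_mono[OF p(2)[of b] norm_ge_zero[of \<omega>]]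
        by linarith
      moreover have "\<bar>\<omega> \<bullet> (0 - p0)\<bar> \<le> norm \<omega> * D'"
        using Cauchy_Schwarz_ineq2[of \<omega> "0 - p0"] mult_left_mono[OF p0(2) norm_ge_zero[of \<omega>]] by linarith
      ultimately have "\<bar>R * \<omega> $ b\<bar> \<le> \<epsilon> + 2 * D' * norm \<omega>" by (simp add: algebra_simps)
      thus ?thesis using R0 by (simp add: abs_mult)
    qed
    have "R * norm \<omega> \<le> R * (\<Sum>b\<in>UNIV. \<bar>\<omega> $ b\<bar>)"
      using R0 norm_le_l1_cart[of \<omega>] by (intro mult_left_mono) auto
    also have "\<dots> \<le> (\<Sum>b\<in>(UNIV :: 'd set). \<epsilon> + 2 * D' * norm \<omega>)"
      unfolding sum_distrib_left using comp by (intro sum_mono) auto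
    also have "\<dots> = d * \<epsilon> + 2 * d * D' * norm \<omega>" by (simp add: d_def algebra_simps)
    also have "\<dots> \<le> d * \<epsilon> + R / 2 * norm \<omega>"
      using R by (intro add_left_mono mult_right_mono) auto
    finally have "R / 2 * norm \<omega> \<le> d * \<epsilon>" by (simp add: algebra_simps)
    thus ?thesis using R0 by (simp add: field_simps)
  qed
  have occ: "\<exists>q. (i0, q) \<in> supertile (n + k0) j \<and> (i0, q + w) \<in> supertile (n + k0) j"
    if w: "w \<in> range v" for j w
  proof -
    obtain b where b: "w = v b" using w by blast
    obtain r where r: "(i0, r) \<in> supertile k0 j" using k0(2) by blast
    have "(i0, (L ^^ n) r + p0) \<in> supertile (n + k0) j" by (rule supertile_addI[OF r p0(1)])
    moreover have "(i0, (L ^^ n) r + p b) \<in> supertile (n + k0) j" by (rule supertile_addI[OF r p(1)])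
    moreover have "(L ^^ n) r + p b = (L ^^ n) r + p0 + w" by (simp add: b v_def)
    ultimately show ?thesis by metis
  qed
  have prim2: "\<exists>q. (i, q) \<in> supertile (n + k0) j" for i j
  proof -
    (* n = k0 + m, so type i occurs in every supertile of level n + k0 *)
    have "supertile (m + k0) j \<noteq> {}"
      using supertile_supp[of "m + k0" j 0] linear_0[OF linear_Ln] zero_supp[of j] by force
    then obtain i1 p1 where "(i1, p1) \<in> supertile (m + k0) j" by auto
    moreover obtain q where "(i, q) \<in> supertile k0 i1" using k0(2) by blast
    ultimately have "(i, (L ^^ k0) p1 + q) \<in> supertile (k0 + (m + k0)) j" by (rule supertile_addI)
    thus ?thesis by (auto simp: n_def add.assoc)
  qed
  show ?thesis
    by (rule exI[of _ "n + k0"], rule exI[of _ i0], rule exI[of _ "range v"], rule exI[of _ "2 * d / R"])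
      (use span occ prim2 R0 d in auto)
qed

end

section \<open>Twisted sums over supertiles\<close>

lemma e_char_eq_cis: "e_char x = cis (2 * pi * x)"
  by (simp add: e_char_def cis_conv_exp mult_ac)

lemma e_char_add: "e_char (x + y) = e_char x * e_char y"
  by (simp add: e_char_eq_cis cis_mult distrib_left)

lemma norm_e_char [simp]: "norm (e_char x) = 1"
  by (simp add: e_char_eq_cis)

lemma e_char_0 [simp]: "e_char 0 = 1"
  by (simp add: e_char_eq_cis)

lemma e_char_minus: "e_char (- x) = cnj (e_char x)"
  by (simp add: e_char_eq_cis cis_cnj)

lemma e_char_of_int: "e_char (of_int n) = 1"
  by (simp add: e_char_eq_cis cis_multiple_2pi)

lemma norm_one_plus_cis: "norm (1 + cis t) = 2 * \<bar>cos (t / 2)\<bar>"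
proof -
  have "(norm (1 + cis t))\<^sup>2 = (1 + cos t)\<^sup>2 + (sin t)\<^sup>2" by (simp add: cmod_power2)
  also have "\<dots> = 1 + 2 * cos t + ((cos t)\<^sup>2 + (sin t)\<^sup>2)" by (simp add: power2_eq_square algebra_simps)
  also have "\<dots> = 2 + 2 * cos (2 * (t / 2))" by simp
  also have "\<dots> = (2 * \<bar>cos (t / 2)\<bar>)\<^sup>2" by (simp only: cos_double_cos) (simp add: power_mult_distrib)
  finally show ?thesis by (rule power2_eq_imp_eq) auto
qed

text \<open>\<open>|1 + e(x)| = 2 |cos (pi x)|\<close>, and this is 2 only at integers.\<close>

lemma norm_one_plus_e_char:
  assumes "\<delta> > 0"
  shows "\<exists>\<eta>. 0 < \<eta> \<and> \<eta> \<le> 1 \<and> (\<forall>x. (\<forall>z::int. \<bar>x - of_int z\<bar> > \<delta>) \<longrightarrow> norm (1 + e_char x) \<le> 2 - \<eta>)"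
proof -
  define d where "d = min \<delta> (1 / 2)"
  have d: "0 < d" "d \<le> 1 / 2" using assms by (auto simp: d_def)
  define \<eta> where "\<eta> = min 1 (2 - 2 * cos (pi * d))"
  have "cos (pi * d) < cos 0"
    using d by (intro cos_monotone_0_pi) (auto simp: mult_le_cancel_left1)
  hence \<eta>: "\<eta> > 0" by (simp add: \<eta>_def)
  have "norm (1 + e_char x) \<le> 2 - \<eta>" if x: "\<forall>z::int. \<bar>x - of_int z\<bar> > \<delta>" for x
  proof -
    define y where "y = x - of_int (round x)"
    have y: "\<bar>y\<bar> \<le> 1 / 2" using of_int_round_abs_le[of x] by (simp add: y_def abs_minus_commute)
    have yd: "d \<le> \<bar>y\<bar>" using x[rule_format, of "round x"] by (simp add: y_def d_def)
    have "e_char x = e_char (y + of_int (round x))" by (simp add: y_def)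
    also have "\<dots> = e_char y" by (simp only: e_char_add e_char_of_int) simp
    finally have "norm (1 + e_char x) = 2 * \<bar>cos (pi * y)\<bar>"
      by (simp add: e_char_eq_cis norm_one_plus_cis mult_ac)
    also have "cos (pi * y) = cos (pi * \<bar>y\<bar>)" by (cases "y \<ge> 0") auto
    also have "\<bar>cos (pi * \<bar>y\<bar>)\<bar> = cos (pi * \<bar>y\<bar>)"
    proof (intro abs_of_nonneg cos_ge_zero)
      have "pi * \<bar>y\<bar> \<le> pi * (1 / 2)" using y by (intro mult_left_mono) auto
      thus "pi * \<bar>y\<bar> \<le> pi / 2" by simp
      have "0 \<le> pi * \<bar>y\<bar>" by simp
      moreover have "- (pi / 2) \<le> 0" by simp
      ultimately show "- (pi / 2) \<le> pi * \<bar>y\<bar>" by linarith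
    qed
    also have "cos (pi * \<bar>y\<bar>) \<le> cos (pi * d)"
      using d y yd by (intro cos_monotone_0_pi_le) (auto simp: mult_le_cancel_left1)
    finally show ?thesis by (simp add: \<eta>_def)
  qed
  moreover have "\<eta> \<le> 1" by (simp add: \<eta>_def)
  ultimately show ?thesis using \<eta> by blast
qed

context self_similar_substitution
begin

abbreviation csize :: "nat \<Rightarrow> 'm \<Rightarrow> real" where "csize n j \<equiv> real (card (supertile n j))"

lemma csize_add: "csize (n + k) j = (\<Sum>(i, p)\<in>supertile k j. csize n i)"
proof -
  have "(\<Sum>t\<in>supertile (n + k) j. 1 :: real) = (\<Sum>(i, p)\<in>supertile k j. csize n i)"
    unfolding sum_supertile_add by (simp add: case_prod_beta)
  thus ?thesis by simp
qed

subsection \<open>Counting tiles by volume\<close>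

lemma interior_lmeasurable: "interior (supp i) \<in> lmeasurable"
  by (rule lmeasurable_open) (auto intro: bounded_interior compact_imp_bounded compact_supp)

lemma supp_lmeasurable: "supp i \<in> lmeasurable"
  by (rule lmeasurable_compact[OF compact_supp])

lemma interior_volume_pos: "measure lebesgue (interior (supp i)) > 0"
proof -
  obtain e where e: "e > 0" "ball 0 e \<subseteq> interior (supp i)"
    using zero_interior[of i] by (meson open_contains_ball open_interior)
  have "0 < measure lebesgue (ball (0 :: real^'d) e)"
    using content_ball_pos[OF e(1), of "0 :: real^'d"] by (simp add: measure_completion)
  also have "\<dots> \<le> measure lebesgue (interior (supp i))"
    using e(2) by (intro measure_mono_fmeasurable interior_lmeasurable) auto
  finally show ?thesis .
qed

lemma supertile_packing:
  "\<exists>v0>0. \<forall>n j A B. A \<subseteq> supertile n j \<longrightarrow> B \<in> lmeasurable \<longrightarrow>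
     (\<forall>(i, p)\<in>A. (+) p ` interior (supp i) \<subseteq> B) \<longrightarrow> v0 * real (card A) \<le> measure lebesgue B"
proof -
  define v0 where "v0 = Min (range (\<lambda>i. measure lebesgue (interior (supp i))))"
  have v0: "v0 > 0" unfolding v0_def using interior_volume_pos by (subst Min_gr_iff) auto
  have main: "v0 * real (card A) \<le> measure lebesgue B"
    if A: "A \<subseteq> supertile n j" and B: "B \<in> lmeasurable" and sub: "\<forall>(i, p)\<in>A. (+) p ` interior (supp i) \<subseteq> B"
    for n j A B
  proof -
    have fin: "finite A" using A finite_supertile finite_subset by blast
    define I where "I = (\<lambda>(i, p). (+) p ` interior (supp i))"
    have Ilm: "I t \<in> lmeasurable" for t
      by (cases t) (simp add: I_def measurable_translation interior_lmeasurable)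
    have I_iff: "x \<in> I (i, p) \<longleftrightarrow> x - p \<in> interior (supp i)" for x i p
      unfolding I_def by (auto simp: image_iff intro!: bexI[of _ "x - p"])
    have disj: "disjoint_family_on I A"
      unfolding disjoint_family_on_def
    proof (intro ballI impI)
      fix s t assume st: "s \<in> A" "t \<in> A" "s \<noteq> t"
      show "I s \<inter> I t = {}"
      proof (rule ccontr)
        assume "I s \<inter> I t \<noteq> {}"
        then obtain x where x: "x \<in> I s" "x \<in> I t" by blast
        obtain i p i' p' where eq: "s = (i, p)" "t = (i', p')" by (cases s; cases t)
        have "x - p \<in> interior (supp i)" "x - p' \<in> interior (supp i')"
          using x by (simp_all add: I_iff eq)
        moreover have "(i, p) \<in> supertile n j" "(i', p') \<in> supertile n j" using st A eq by auto
        ultimately have "(i, p) = (i', p')" by (intro supertile_disjoint)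
        thus False using st eq by simp
      qed
    qed
    have "v0 * real (card A) = (\<Sum>t\<in>A. v0)" by simp
    also have "\<dots> \<le> (\<Sum>t\<in>A. measure lebesgue (I t))"
    proof (rule sum_mono)
      fix t
      have "measure lebesgue (I t) = measure lebesgue (interior (supp (fst t)))"
        by (cases t) (simp add: I_def measure_translation)
      thus "v0 \<le> measure lebesgue (I t)" by (simp add: v0_def)
    qed
    also have "\<dots> = measure lebesgue (\<Union>t\<in>A. I t)"
    proof (rule measure_finite_Union[symmetric, OF fin _ disj])
      show "I ` A \<subseteq> sets lebesgue" using Ilm by (auto dest: fmeasurableD)
      show "emeasure lebesgue (I t) \<noteq> \<infinity>" for t using fmeasurableD2[OF Ilm[of t]] by simp
    qed
    also have "\<dots> \<le> measure lebesgue B"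
    proof (rule measure_mono_fmeasurable[OF _ _ B])
      have "I t \<subseteq> B" if "t \<in> A" for t
        using bspec[OF sub that] by (cases t) (simp add: I_def)
      thus "(\<Union>t\<in>A. I t) \<subseteq> B" by blast
      show "(\<Union>t\<in>A. I t) \<in> sets lebesgue"
        using fin Ilm by (intro sets.finite_UN) (auto simp: fmeasurableD)
    qed
    finally show ?thesis .
  qed
  show ?thesis by (intro exI[of _ v0] conjI allI impI v0 main)
qed

lemma supertile_covering:
  "\<exists>V1>0. \<forall>A B. finite A \<longrightarrow> B \<in> lmeasurable \<longrightarrow>
     (\<forall>x\<in>B. \<exists>(i, p)\<in>A. x - p \<in> supp i) \<longrightarrow> measure lebesgue B \<le> V1 * real (card A)"
proof -
  define V1 where "V1 = 1 + Max (range (\<lambda>i. measure lebesgue (supp i)))"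
  have "0 \<le> Max (range (\<lambda>i. measure lebesgue (supp i)))" by (subst Max_ge_iff) auto
  hence V1: "V1 > 0" by (simp add: V1_def)
  have main: "measure lebesgue B \<le> V1 * real (card A)"
    if fin: "finite A" and B: "B \<in> lmeasurable" and sub: "\<forall>x\<in>B. \<exists>(i, p)\<in>A. x - p \<in> supp i" for A B
  proof -
    define I where "I = (\<lambda>(i, p). (+) p ` supp i)"
    have Ilm: "I t \<in> lmeasurable" for t
      by (cases t) (simp add: I_def measurable_translation supp_lmeasurable)
    have BI: "B \<subseteq> (\<Union>t\<in>A. I t)"
    proof
      fix x assume "x \<in> B"
      then obtain i p where "(i, p) \<in> A" "x - p \<in> supp i" using sub by blast
      thus "x \<in> (\<Union>t\<in>A. I t)" by (intro UN_I[of "(i, p)"]) (auto simp: I_def image_iff intro!: bexI[of _ "x - p"])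
    qed
    have "measure lebesgue B \<le> measure lebesgue (\<Union>t\<in>A. I t)"
      using fin Ilm B by (intro measure_mono_fmeasurable BI fmeasurable.finite_UN) (auto simp: fmeasurableD)
    also have "\<dots> \<le> (\<Sum>t\<in>A. measure lebesgue (I t))"
      using fin Ilm by (intro measure_UNION_le) (auto simp: fmeasurableD)
    also have "\<dots> \<le> (\<Sum>t\<in>A. V1)"
    proof (rule sum_mono)
      fix t
      have "measure lebesgue (I t) = measure lebesgue (supp (fst t))"
        by (cases t) (simp add: I_def measure_translation)
      also have "\<dots> \<le> Max (range (\<lambda>i. measure lebesgue (supp i)))" by (intro Max_ge) auto
      finally show "measure lebesgue (I t) \<le> V1" by (simp add: V1_def)
    qed
    finally show ?thesis by (simp add: mult.commute)
  qed
  show ?thesis by (intro exI[of _ V1] conjI allI impI V1 main)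
qed

lemma supp_contains_ball: "\<exists>\<rho>>0. \<forall>j. ball 0 \<rho> \<subseteq> supp j"
proof -
  have "\<forall>j. \<exists>e>0. ball 0 e \<subseteq> supp j" using zero_interior by (auto simp: mem_interior)
  then obtain e where e: "\<And>j. e j > 0" "\<And>j. ball 0 (e j) \<subseteq> supp j" by metis
  define \<rho> where "\<rho> = Min (range e)"
  have "\<rho> > 0" unfolding \<rho>_def using e(1) by (subst Min_gr_iff) auto
  moreover have "ball 0 \<rho> \<subseteq> supp j" for j
  proof -
    have "\<rho> \<le> e j" by (simp add: \<rho>_def)
    thus ?thesis using e(2)[of j] subset_ball by blast
  qed
  ultimately show ?thesis by blast
qed

text \<open>A supertile of level \<open>n\<close> contains a ball and lies in a ball whose radii are fixed multiples of \<open>c ^ n\<close>.\<close>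

lemma csize_bounds: "\<exists>\<alpha>>0. \<exists>\<beta>>0. \<exists>a>0. \<forall>n j. \<alpha> * a ^ n \<le> csize n j \<and> csize n j \<le> \<beta> * a ^ n"
proof -
  obtain v0 where v0: "v0 > 0" "\<And>n j A B. A \<subseteq> supertile n j \<Longrightarrow> B \<in> lmeasurable \<Longrightarrow>
     (\<forall>(i, p)\<in>A. (+) p ` interior (supp i) \<subseteq> B) \<Longrightarrow> v0 * real (card A) \<le> measure lebesgue B"
    using supertile_packing by blast
  obtain V1 where V1: "V1 > 0" "\<And>A B. finite A \<Longrightarrow> B \<in> lmeasurable \<Longrightarrow>
     (\<forall>x\<in>B. \<exists>(i, p)\<in>A. x - p \<in> supp i) \<Longrightarrow> measure lebesgue B \<le> V1 * real (card A)"
    using supertile_covering by blast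
  define u where "u = unit_ball_vol (real CARD('d))"
  have u: "u > 0" by (simp add: u_def)
  have vol: "measure lebesgue (ball (0 :: real^'d) r) = u * r ^ CARD('d)"
    "measure lebesgue (cball (0 :: real^'d) r) = u * r ^ CARD('d)" if "r \<ge> 0" for r
    using content_ball[OF that, of "0 :: real^'d"] content_cball[OF that, of "0 :: real^'d"]
    by (simp_all add: u_def measure_completion)
  define a where "a = c ^ CARD('d)"
  have a: "a > 0" using c by (simp add: a_def)
  have scale: "(c ^ n * r) ^ CARD('d) = a ^ n * r ^ CARD('d)" for n r
    by (simp add: a_def power_mult_distrib power_mult[symmetric] mult.commute)
  obtain \<rho> where \<rho>: "\<rho> > 0" "\<And>j. ball 0 \<rho> \<subseteq> supp j" using supp_contains_ball by blast
  have "u * \<rho> ^ CARD('d) / V1 * a ^ n \<le> csize n j \<and> csize n j \<le> u * radius ^ CARD('d) / v0 * a ^ n" for n j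
  proof
    have "u * (a ^ n * \<rho> ^ CARD('d)) = measure lebesgue (ball (0 :: real^'d) (c ^ n * \<rho>))"
      using \<rho>(1) c by (subst vol) (auto simp: scale)
    also have "\<dots> \<le> V1 * csize n j"
    proof (intro V1(2) finite_supertile ballI)
      fix x :: "real^'d" assume x: "x \<in> ball 0 (c ^ n * \<rho>)"
      obtain y where y: "x = (L ^^ n) y" using bij_Ln[of n] by (metis bij_pointE)
      have "c ^ n * norm y < c ^ n * \<rho>" using x by (simp add: y norm_Ln)
      hence "y \<in> supp j" using c \<rho>(2)[of j] by auto
      thus "\<exists>(i, p)\<in>supertile n j. x - p \<in> supp i" using supertile_supp[of n j x] y by blast
    qed auto
    finally show "u * \<rho> ^ CARD('d) / V1 * a ^ n \<le> csize n j" using V1(1) by (simp add: field_simps)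
    have "v0 * csize n j \<le> measure lebesgue (cball (0 :: real^'d) (c ^ n * radius))"
    proof (intro v0(2)[OF order_refl], simp, clarify)
      fix i p z assume *: "(i, p) \<in> supertile n j" "z \<in> interior (supp i)"
      hence "(p + z) - p \<in> supp i" using interior_subset by auto
      from supertile_supp_norm[OF *(1) this] show "p + z \<in> cball 0 (c ^ n * radius)" by simp
    qed
    also have "\<dots> = u * (a ^ n * radius ^ CARD('d))"
      using radius_pos c by (subst vol) (auto simp: scale)
    finally show "csize n j \<le> u * radius ^ CARD('d) / v0 * a ^ n" using v0(1) by (simp add: field_simps)
  qed
  moreover have "u * \<rho> ^ CARD('d) / V1 > 0" "u * radius ^ CARD('d) / v0 > 0"
    using v0 V1 u \<rho> radius_pos by auto
  ultimately show ?thesis using a by blast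
qed

lemma csize_pos: "csize n j > 0"
proof -
  obtain \<alpha> a where "\<alpha> > 0" "a > 0" "\<alpha> * a ^ n \<le> csize n j" using csize_bounds by blast
  thus ?thesis by (meson less_le_trans mult_pos_pos zero_less_power)
qed

lemma csize_comparable: "\<exists>\<kappa>. 0 < \<kappa> \<and> \<kappa> \<le> 1 \<and> (\<forall>n i j. \<kappa> * csize (n + k) j \<le> csize n i)"
proof -
  obtain \<alpha> \<beta> a where *: "\<alpha> > 0" "\<beta> > 0" "a > 0" "\<And>n j. \<alpha> * a ^ n \<le> csize n j"
    "\<And>n j. csize n j \<le> \<beta> * a ^ n" using csize_bounds by blast
  define \<kappa> where "\<kappa> = min 1 (\<alpha> / (\<beta> * a ^ k))"
  have \<kappa>: "\<kappa> > 0" "\<kappa> \<le> 1" using * by (auto simp: \<kappa>_def)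
  have "\<kappa> * csize (n + k) j \<le> csize n i" for n i j
  proof -
    have "\<kappa> * csize (n + k) j \<le> \<alpha> / (\<beta> * a ^ k) * (\<beta> * a ^ (n + k))"
      using * by (intro mult_mono) (auto simp: \<kappa>_def)
    also have "\<dots> = \<alpha> * a ^ n" using *(1,2,3) by (simp add: power_add)
    also have "\<dots> \<le> csize n i" by (rule *)
    finally show ?thesis .
  qed
  thus ?thesis using \<kappa> by blast
qed

subsection \<open>The cocycle\<close>

definition twisted_sum :: "real^'d \<Rightarrow> ('m \<Rightarrow> complex) \<Rightarrow> nat \<Rightarrow> 'm \<Rightarrow> complex" where
  "twisted_sum \<omega> h n j = (\<Sum>(i, p)\<in>supertile n j. e_char (\<omega> \<bullet> p) * h i)"

text \<open>A cocycle over the transpose of \<open>L\<close>: the phases at level \<open>n\<close> depend on \<open>\<omega>\<close> only through \<open>\<omega> \<bullet> L ^ n p\<close>.\<close>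

lemma twisted_sum_add:
  "twisted_sum \<omega> h (n + k) j = (\<Sum>(i, p)\<in>supertile k j. e_char (\<omega> \<bullet> (L ^^ n) p) * twisted_sum \<omega> h n i)"
  by (simp add: twisted_sum_def sum_supertile_add case_prod_beta inner_add_right e_char_add
      sum_distrib_left mult.assoc)

definition twisted_bound :: "real^'d \<Rightarrow> ('m \<Rightarrow> complex) \<Rightarrow> nat \<Rightarrow> real \<Rightarrow> bool" where
  "twisted_bound \<omega> h n B \<longleftrightarrow> (\<forall>i. norm (twisted_sum \<omega> h n i) \<le> B * csize n i)"

lemma twisted_bound_0: "(\<And>i. norm (h i) \<le> B) \<Longrightarrow> twisted_bound \<omega> h 0 B"
  by (simp add: twisted_bound_def twisted_sum_def supertile_0)

lemma twisted_bound_add: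
  assumes "twisted_bound \<omega> h n B" shows "twisted_bound \<omega> h (n + k) B"
  unfolding twisted_bound_def
proof
  fix j
  have "norm (twisted_sum \<omega> h (n + k) j) \<le> (\<Sum>x\<in>supertile k j. B * csize n (fst x))"
    unfolding twisted_sum_add using assms
    by (intro sum_norm_le) (auto simp: norm_mult twisted_bound_def case_prod_beta)
  also have "\<dots> = B * csize (n + k) j" by (simp add: csize_add sum_distrib_left case_prod_beta)
  finally show "norm (twisted_sum \<omega> h (n + k) j) \<le> B * csize (n + k) j" .
qed

lemma twisted_bound_mono:
  "twisted_bound \<omega> h n B \<Longrightarrow> n \<le> n' \<Longrightarrow> twisted_bound \<omega> h n' B"
  using twisted_bound_add[of \<omega> h n B "n' - n"] by simp

text \<open>Two copies of the same supertile whose phases differ cancel by a definite proportion.\<close>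

lemma twisted_bound_contract:
  assumes bnd: "twisted_bound \<omega> h n B" "B \<ge> 0"
    and occ: "\<And>j. \<exists>p. (i0, p) \<in> supertile k j \<and> (i0, p + v) \<in> supertile k j"
    and \<kappa>: "\<And>i j. \<kappa> * csize (n + k) j \<le> csize n i"
    and \<eta>: "norm (1 + e_char (\<omega> \<bullet> (L ^^ n) v)) \<le> 2 - \<eta>" "0 < \<eta>"
  shows "twisted_bound \<omega> h (n + k) ((1 - \<kappa> * \<eta>) * B)"
  unfolding twisted_bound_def
proof
  fix j
  obtain p where p: "(i0, p) \<in> supertile k j" "(i0, p + v) \<in> supertile k j" using occ by blast
  have "v \<noteq> 0" using \<eta> linear_0[OF linear_Ln] by auto
  define g where "g = (\<lambda>x. e_char (\<omega> \<bullet> (L ^^ n) (snd x)) * twisted_sum \<omega> h n (fst x))"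
  define w where "w = (\<lambda>x :: 'm \<times> (real^'d). csize n (fst x))"
  define A where "A = supertile k j - {(i0, p)} - {(i0, p + v)}"
  have split: "sum f (supertile k j) = f (i0, p) + (f (i0, p + v) + sum f A)"
    for f :: "'m \<times> (real^'d) \<Rightarrow> 'b::comm_monoid_add"
    unfolding A_def using p \<open>v \<noteq> 0\<close> finite_supertile[of k j]
    by (subst sum.remove[of _ "(i0, p)"], simp_all, subst sum.remove[of _ "(i0, p + v)"], simp_all)
  have gw: "norm (g x) \<le> B * w x" for x
    using bnd(1) by (simp add: g_def w_def norm_mult twisted_bound_def)
  have "g (i0, p) + g (i0, p + v) = e_char (\<omega> \<bullet> (L ^^ n) p) * ((1 + e_char (\<omega> \<bullet> (L ^^ n) v)) * twisted_sum \<omega> h n i0)"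
    by (simp add: g_def Ln_add inner_add_right e_char_add algebra_simps)
  hence "norm (g (i0, p) + g (i0, p + v)) = norm (1 + e_char (\<omega> \<bullet> (L ^^ n) v)) * norm (twisted_sum \<omega> h n i0)"
    by (simp add: norm_mult)
  also have "\<dots> \<le> (2 - \<eta>) * (B * csize n i0)"
    using \<eta>(1) bnd(1) order_trans[OF norm_ge_zero \<eta>(1)] by (intro mult_mono) (auto simp: twisted_bound_def)
  finally have two: "norm (g (i0, p) + g (i0, p + v)) \<le> (2 - \<eta>) * (B * csize n i0)" .
  have "twisted_sum \<omega> h (n + k) j = sum g (supertile k j)"
    by (simp add: twisted_sum_add g_def case_prod_beta)
  also have "\<dots> = (g (i0, p) + g (i0, p + v)) + sum g A" by (simp add: split add.assoc)
  also have "norm \<dots> \<le> (2 - \<eta>) * (B * csize n i0) + (\<Sum>x\<in>A. B * w x)"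
    using two sum_norm_le[of A g "\<lambda>x. B * w x", OF gw] norm_triangle_ineq[of "g (i0, p) + g (i0, p + v)" "sum g A"]
    by linarith
  also have "\<dots> = B * sum w (supertile k j) - \<eta> * B * csize n i0"
    by (simp add: split w_def sum_distrib_left algebra_simps)
  also have "sum w (supertile k j) = csize (n + k) j"
    by (simp add: csize_add w_def case_prod_beta)
  also have "B * csize (n + k) j - \<eta> * B * csize n i0 \<le> B * csize (n + k) j - \<eta> * B * (\<kappa> * csize (n + k) j)"
    using \<kappa>[of j i0] \<eta>(2) bnd(2) by (intro diff_left_mono mult_left_mono) auto
  finally show "norm (twisted_sum \<omega> h (n + k) j) \<le> (1 - \<kappa> * \<eta>) * B * csize (n + k) j"
    by (simp add: algebra_simps)
qed

lemma inner_Ln: "(L ^^ n) x \<bullet> (L ^^ n) y = c ^ (2 * n) * (x \<bullet> y)"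
proof -
  have nn: "(norm ((L ^^ n) z))\<^sup>2 = c ^ (2 * n) * (norm z)\<^sup>2" for z
    by (simp add: norm_Ln power_mult_distrib power_mult[symmetric] mult.commute)
  have "(L ^^ n) x \<bullet> (L ^^ n) y = ((norm ((L ^^ n) (x + y)))\<^sup>2 - (norm ((L ^^ n) x))\<^sup>2 - (norm ((L ^^ n) y))\<^sup>2) / 2"
    by (simp add: Ln_add dot_norm)
  also have "\<dots> = c ^ (2 * n) * (((norm (x + y))\<^sup>2 - (norm x)\<^sup>2 - (norm y)\<^sup>2) / 2)"
    by (simp add: nn right_diff_distrib)
  finally show ?thesis by (simp add: dot_norm)
qed

text \<open>\<open>L ^ n\<close> is \<open>c ^ n\<close> times an isometry, so its adjoint maps \<open>L ^ n y\<close> to \<open>c ^ (2 n) y\<close>.\<close>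

lemma adjoint_Ln: "\<exists>\<omega>'. norm \<omega>' = c ^ n * norm \<omega> \<and> (\<forall>x. \<omega>' \<bullet> x = \<omega> \<bullet> (L ^^ n) x)"
proof -
  obtain y where y: "\<omega> = (L ^^ n) y" using bij_Ln[of n] by (metis bij_pointE)
  have "norm (c ^ (2 * n) *\<^sub>R y) = c ^ n * norm \<omega>"
    using c by (simp add: y norm_Ln mult_2 power_add)
  moreover have "(c ^ (2 * n) *\<^sub>R y) \<bullet> x = \<omega> \<bullet> (L ^^ n) x" for x
    by (simp add: y inner_Ln)
  ultimately show ?thesis by blast
qed

end

section \<open>Decay of the cocycle\<close>

context self_similar_substitution
begin

lemma twisted_bound_weaken:
  "twisted_bound \<omega> h n B \<Longrightarrow> B \<le> B' \<Longrightarrow> twisted_bound \<omega> h n B'"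
  unfolding twisted_bound_def by (meson mult_right_mono of_nat_0_le_iff order_trans)

text \<open>Each window of levels that is proportional to \<open>1 + log |L ^ n \<omega>|\<close> contains a contracting level.
  As \<open>log |L ^ n \<omega>|\<close> grows linearly in \<open>n\<close>, consecutive windows grow geometrically.\<close>

lemma cocycle_decay:
  assumes np: "strongly_totally_non_pisot (complex_eigenvalues L)"
  shows "\<exists>G>1. \<exists>\<theta>. 0 < \<theta> \<and> \<theta> < 1 \<and> (\<forall>\<omega> h B n0 l n. 0 \<le> B \<longrightarrow> 1 \<le> c ^ n0 * norm \<omega> \<longrightarrow>
     twisted_bound \<omega> h n0 B \<longrightarrow> n0 \<le> n \<longrightarrow>
     G ^ l * (1 + log c (c ^ n0 * norm \<omega>)) \<le> 1 + log c (c ^ n * norm \<omega>) \<longrightarrow>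
     twisted_bound \<omega> h n (\<theta> ^ l * B))"
proof -
  obtain k i0 V \<kappa>V where V: "finite V" "\<kappa>V > 0" "\<And>\<omega> \<epsilon>. (\<forall>v\<in>V. \<bar>\<omega> \<bullet> v\<bar> \<le> \<epsilon>) \<Longrightarrow> norm \<omega> \<le> \<kappa>V * \<epsilon>"
    and occ: "\<And>j v. v \<in> V \<Longrightarrow> \<exists>p. (i0, p) \<in> supertile k j \<and> (i0, p + v) \<in> supertile k j"
    using return_vectors by metis
  obtain \<delta> C where \<delta>: "\<delta> > 0" and C: "C > 0" and far: "\<And>\<omega> :: real^'d. norm \<omega> \<ge> 1 \<Longrightarrow>
    (\<exists>m. \<exists>v\<in>V. real m \<le> C * (1 + ln (norm \<omega>)) \<and> (\<forall>z::int. \<bar>\<omega> \<bullet> (L ^^ m) v - of_int z\<bar> > \<delta>))"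
    using exists_far_from_integers[OF linear_L sim c np V] by metis
  obtain \<eta> where \<eta>: "0 < \<eta>" "\<eta> \<le> 1"
    "\<And>x. (\<forall>z::int. \<bar>x - of_int z\<bar> > \<delta>) \<Longrightarrow> norm (1 + e_char x) \<le> 2 - \<eta>"
    using norm_one_plus_e_char[OF \<delta>] by blast
  obtain \<kappa> where \<kappa>: "0 < \<kappa>" "\<kappa> \<le> 1" "\<And>n i j. \<kappa> * csize (n + k) j \<le> csize n i"
    using csize_comparable by blast
  define \<theta> where "\<theta> = max (1 - \<kappa> * \<eta>) (1 / 2)"
  have \<theta>: "0 < \<theta>" "\<theta> < 1" using \<kappa> \<eta> by (auto simp: \<theta>_def)
  define C' where "C' = C * (1 + ln c)"
  have lnc: "ln c > 0" using c by simp
  have C': "C' > 0" using C lnc by (simp add: C'_def)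
  define H where "H = 1 + C' + real k"
  (* the factor 2 absorbs the rounding of the starting level of a window to an integer *)
  define G where "G = 2 * H"
  have G: "G > 1" using C' by (simp add: G_def H_def)
  have main: "twisted_bound \<omega> h n (\<theta> ^ l * B)"
    if B: "0 \<le> B" and one: "1 \<le> c ^ n0 * norm \<omega>" and b0: "twisted_bound \<omega> h n0 B" and nn: "n0 \<le> n"
      and large: "G ^ l * (1 + log c (c ^ n0 * norm \<omega>)) \<le> 1 + log c (c ^ n * norm \<omega>)"
    for \<omega> h B n0 l n
  proof -
    have \<omega>: "norm \<omega> > 0" using one c by (cases "norm \<omega> = 0") auto
    define \<tau> where "\<tau> n = 1 + real n + log c (norm \<omega>)" for n
    have \<tau>: "1 + log c (c ^ n * norm \<omega>) = \<tau> n" for n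
      using \<omega> c by (simp add: \<tau>_def log_mult log_nat_power)
    have "0 \<le> log c (c ^ n0 * norm \<omega>)"
      using one c zero_le_log_cancel_iff[of c "c ^ n0 * norm \<omega>"] by linarith
    hence \<tau>0: "\<tau> n0 \<ge> 1" using \<tau>[of n0] by linarith
    have step: "twisted_bound \<omega> h n' (\<theta> * B')"
      if b: "twisted_bound \<omega> h n1 B'" and B': "B' \<ge> 0" and t1: "\<tau> n1 \<ge> 1" and t2: "\<tau> n' \<ge> H * \<tau> n1"
      for n1 n' B'
    proof -
      obtain \<omega>' where \<omega>': "norm \<omega>' = c ^ n1 * norm \<omega>" "\<And>x. \<omega>' \<bullet> x = \<omega> \<bullet> (L ^^ n1) x"
        using adjoint_Ln by blast
      have lg: "0 \<le> log c (c ^ n1 * norm \<omega>)" using t1 \<tau>[of n1] by simp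
      hence "norm \<omega>' \<ge> 1" using c \<omega> unfolding \<omega>'(1) by (subst (asm) zero_le_log_cancel_iff) auto
      then obtain m v where mv: "v \<in> V" "real m \<le> C * (1 + ln (norm \<omega>'))"
        "\<forall>z::int. \<bar>\<omega>' \<bullet> (L ^^ m) v - of_int z\<bar> > \<delta>" using far by blast
      have "ln (norm \<omega>') = ln c * log c (c ^ n1 * norm \<omega>)" using lnc by (simp add: \<omega>'(1) log_def)
      also have "\<dots> = ln c * (\<tau> n1 - 1)" using \<tau>[of n1] by simp
      also have "1 + ln c * (\<tau> n1 - 1) \<le> (1 + ln c) * \<tau> n1" using t1 lnc by (simp add: algebra_simps)
      finally have "C * (1 + ln (norm \<omega>')) \<le> C' * \<tau> n1"
        unfolding C'_def mult.assoc using C by (intro mult_left_mono) (simp_all add: \<open>ln (norm \<omega>') = ln c * log c (c ^ n1 * norm \<omega>)\<close>)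
      hence m: "real m \<le> C' * \<tau> n1" using mv(2) by linarith
      have "real k * 1 \<le> real k * \<tau> n1" using t1 by (intro mult_left_mono) auto
      hence "\<tau> n1 + real m + real k \<le> H * \<tau> n1" using m by (simp add: H_def algebra_simps)
      hence "n1 + m + k \<le> n'" using t2 by (simp add: \<tau>_def)
      moreover have "twisted_bound \<omega> h (n1 + m + k) ((1 - \<kappa> * \<eta>) * B')"
      proof (rule twisted_bound_contract[OF _ B' occ[OF mv(1)]])
        show "twisted_bound \<omega> h (n1 + m) B'" by (rule twisted_bound_add[OF b])
        show "\<kappa> * csize (n1 + m + k) j \<le> csize (n1 + m) i" for i j by (rule \<kappa>)
        show "norm (1 + e_char (\<omega> \<bullet> (L ^^ (n1 + m)) v)) \<le> 2 - \<eta>"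
          using \<eta>(3)[OF mv(3)] \<omega>'(2) by (simp add: funpow_add)
      qed (rule \<eta>)
      moreover have "(1 - \<kappa> * \<eta>) * B' \<le> \<theta> * B'" using B' by (intro mult_right_mono) (auto simp: \<theta>_def)
      ultimately show ?thesis by (meson twisted_bound_mono twisted_bound_weaken)
    qed
    show ?thesis using nn large unfolding \<tau>
    proof (induction l arbitrary: n)
      case 0
      thus ?case using twisted_bound_mono[OF b0] by simp
    next
      case (Suc l)
      have G1: "G ^ l * \<tau> n0 \<ge> \<tau> n0" using G \<tau>0 by (simp add: mult_le_cancel_right1)
      (* the first level to which the induction hypothesis applies *)
      define n1 where "n1 = n0 + nat \<lceil>G ^ l * \<tau> n0 - \<tau> n0\<rceil>"
      have n1: "\<tau> n1 \<ge> G ^ l * \<tau> n0" "\<tau> n1 \<le> G ^ l * \<tau> n0 + 1"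
        using G1 unfolding n1_def \<tau>_def by (simp_all, linarith+)
      have bn1: "twisted_bound \<omega> h n1 (\<theta> ^ l * B)"
        using n1(1) by (intro Suc.IH) (simp_all add: n1_def)
      have tn: "\<tau> n \<ge> H * \<tau> n1"
      proof -
        have "\<tau> n1 \<le> 2 * (G ^ l * \<tau> n0)" using n1(2) G1 \<tau>0 by linarith
        hence "H * \<tau> n1 \<le> H * (2 * (G ^ l * \<tau> n0))"
          using C' by (intro mult_left_mono) (auto simp: H_def)
        also have "\<dots> = G ^ Suc l * \<tau> n0" by (simp add: G_def)
        also have "\<dots> \<le> \<tau> n" by (rule Suc.prems(2))
        finally show ?thesis .
      qed
      have "twisted_bound \<omega> h n (\<theta> * (\<theta> ^ l * B))"
      proof (rule step[OF bn1 _ _ tn])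
        show "1 \<le> \<tau> n1" using n1(1) G1 \<tau>0 by linarith
      qed (use B \<theta> in auto)
      thus ?case by (simp add: mult.assoc)
    qed
  qed
  show ?thesis using G \<theta> main by blast
qed

text \<open>At frequency 0 the averages over supertiles of a given level are convex combinations of
  the averages at a lower level, in which every type of tile has weight at least \<open>\<kappa>\<close>.\<close>

lemma zero_frequency_contraction:
  "\<exists>k>0. \<exists>\<theta>. 0 < \<theta> \<and> \<theta> < 1 \<and> (\<forall>h B l. (\<forall>i. norm (h i) \<le> B) \<longrightarrow>
     (\<exists>lo hi. hi - lo \<le> \<theta> ^ l * (2 * B) \<and> (\<forall>i. lo * csize (k * l) i \<le> Re (twisted_sum 0 h (k * l) i) \<and>
        Re (twisted_sum 0 h (k * l) i) \<le> hi * csize (k * l) i)))"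
proof -
  obtain k where k: "k > 0" "\<And>i j. \<exists>p. (i, p) \<in> supertile k j" using primitive_supertile by blast
  obtain \<kappa> where \<kappa>: "0 < \<kappa>" "\<kappa> \<le> 1" "\<And>n i j. \<kappa> * csize (n + k) j \<le> csize n i"
    using csize_comparable by blast
  define \<theta> where "\<theta> = max (1 - \<kappa>) (1 / 2)"
  have \<theta>: "0 < \<theta>" "\<theta> < 1" using \<kappa> by (auto simp: \<theta>_def)
  have main: "\<exists>lo hi. hi - lo \<le> \<theta> ^ l * (2 * B) \<and> (\<forall>i. lo * csize (k * l) i \<le> Re (twisted_sum 0 h (k * l) i) \<and>
        Re (twisted_sum 0 h (k * l) i) \<le> hi * csize (k * l) i)" if h: "\<forall>i. norm (h i) \<le> B" for h B l
  proof (induction l)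
    case 0
    have "- B \<le> Re (h i) \<and> Re (h i) \<le> B" for i
      using h[rule_format, of i] abs_Re_le_cmod[of "h i"] by linarith
    thus ?case by (intro exI[of _ "- B"] exI[of _ B]) (auto simp: twisted_sum_def supertile_0)
  next
    case (Suc l)
    then obtain lo hi where *: "hi - lo \<le> \<theta> ^ l * (2 * B)"
      "\<And>i. lo * csize (k * l) i \<le> Re (twisted_sum 0 h (k * l) i)"
      "\<And>i. Re (twisted_sum 0 h (k * l) i) \<le> hi * csize (k * l) i" by blast
    define n where "n = k * l"
    define i0 :: 'm where "i0 = undefined"
    define u where "u = Re (twisted_sum 0 h n i0) / csize n i0"
    have u: "Re (twisted_sum 0 h n i0) = u * csize n i0" using csize_pos[of n i0] by (simp add: u_def)
    have "lo * csize n i0 \<le> u * csize n i0" "u * csize n i0 \<le> hi * csize n i0"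
      using *(2,3)[of i0] u by (simp_all add: n_def)
    hence lu: "lo \<le> u" "u \<le> hi" using csize_pos[of n i0] by simp_all
    (* all averages move towards u, the average over the type i0, by the weight \<kappa> of this type *)
    define lo' hi' where "lo' = lo + \<kappa> * (u - lo)" and "hi' = hi - \<kappa> * (hi - u)"
    have "hi' - lo' = (1 - \<kappa>) * (hi - lo)" by (simp add: lo'_def hi'_def algebra_simps)
    also have "\<dots> \<le> \<theta> * (hi - lo)" using lu by (intro mult_right_mono) (auto simp: \<theta>_def)
    also have "\<dots> \<le> \<theta> * (\<theta> ^ l * (2 * B))" using * \<theta> by (intro mult_left_mono) auto
    finally have d: "hi' - lo' \<le> \<theta> ^ Suc l * (2 * B)" by simp
    have "lo' * csize (n + k) j \<le> Re (twisted_sum 0 h (n + k) j) \<and>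
        Re (twisted_sum 0 h (n + k) j) \<le> hi' * csize (n + k) j" for j
    proof -
      obtain p where p: "(i0, p) \<in> supertile k j" using k(2) by blast
      define A where "A = supertile k j - {(i0, p)}"
      have split: "sum f (supertile k j) = f (i0, p) + sum f A" for f :: "_ \<Rightarrow> real"
        unfolding A_def by (rule sum.remove[OF finite_supertile p])
      define g where "g = (\<lambda>x :: 'm \<times> (real^'d). Re (twisted_sum 0 h n (fst x)))"
      define w where "w = (\<lambda>x :: 'm \<times> (real^'d). csize n (fst x))"
      have ts: "Re (twisted_sum 0 h (n + k) j) = u * csize n i0 + sum g A"
        using split[of g] by (simp add: twisted_sum_add case_prod_beta g_def u Re_sum)
      have cs: "csize (n + k) j = csize n i0 + sum w A"
        using split[of w] by (simp add: csize_add case_prod_beta w_def)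
      have "lo * sum w A \<le> sum g A" "sum g A \<le> hi * sum w A"
        unfolding sum_distrib_left using *(2,3) by (auto intro!: sum_mono simp: g_def w_def n_def)
      moreover have "(u - lo) * (\<kappa> * csize (n + k) j) \<le> (u - lo) * csize n i0"
        "(hi - u) * (\<kappa> * csize (n + k) j) \<le> (hi - u) * csize n i0"
        using \<kappa>(3)[of n j i0] lu by (auto intro!: mult_left_mono)
      ultimately show ?thesis unfolding ts lo'_def hi'_def
        using arg_cong[OF cs, of "\<lambda>x. lo * x"] arg_cong[OF cs, of "\<lambda>x. hi * x"]
        by (auto simp: algebra_simps)
    qed
    moreover have "n + k = k * Suc l" by (simp add: n_def)
    ultimately show ?case using d by (intro exI[of _ lo'] exI[of _ hi']) auto
  qed
  show ?thesis using k(1) \<theta> main by blast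
qed

end

section \<open>Twisted integrals over balls\<close>

lemma norm_sum_at_most_one:
  fixes f :: "'a \<Rightarrow> 'b::real_normed_vector"
  assumes "finite A" "0 \<le> M" "\<And>a. a \<in> A \<Longrightarrow> norm (f a) \<le> M"
    and "\<And>a b. a \<in> A \<Longrightarrow> b \<in> A \<Longrightarrow> f a \<noteq> 0 \<Longrightarrow> f b \<noteq> 0 \<Longrightarrow> a = b"
  shows "norm (sum f A) \<le> M"
proof (cases "\<exists>a\<in>A. f a \<noteq> 0")
  case True
  then obtain a where a: "a \<in> A" "f a \<noteq> 0" by blast
  have "sum f A = sum f {a}"
    using assms(1,4) a by (intro sum.mono_neutral_right) auto
  thus ?thesis using assms(3)[OF a(1)] by simp
next
  case False
  thus ?thesis using assms(2) by simp
qed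

lemma norm_lebesgue_integral_le:
  fixes f :: "'a \<Rightarrow> 'b::{banach, second_countable_topology}"
  assumes "integrable N f" "integrable N g" "\<And>x. norm (f x) \<le> g x"
  shows "norm (integral\<^sup>L N f) \<le> integral\<^sup>L N g"
  using assms by (intro order_trans[OF integral_norm_bound integral_mono]) auto

lemma integrable_indicator_cball_scaleR:
  "integrable lborel (\<lambda>x :: 'a::euclidean_space. indicator (cball p r) x *\<^sub>R (M :: real))"
  using emeasure_lborel_cball_finite[of p r]
  by (intro integrable_scaleR_left integrable_real_indicator) (auto simp: infinity_ennreal_def)

lemma integrable_indicator_ball:
  "integrable lborel (\<lambda>x :: 'a::euclidean_space. indicator (ball p r) x :: real)"
  using emeasure_lborel_ball_finite[of p r]
  by (intro integrable_real_indicator) (auto simp: infinity_ennreal_def)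

lemma lborel_integral_translation:
  fixes f :: "'a::euclidean_space \<Rightarrow> 'b::{banach, second_countable_topology}"
  assumes [measurable]: "f \<in> borel_measurable borel"
  shows "(LINT x|lborel. f (x - p)) = (LINT x|lborel. f x)"
proof -
  have "(LINT x|lborel. f x) = (LINT x|distr lborel borel ((+) (- p)). f x)" by (simp add: lborel_distr_plus)
  also have "\<dots> = (LINT x|lborel. f (- p + x))" by (subst integral_distr) auto
  finally show ?thesis by (simp add: add.commute)
qed

lemma continuous_e_char: "continuous_on UNIV (\<lambda>x :: real^'d::finite. e_char (\<omega> \<bullet> x))"
  unfolding e_char_def by (intro continuous_intros)

lemma borel_measurable_e_char [measurable]: "(\<lambda>x :: real^'d::finite. e_char (\<omega> \<bullet> x)) \<in> borel_measurable borel"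
  by (rule borel_measurable_continuous_onI[OF continuous_e_char])

locale tile_profile = self_similar_substitution T \<zeta> L c
  for T :: "'m::finite \<Rightarrow> 'd::finite tile" and \<zeta> L c +
  fixes \<psi> :: "'m \<Rightarrow> real^'d \<Rightarrow> complex" and M :: real
  assumes M: "\<And>i x. norm (\<psi> i x) \<le> M"
    and \<psi>_outside: "\<And>i x. x \<notin> interior (supp i) \<Longrightarrow> \<psi> i x = 0"
    and \<psi>_cont: "\<And>i. continuous_on UNIV (\<psi> i)"
begin

lemma M_nonneg: "0 \<le> M"
  using M[of undefined undefined] norm_ge_zero order_trans by blast

lemma \<psi>_measurable [measurable]: "\<psi> i \<in> borel_measurable borel"
  by (rule borel_measurable_continuous_onI[OF \<psi>_cont])

definition \<psi>hat :: "real^'d \<Rightarrow> 'm \<Rightarrow> complex" where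
  "\<psi>hat \<omega> i = (LINT u|lborel. e_char (\<omega> \<bullet> u) * \<psi> i u)"

lemma tile_integrable: "integrable lborel (\<lambda>x. e_char (\<omega> \<bullet> x) * \<psi> i (x - p))"
proof (rule Bochner_Integration.integrable_bound)
  show "integrable lborel (\<lambda>x. indicator (cball p radius) x *\<^sub>R M)"
    by (rule integrable_indicator_cball_scaleR)
  show "(\<lambda>x. e_char (\<omega> \<bullet> x) * \<psi> i (x - p)) \<in> borel_measurable lborel" by measurable
  show "AE x in lborel. norm (e_char (\<omega> \<bullet> x) * \<psi> i (x - p)) \<le> norm (indicator (cball p radius) x *\<^sub>R M)"
  proof (rule AE_I2)
    fix x
    show "norm (e_char (\<omega> \<bullet> x) * \<psi> i (x - p)) \<le> norm (indicator (cball p radius) x *\<^sub>R M)"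
    proof (cases "x - p \<in> interior (supp i)")
      case True
      hence "x \<in> cball p radius"
        using supp_le_radius[of "x - p" i] interior_subset by (auto simp: dist_norm norm_minus_commute)
      thus ?thesis using M[of i "x - p"] M_nonneg by (simp add: norm_mult)
    qed (simp add: \<psi>_outside)
  qed
qed

lemma tile_integral: "(LINT x|lborel. e_char (\<omega> \<bullet> x) * \<psi> i (x - p)) = e_char (\<omega> \<bullet> p) * \<psi>hat \<omega> i"
proof -
  have "(LINT x|lborel. e_char (\<omega> \<bullet> x) * \<psi> i (x - p)) =
      (LINT x|lborel. (\<lambda>u. e_char (\<omega> \<bullet> p) * (e_char (\<omega> \<bullet> u) * \<psi> i u)) (x - p))"
    by (intro Bochner_Integration.integral_cong) (simp_all add: inner_diff_right flip: mult.assoc e_char_add)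
  also have "\<dots> = (LINT u|lborel. e_char (\<omega> \<bullet> p) * (e_char (\<omega> \<bullet> u) * \<psi> i u))"
    by (rule lborel_integral_translation) measurable
  finally show ?thesis using tile_integrable[of \<omega> i 0] by (simp add: \<psi>hat_def)
qed

definition volume_bound :: real where
  "volume_bound = measure lborel (cball (0 :: real^'d) radius)"

lemma norm_\<psi>hat_le: "norm (\<psi>hat \<omega> i) \<le> M * volume_bound"
proof -
  have "norm (\<psi>hat \<omega> i) \<le> (LINT u|lborel. indicator (cball (0 :: real^'d) radius) u *\<^sub>R M)"
    unfolding \<psi>hat_def
  proof (rule norm_lebesgue_integral_le)
    show "integrable lborel (\<lambda>u. e_char (\<omega> \<bullet> u) * \<psi> i u)" using tile_integrable[of \<omega> i 0] by simp
    show "integrable lborel (\<lambda>u :: real^'d. indicator (cball 0 radius) u *\<^sub>R M)"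
      by (rule integrable_indicator_cball_scaleR)
    fix u
    show "norm (e_char (\<omega> \<bullet> u) * \<psi> i u) \<le> indicator (cball 0 radius) u *\<^sub>R M"
    proof (cases "u \<in> interior (supp i)")
      case True
      hence "u \<in> cball 0 radius" using supp_le_radius[of u i] interior_subset by auto
      thus ?thesis using M[of i u] by (simp add: norm_mult)
    qed (simp add: \<psi>_outside M_nonneg)
  qed
  thus ?thesis by (simp add: volume_bound_def mult.commute)
qed

definition tile_fun :: "nat \<Rightarrow> 'm \<Rightarrow> real^'d \<Rightarrow> complex" where
  "tile_fun n j x = (\<Sum>(i, p)\<in>supertile n j. \<psi> i (x - p))"

lemma tile_fun_nonzero:
  assumes "tile_fun n j x \<noteq> 0"
  shows "x \<in> (L ^^ n) ` interior (supp j)" "norm x \<le> c ^ n * radius"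
proof -
  obtain t where t: "t \<in> supertile n j" "(case t of (i, p) \<Rightarrow> \<psi> i (x - p)) \<noteq> 0"
    using assms unfolding tile_fun_def by (rule sum.not_neutral_contains_not_neutral)
  obtain i p where "t = (i, p)" by (cases t)
  hence ip: "(i, p) \<in> supertile n j" "\<psi> i (x - p) \<noteq> 0" using t by auto
  hence int: "x - p \<in> interior (supp i)" using \<psi>_outside by blast
  show "x \<in> (L ^^ n) ` interior (supp j)" by (rule supertile_interior_subset[OF ip(1) int])
  show "norm x \<le> c ^ n * radius"
    using supertile_supp_norm[OF ip(1)] int interior_subset by blast
qed

lemma norm_tile_fun_le: "norm (tile_fun n j x) \<le> M"
  unfolding tile_fun_def
proof (rule norm_sum_at_most_one[OF finite_supertile M_nonneg])
  fix a b assume *: "a \<in> supertile n j" "b \<in> supertile n j"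
    "(case a of (i, p) \<Rightarrow> \<psi> i (x - p)) \<noteq> 0" "(case b of (i, p) \<Rightarrow> \<psi> i (x - p)) \<noteq> 0"
  obtain i p i' p' where eq: "a = (i, p)" "b = (i', p')" by (cases a; cases b)
  have "x - p \<in> interior (supp i)" "x - p' \<in> interior (supp i')"
    using *(3,4) \<psi>_outside by (auto simp: eq)
  thus "a = b" using supertile_disjoint *(1,2) unfolding eq by blast
qed (auto simp: M)

lemma tile_fun_integrable:
  "integrable lborel (\<lambda>x. e_char (\<omega> \<bullet> x) * tile_fun n j (x - p))"
proof -
  have "integrable lborel (\<lambda>x. \<Sum>(i, q)\<in>supertile n j. e_char (\<omega> \<bullet> x) * \<psi> i (x - (p + q)))"
    unfolding case_prod_beta by (intro Bochner_Integration.integrable_sum tile_integrable)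
  thus ?thesis by (simp add: tile_fun_def sum_distrib_left case_prod_beta diff_diff_eq)
qed

lemma tile_fun_integral:
  "(LINT x|lborel. e_char (\<omega> \<bullet> x) * tile_fun n j (x - p)) = e_char (\<omega> \<bullet> p) * twisted_sum \<omega> (\<psi>hat \<omega>) n j"
proof -
  have "(LINT x|lborel. e_char (\<omega> \<bullet> x) * tile_fun n j (x - p)) =
     (LINT x|lborel. (\<Sum>t\<in>supertile n j. e_char (\<omega> \<bullet> x) * \<psi> (fst t) (x - (p + snd t))))"
    by (simp add: tile_fun_def sum_distrib_left case_prod_beta diff_diff_eq)
  also have "\<dots> = (\<Sum>t\<in>supertile n j. LINT x|lborel. e_char (\<omega> \<bullet> x) * \<psi> (fst t) (x - (p + snd t)))"
    by (rule Bochner_Integration.integral_sum) (rule tile_integrable)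
  also have "\<dots> = e_char (\<omega> \<bullet> p) * twisted_sum \<omega> (\<psi>hat \<omega>) n j"
    by (simp add: tile_integral twisted_sum_def sum_distrib_left case_prod_beta inner_add_right e_char_add mult.assoc)
  finally show ?thesis .
qed

lemma tile_fun_add: "tile_fun (n + k) j x = (\<Sum>(i, p)\<in>supertile k j. tile_fun n i (x - (L ^^ n) p))"
  by (simp add: tile_fun_def sum_supertile_add case_prod_beta diff_diff_eq)

text \<open>The criterion is stated for positions only: a supertile of level \<open>n\<close> lies within \<open>c ^ n radius\<close>
  of its position \<open>L ^ n p\<close>.\<close>

definition inner_supertiles :: "nat \<Rightarrow> nat \<Rightarrow> 'm \<Rightarrow> real^'d \<Rightarrow> real \<Rightarrow> ('m \<times> (real^'d)) set" where
  "inner_supertiles n k j s R = {(i, p) \<in> supertile k j. norm ((L ^^ n) p - s) + c ^ n * radius < R}"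

lemma finite_inner_supertiles: "finite (inner_supertiles n k j s R)"
  by (rule finite_subset[OF _ finite_supertile[of k j]]) (auto simp: inner_supertiles_def)

text \<open>The supertiles that are not inner contribute only on the annulus within \<open>2 c ^ n radius\<close>
  of the boundary of the ball.\<close>

lemma ball_integral_inner_supertiles:
  assumes R: "2 * (c ^ n * radius) \<le> R"
  shows "norm ((LINT x:ball s R|lborel. e_char (\<omega> \<bullet> x) * tile_fun (n + k) j x) -
      (\<Sum>(i, p)\<in>inner_supertiles n k j s R. e_char (\<omega> \<bullet> (L ^^ n) p) * twisted_sum \<omega> (\<psi>hat \<omega>) n i))
    \<le> M * (measure lborel (ball s R) - measure lborel (ball s (R - 2 * (c ^ n * radius))))"
proof -
  define I where "I = inner_supertiles n k j s R"
  define O' where "O' = supertile k j - I"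
  define r where "r = c ^ n * radius"
  have r: "r > 0" using c radius_pos by (simp add: r_def)
  define F where "F x = (\<Sum>t\<in>O'. tile_fun n (fst t) (x - (L ^^ n) (snd t)))" for x
  define G where "G x = (\<Sum>t\<in>I. tile_fun n (fst t) (x - (L ^^ n) (snd t)))" for x
  have I: "I \<subseteq> supertile k j" by (auto simp: I_def inner_supertiles_def)
  have FG: "tile_fun (n + k) j x = G x + F x" for x
    unfolding tile_fun_add case_prod_beta F_def G_def O'_def
    using sum.subset_diff[OF I finite_supertile] by (simp add: add.commute)
  have Gint: "integrable lborel (\<lambda>x. e_char (\<omega> \<bullet> x) * G x)"
    unfolding G_def sum_distrib_left by (intro Bochner_Integration.integrable_sum tile_fun_integrable)
  have Fint: "integrable lborel (\<lambda>x. e_char (\<omega> \<bullet> x) * F x)"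
    unfolding F_def sum_distrib_left by (intro Bochner_Integration.integrable_sum tile_fun_integrable)
  have G_out: "G x = 0" if "x \<notin> ball s R" for x
    unfolding G_def
  proof (rule sum.neutral, rule ballI, rule ccontr)
    fix t assume t: "t \<in> I" "tile_fun n (fst t) (x - (L ^^ n) (snd t)) \<noteq> 0"
    have "norm (x - (L ^^ n) (snd t)) \<le> r" using tile_fun_nonzero(2)[OF t(2)] by (simp add: r_def)
    moreover have "norm ((L ^^ n) (snd t) - s) + r < R"
      using t(1) by (auto simp: I_def inner_supertiles_def r_def)
    moreover have "norm (x - s) \<le> norm (x - (L ^^ n) (snd t)) + norm ((L ^^ n) (snd t) - s)"
      using norm_triangle_ineq[of "x - (L ^^ n) (snd t)" "(L ^^ n) (snd t) - s"] by simp
    ultimately show False using that by (simp add: dist_norm norm_minus_commute)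
  qed
  have F_in: "F x = 0" if "x \<in> ball s (R - 2 * r)" for x
    unfolding F_def
  proof (rule sum.neutral, rule ballI, rule ccontr)
    fix t assume t: "t \<in> O'" "tile_fun n (fst t) (x - (L ^^ n) (snd t)) \<noteq> 0"
    have "norm (x - (L ^^ n) (snd t)) \<le> r" using tile_fun_nonzero(2)[OF t(2)] by (simp add: r_def)
    moreover have "norm ((L ^^ n) (snd t) - s) + r \<ge> R"
      using t(1) by (cases t) (auto simp: O'_def I_def inner_supertiles_def r_def)
    moreover have "norm ((L ^^ n) (snd t) - s) \<le> norm (x - (L ^^ n) (snd t)) + norm (x - s)"
      using norm_triangle_ineq4[of "x - s" "x - (L ^^ n) (snd t)"] by simp
    ultimately show False using that by (simp add: dist_norm norm_minus_commute)
  qed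
  have F_le: "norm (F x) \<le> M" for x
    unfolding F_def
  proof (rule norm_sum_at_most_one[OF _ M_nonneg norm_tile_fun_le])
    show "finite O'" by (simp add: O'_def finite_supertile)
    fix a b assume ab: "a \<in> O'" "b \<in> O'" "tile_fun n (fst a) (x - (L ^^ n) (snd a)) \<noteq> 0"
      "tile_fun n (fst b) (x - (L ^^ n) (snd b)) \<noteq> 0"
    obtain i p i' p' where eq: "a = (i, p)" "b = (i', p')" by (cases a; cases b)
    obtain y where y: "y \<in> interior (supp i)" "x - (L ^^ n) p = (L ^^ n) y"
      using tile_fun_nonzero(1)[OF ab(3)] by (auto simp: eq)
    obtain y' where y': "y' \<in> interior (supp i')" "x - (L ^^ n) p' = (L ^^ n) y'"
      using tile_fun_nonzero(1)[OF ab(4)] by (auto simp: eq)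
    have "(L ^^ n) (p + y) = (L ^^ n) (p' + y')" using y(2) y'(2) by (simp add: Ln_add algebra_simps)
    hence yy: "p + y = p' + y'" using inj_Ln by (auto dest: injD)
    have "(p + y) - p \<in> interior (supp i)" "(p + y) - p' \<in> interior (supp i')"
      using y(1) y'(1) by (simp, simp add: yy)
    thus "a = b" using supertile_disjoint ab(1,2) unfolding eq O'_def by blast
  qed
  have "(LINT x:ball s R|lborel. e_char (\<omega> \<bullet> x) * tile_fun (n + k) j x) =
      (LINT x|lborel. e_char (\<omega> \<bullet> x) * G x + indicator (ball s R) x *\<^sub>R (e_char (\<omega> \<bullet> x) * F x))"
    unfolding set_lebesgue_integral_def
    by (intro Bochner_Integration.integral_cong) (auto simp: FG G_out indicator_def distrib_left)
  also have "\<dots> = (LINT x|lborel. e_char (\<omega> \<bullet> x) * G x) +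
      (LINT x|lborel. indicator (ball s R) x *\<^sub>R (e_char (\<omega> \<bullet> x) * F x))"
    by (rule Bochner_Integration.integral_add[OF Gint integrable_mult_indicator[OF _ Fint]]) simp
  also have "(LINT x|lborel. e_char (\<omega> \<bullet> x) * G x) =
      (\<Sum>(i, p)\<in>I. e_char (\<omega> \<bullet> (L ^^ n) p) * twisted_sum \<omega> (\<psi>hat \<omega>) n i)"
    unfolding G_def sum_distrib_left case_prod_beta
    by (subst Bochner_Integration.integral_sum) (simp_all only: tile_fun_integrable tile_fun_integral)
  finally have "(LINT x:ball s R|lborel. e_char (\<omega> \<bullet> x) * tile_fun (n + k) j x) -
      (\<Sum>(i, p)\<in>I. e_char (\<omega> \<bullet> (L ^^ n) p) * twisted_sum \<omega> (\<psi>hat \<omega>) n i) =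
      (LINT x|lborel. indicator (ball s R) x *\<^sub>R (e_char (\<omega> \<bullet> x) * F x))" by simp
  also have "norm \<dots> \<le> (LINT x|lborel. M * (indicator (ball s R) x - indicator (ball s (R - 2 * r)) x))"
  proof (rule norm_lebesgue_integral_le)
    show "integrable lborel (\<lambda>x. indicator (ball s R) x *\<^sub>R (e_char (\<omega> \<bullet> x) * F x))"
      by (rule integrable_mult_indicator[OF _ Fint]) simp
    show "integrable lborel (\<lambda>x. M * (indicator (ball s R) x - indicator (ball s (R - 2 * r)) x))"
      by (intro integrable_mult_right Bochner_Integration.integrable_diff integrable_indicator_ball)
    fix x
    have "x \<in> ball s R" if "x \<in> ball s (R - 2 * r)" using that r by auto
    thus "norm (indicator (ball s R) x *\<^sub>R (e_char (\<omega> \<bullet> x) * F x)) \<le>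
        M * (indicator (ball s R) x - indicator (ball s (R - 2 * r)) x)"
      using F_le[of x] F_in[of x] M_nonneg by (auto simp: indicator_def norm_mult)
  qed
  also have "\<dots> = M * (measure lborel (ball s R) - measure lborel (ball s (R - 2 * r)))"
  proof -
    note int = integrable_indicator_ball
    show ?thesis by (subst integral_mult_right_zero, subst Bochner_Integration.integral_diff[OF int int]) simp
  qed
  finally show ?thesis by (simp add: I_def r_def)
qed

lemma inner_supertiles_tiles:
  "card ((\<lambda>((i', p'), (i, q)). (i, (L ^^ n) p' + q)) ` (SIGMA (i', p'):inner_supertiles n k j s R. supertile n i'))
     = (\<Sum>(i, p)\<in>inner_supertiles n k j s R. card (supertile n i))"
proof -
  have "inj_on (\<lambda>((i', p'), (i, q)). (i, (L ^^ n) p' + q)) (SIGMA (i', p'):inner_supertiles n k j s R. supertile n i')"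
    by (rule inj_on_subset[OF inj_on_supertile_add[of n k j]]) (auto simp: inner_supertiles_def)
  thus ?thesis
    by (subst card_image) (simp_all add: finite_inner_supertiles finite_supertile card_SigmaI case_prod_beta)
qed

lemma inner_supertiles_upper:
  assumes v0: "\<And>n j A B. A \<subseteq> supertile n j \<Longrightarrow> B \<in> lmeasurable \<Longrightarrow>
     (\<forall>(i, p)\<in>A. (+) p ` interior (supp i) \<subseteq> B) \<Longrightarrow> v0 * real (card A) \<le> measure lebesgue B"
  shows "v0 * (\<Sum>(i, p)\<in>inner_supertiles n k j s R. csize n i) \<le> measure lborel (ball s R)"
proof -
  let ?I = "inner_supertiles n k j s R"
  let ?A = "(\<lambda>((i', p'), (i, q)). (i, (L ^^ n) p' + q)) ` (SIGMA (i', p'):?I. supertile n i')"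
  have "v0 * real (card ?A) \<le> measure lebesgue (ball s R)"
  proof (rule v0[of _ "n + k" j])
    show "?A \<subseteq> supertile (n + k) j"
      unfolding supertile_add_image by (rule image_mono) (auto simp: inner_supertiles_def)
    show "\<forall>(i, p)\<in>?A. (+) p ` interior (supp i) \<subseteq> ball s R"
    proof (clarify)
      fix i' p' i q z
      assume *: "(i', p') \<in> ?I" "(i, q) \<in> supertile n i'" "z \<in> interior (supp i)"
      have "(q + z) - q \<in> supp i" using *(3) interior_subset by auto
      hence "norm (q + z) \<le> c ^ n * radius" by (rule supertile_supp_norm[OF *(2)])
      moreover have "norm ((L ^^ n) p' - s) + c ^ n * radius < R" using *(1) by (auto simp: inner_supertiles_def)
      moreover have "norm ((L ^^ n) p' + q + z - s) \<le> norm (q + z) + norm ((L ^^ n) p' - s)"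
        using norm_triangle_ineq[of "q + z" "(L ^^ n) p' - s"] by (simp add: algebra_simps)
      ultimately show "(L ^^ n) p' + q + z \<in> ball s R" by (simp add: dist_norm norm_minus_commute)
    qed
  qed simp
  thus ?thesis unfolding inner_supertiles_tiles by (simp add: measure_completion case_prod_beta)
qed

lemma inner_supertiles_lower:
  assumes V1: "\<And>A B. finite A \<Longrightarrow> B \<in> lmeasurable \<Longrightarrow>
     (\<forall>x\<in>B. \<exists>(i, p)\<in>A. x - p \<in> supp i) \<Longrightarrow> measure lebesgue B \<le> V1 * real (card A)"
    and sub: "ball s R \<subseteq> (L ^^ (n + k)) ` supp j"
  shows "measure lborel (ball s (R - 2 * (c ^ n * radius))) \<le>
     V1 * (\<Sum>(i, p)\<in>inner_supertiles n k j s R. csize n i)"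
proof -
  let ?I = "inner_supertiles n k j s R"
  let ?A = "(\<lambda>((i', p'), (i, q)). (i, (L ^^ n) p' + q)) ` (SIGMA (i', p'):?I. supertile n i')"
  have "measure lebesgue (ball s (R - 2 * (c ^ n * radius))) \<le> V1 * real (card ?A)"
  proof (rule V1)
    have "finite (SIGMA (i', p'):?I. supertile n i')"
      by (rule finite_SigmaI) (auto simp: finite_inner_supertiles finite_supertile)
    thus "finite ?A" by (rule finite_imageI)
    show "\<forall>x\<in>ball s (R - 2 * (c ^ n * radius)). \<exists>(i, p)\<in>?A. x - p \<in> supp i"
    proof
      fix x assume x: "x \<in> ball s (R - 2 * (c ^ n * radius))"
      have "0 \<le> c ^ n * radius" using c radius_pos by simp
      hence "x \<in> ball s R" using x by auto
      hence "x \<in> (L ^^ (n + k)) ` supp j" using sub by blast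
      then obtain i P where iP: "(i, P) \<in> supertile (n + k) j" "x - P \<in> supp i"
        using supertile_supp[of "n + k" j x] by auto
      then obtain i' p' where p': "(i', p') \<in> supertile k j" "(i, P - (L ^^ n) p') \<in> supertile n i'"
        by (auto simp: in_supertile_add_iff)
      have "(x - (L ^^ n) p') - (P - (L ^^ n) p') \<in> supp i" using iP(2) by simp
      hence "norm (x - (L ^^ n) p') \<le> c ^ n * radius" by (rule supertile_supp_norm[OF p'(2)])
      moreover have "norm ((L ^^ n) p' - s) \<le> norm (x - (L ^^ n) p') + norm (x - s)"
        using norm_triangle_ineq4[of "x - s" "x - (L ^^ n) p'"] by simp
      ultimately have "(i', p') \<in> ?I"
        using x p'(1) by (simp add: inner_supertiles_def dist_norm norm_minus_commute)
      hence "(i, P) \<in> ?A"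
        using p'(2) by (intro image_eqI[of _ _ "((i', p'), (i, P - (L ^^ n) p'))"]) auto
      thus "\<exists>(i, p)\<in>?A. x - p \<in> supp i" using iP(2) by blast
    qed
  qed simp
  thus ?thesis unfolding inner_supertiles_tiles by (simp add: measure_completion case_prod_beta)
qed

end

section \<open>Ergodic integrals over balls\<close>

lemma ball_volume_annulus:
  fixes s :: "'a::euclidean_space" and \<delta> R :: real
  assumes "0 \<le> \<delta>" "\<delta> \<le> R" "0 < R"
  shows "measure lborel (ball s R) - measure lborel (ball s (R - \<delta>)) \<le>
    (DIM('a) * \<delta> / R) * measure lborel (ball s R)"
proof -
  have "1 + real DIM('a) * (- \<delta> / R) \<le> (1 + (- \<delta> / R)) ^ DIM('a)"
    using assms by (intro Bernoulli_inequality) (simp add: field_simps)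
  hence "R ^ DIM('a) * (1 - real DIM('a) * \<delta> / R) \<le> R ^ DIM('a) * (1 - \<delta> / R) ^ DIM('a)"
    using assms by (intro mult_left_mono) auto
  also have "\<dots> = (R - \<delta>) ^ DIM('a)"
    using assms by (simp add: power_mult_distrib[symmetric] right_diff_distrib)
  finally have "unit_ball_vol (real DIM('a)) * (R ^ DIM('a) * (1 - real DIM('a) * \<delta> / R)) \<le>
      unit_ball_vol (real DIM('a)) * (R - \<delta>) ^ DIM('a)"
    by (intro mult_left_mono) auto
  thus ?thesis using assms by (simp add: content_ball algebra_simps)
qed

lemma ball_volume_half:
  fixes s :: "'a::euclidean_space"
  assumes "R / 2 \<le> R'" "0 < R"
  shows "measure lborel (ball s R) / 2 ^ DIM('a) \<le> measure lborel (ball s R')"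
proof -
  have "(R / 2) ^ DIM('a) \<le> R' ^ DIM('a)" using assms by (intro power_mono) auto
  hence "unit_ball_vol (real DIM('a)) * (R / 2) ^ DIM('a) \<le> unit_ball_vol (real DIM('a)) * R' ^ DIM('a)"
    by (intro mult_left_mono) auto
  thus ?thesis using assms by (simp add: content_ball power_divide)
qed

context self_similar_substitution
begin

text \<open>These constants depend on the substitution only, which makes the final estimate uniform in the
  cylindrical function.\<close>

definition packing_volume :: real where
  "packing_volume = (SOME v0. v0 > 0 \<and> (\<forall>n j A B. A \<subseteq> supertile n j \<longrightarrow> B \<in> lmeasurable \<longrightarrow>
     (\<forall>(i, p)\<in>A. (+) p ` interior (supp i) \<subseteq> B) \<longrightarrow> v0 * real (card A) \<le> measure lebesgue B))"

definition covering_volume :: real where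
  "covering_volume = (SOME V1. V1 > 0 \<and> (\<forall>A B. finite A \<longrightarrow> B \<in> lmeasurable \<longrightarrow>
     (\<forall>x\<in>B. \<exists>(i, p)\<in>A. x - p \<in> supp i) \<longrightarrow> measure lebesgue B \<le> V1 * real (card A)))"

lemma packing_volume_spec:
  "packing_volume > 0 \<and> (\<forall>n j A B. A \<subseteq> supertile n j \<longrightarrow> B \<in> lmeasurable \<longrightarrow>
     (\<forall>(i, p)\<in>A. (+) p ` interior (supp i) \<subseteq> B) \<longrightarrow> packing_volume * real (card A) \<le> measure lebesgue B)"
  unfolding packing_volume_def by (rule someI_ex[OF supertile_packing])

lemmas packing_volume_pos = packing_volume_spec[THEN conjunct1]

lemma covering_volume_spec:
  "covering_volume > 0 \<and> (\<forall>A B. finite A \<longrightarrow> B \<in> lmeasurable \<longrightarrow>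
     (\<forall>x\<in>B. \<exists>(i, p)\<in>A. x - p \<in> supp i) \<longrightarrow> measure lebesgue B \<le> covering_volume * real (card A))"
  unfolding covering_volume_def by (rule someI_ex[OF supertile_covering])

lemmas covering_volume_pos = covering_volume_spec[THEN conjunct1]

lemma packing_volume: "A \<subseteq> supertile n j \<Longrightarrow> B \<in> lmeasurable \<Longrightarrow>
     (\<forall>(i, p)\<in>A. (+) p ` interior (supp i) \<subseteq> B) \<Longrightarrow> packing_volume * real (card A) \<le> measure lebesgue B"
  by (rule packing_volume_spec[THEN conjunct2, THEN spec, THEN spec, THEN spec, THEN spec, THEN mp, THEN mp, THEN mp])

lemma covering_volume: "finite A \<Longrightarrow> B \<in> lmeasurable \<Longrightarrow>
     (\<forall>x\<in>B. \<exists>(i, p)\<in>A. x - p \<in> supp i) \<Longrightarrow> measure lebesgue B \<le> covering_volume * real (card A)"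
  by (rule covering_volume_spec[THEN conjunct2, THEN spec, THEN spec, THEN mp, THEN mp, THEN mp])

lemma ball_in_supertile_level:
  assumes "ball s R \<subseteq> (L ^^ N) ` supp j" "c ^ n * radius < R"
  shows "n \<le> N"
proof (rule ccontr)
  assume "\<not> n \<le> N"
  hence "c ^ N \<le> c ^ n" using c by (intro power_increasing) auto
  hence "c ^ N * radius \<le> c ^ n * radius" using radius_pos by (intro mult_right_mono) auto
  have "ball s R \<subseteq> cball 0 (c ^ N * radius)"
  proof
    fix x assume "x \<in> ball s R"
    then obtain y where "y \<in> supp j" "x = (L ^^ N) y" using assms(1) by blast
    thus "x \<in> cball 0 (c ^ N * radius)"
      using supp_le_radius[of y j] c by (simp add: norm_Ln mult_left_mono)
  qed
  moreover have "0 < c ^ n * radius" using c radius_pos by simp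
  hence "0 < R" using assms(2) by linarith
  ultimately have "dist s 0 + R \<le> c ^ N * radius" by (simp only: ball_subset_cball_iff) auto
  hence "R \<le> c ^ N * radius" using zero_le_dist[of s 0] by linarith
  with \<open>c ^ N * radius \<le> c ^ n * radius\<close> assms(2) show False by linarith
qed

lemma tiling_space_patch:
  assumes "X \<in> tiling_space T \<zeta> L" "P \<subseteq> X" "finite P"
  obtains n j s where "shift s ` P \<subseteq> (subst_ext T \<zeta> L ^^ n) {T j}"
  using assms by (auto simp: tiling_space_def)

text \<open>Every finite set of tiles of \<open>X\<close> is a translate of a set of tiles of a supertile, where the packing bound
  limits the number of tiles in a bounded region.\<close>

lemma supertile_packing_finite:
  assumes X: "X \<in> tiling_space T \<zeta> L"
  shows "finite {t \<in> X. fst t \<inter> cball 0 R \<noteq> {}}"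
proof -
  let ?Q = "{(i, p). shift p (T i) \<in> X \<and> norm p \<le> R + radius}"
  define K where "K = nat \<lceil>measure lborel (cball (0 :: real^'d) (R + 2 * radius)) / packing_volume\<rceil>"
  have "card F \<le> K" if F: "F \<subseteq> ?Q" "finite F" for F
  proof -
    have F': "(\<lambda>(i, p). shift p (T i)) ` F \<subseteq> X" "finite ((\<lambda>(i, p). shift p (T i)) ` F)" using F by auto
    obtain n j s where njs: "shift s ` (\<lambda>(i, p). shift p (T i)) ` F \<subseteq> (subst_ext T \<zeta> L ^^ n) {T j}"
      by (rule tiling_space_patch[OF X F'])
    define A where "A = (\<lambda>(i, p). (i, s + p)) ` F"
    have "card A = card F" unfolding A_def by (rule card_image) (auto simp: inj_on_def)
    moreover have "packing_volume * real (card A) \<le> measure lebesgue (cball s (R + 2 * radius))"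
    proof (rule packing_volume)
      show "A \<subseteq> supertile n j"
        using njs by (fastforce simp: A_def supertile_def shift_shift)
      show "\<forall>(i, p)\<in>A. (+) p ` interior (supp i) \<subseteq> cball s (R + 2 * radius)"
      proof (clarify)
        fix i p z assume *: "(i, p) \<in> A" "z \<in> interior (supp i)"
        then obtain q where q: "p = s + q" "(i, q) \<in> F" by (auto simp: A_def)
        hence "norm q \<le> R + radius" using F by auto
        moreover have "norm z \<le> radius" using * interior_subset supp_le_radius by blast
        ultimately have "norm (q + z) \<le> R + 2 * radius" using norm_triangle_ineq[of q z] by linarith
        moreover have "dist s (p + z) = norm ((s + (q + z)) - s)"
          by (simp only: dist_norm norm_minus_commute q add.assoc)
        ultimately show "p + z \<in> cball s (R + 2 * radius)" by simp
      qed
    qed simp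
    moreover have "measure lebesgue (cball s (R + 2 * radius)) = measure lborel (cball (0 :: real^'d) (R + 2 * radius))"
    proof -
      have "cball s (R + 2 * radius) = (+) s ` cball 0 (R + 2 * radius)" by simp
      thus ?thesis by (simp only: measure_translation) (simp add: measure_completion)
    qed
    ultimately have "packing_volume * real (card F) \<le> measure lborel (cball (0 :: real^'d) (R + 2 * radius))" by simp
    hence "real (card F) \<le> measure lborel (cball (0 :: real^'d) (R + 2 * radius)) / packing_volume"
      using packing_volume_pos by (simp add: field_simps)
    thus ?thesis unfolding K_def by linarith
  qed
  hence "finite ?Q" by (rule finite_if_finite_subsets_card_bdd[THEN conjunct1]) blast
  moreover have "{t \<in> X. fst t \<inter> cball 0 R \<noteq> {}} \<subseteq> (\<lambda>(i, p). shift p (T i)) ` ?Q"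
  proof
    fix t assume t: "t \<in> {t \<in> X. fst t \<inter> cball 0 R \<noteq> {}}"
    hence tX: "t \<in> X" and ne: "fst t \<inter> cball 0 R \<noteq> {}" by simp_all
    have "over_alphabet T X" using X by (simp add: tiling_space_def)
    then obtain i p where ip: "t = shift p (T i)" using tX unfolding over_alphabet_def by blast
    obtain x where x: "x \<in> fst t" "norm x \<le> R" using ne by auto
    have "x - p \<in> supp i" using x(1) unfolding ip fst_shift_T .
    hence "norm (x - p) \<le> radius" by (rule supp_le_radius)
    hence "norm p \<le> R + radius" using x(2) norm_triangle_ineq4[of x "x - p"] by simp
    thus "t \<in> (\<lambda>(i, p). shift p (T i)) ` ?Q" using tX ip by (intro image_eqI[of _ _ "(i, p)"]) auto
  qed
  ultimately show ?thesis by (meson finite_imageI finite_subset)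
qed

end

context tile_profile
begin

abbreviation ball_integral :: "real^'d \<Rightarrow> nat \<Rightarrow> 'm \<Rightarrow> real^'d \<Rightarrow> real \<Rightarrow> complex" where
  "ball_integral \<omega> N j s R \<equiv> (LINT x:ball s R|lborel. e_char (\<omega> \<bullet> x) * tile_fun N j x)"

definition annulus_error :: "nat \<Rightarrow> real \<Rightarrow> real" where
  "annulus_error n R = M * (CARD('d) * (2 * (c ^ n * radius)) / R)"

lemma annulus_error:
  assumes "2 * (c ^ n * radius) \<le> R" "0 < R"
  shows "M * (measure lborel (ball s R) - measure lborel (ball s (R - 2 * (c ^ n * radius)))) \<le>
    annulus_error n R * measure lborel (ball (s :: real^'d) R)"
proof -
  have "measure lborel (ball s R) - measure lborel (ball s (R - 2 * (c ^ n * radius))) \<le>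
      (CARD('d) * (2 * (c ^ n * radius)) / R) * measure lborel (ball s R)"
    using ball_volume_annulus[of "2 * (c ^ n * radius)" R s] assms c radius_pos by simp
  hence "M * (measure lborel (ball s R) - measure lborel (ball s (R - 2 * (c ^ n * radius)))) \<le>
      M * ((CARD('d) * (2 * (c ^ n * radius)) / R) * measure lborel (ball s R))"
    by (intro mult_left_mono M_nonneg)
  thus ?thesis by (simp add: annulus_error_def mult.assoc)
qed

lemma ball_integral_bound:
  assumes sub: "ball s R \<subseteq> (L ^^ N) ` supp j" and R: "2 * (c ^ n * radius) \<le> R"
    and B: "twisted_bound \<omega> (\<psi>hat \<omega>) n B" "B \<ge> 0"
  shows "norm (ball_integral \<omega> N j s R) \<le> (annulus_error n R + B / packing_volume) * measure lborel (ball s R)"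
proof -
  have cr: "c ^ n * radius > 0" using c radius_pos by simp
  hence "n \<le> N" using R by (intro ball_in_supertile_level[OF sub]) linarith
  then obtain k where N: "N = n + k" by (metis le_Suc_ex)
  let ?I = "inner_supertiles n k j s R"
  have "norm (\<Sum>(i, p)\<in>?I. e_char (\<omega> \<bullet> (L ^^ n) p) * twisted_sum \<omega> (\<psi>hat \<omega>) n i) \<le> (\<Sum>(i, p)\<in>?I. B * csize n i)"
    using B(1) by (intro sum_norm_le) (auto simp: norm_mult twisted_bound_def case_prod_beta)
  also have "\<dots> = B / packing_volume * (packing_volume * (\<Sum>(i, p)\<in>?I. csize n i))"
    using packing_volume_pos by (simp add: sum_distrib_left case_prod_beta)
  also have "\<dots> \<le> B / packing_volume * measure lborel (ball s R)"
    using B(2) packing_volume_pos by (intro mult_left_mono inner_supertiles_upper packing_volume) auto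
  finally have "norm (\<Sum>(i, p)\<in>?I. e_char (\<omega> \<bullet> (L ^^ n) p) * twisted_sum \<omega> (\<psi>hat \<omega>) n i) \<le>
    B / packing_volume * measure lborel (ball s R)" .
  moreover have "norm (ball_integral \<omega> N j s R -
      (\<Sum>(i, p)\<in>?I. e_char (\<omega> \<bullet> (L ^^ n) p) * twisted_sum \<omega> (\<psi>hat \<omega>) n i)) \<le>
      annulus_error n R * measure lborel (ball s R)"
    unfolding N using R cr
    by (intro order_trans[OF ball_integral_inner_supertiles annulus_error]) auto
  ultimately show ?thesis
    unfolding distrib_right
    using norm_triangle_sub[of "ball_integral \<omega> N j s R"
      "\<Sum>(i, p)\<in>?I. e_char (\<omega> \<bullet> (L ^^ n) p) * twisted_sum \<omega> (\<psi>hat \<omega>) n i"] by linarith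
qed

lemma ball_integral_zero_frequency:
  assumes sub: "ball s R \<subseteq> (L ^^ N) ` supp j" and R: "4 * (c ^ n * radius) \<le> R"
    and lohi: "\<And>i. lo * csize n i \<le> Re (\<beta> * twisted_sum 0 (\<psi>hat 0) n i)"
       "\<And>i. Re (\<beta> * twisted_sum 0 (\<psi>hat 0) n i) \<le> hi * csize n i"
    and \<beta>: "norm \<beta> = 1"
  obtains S where "measure lborel (ball s R) / (2 ^ CARD('d) * covering_volume) \<le> S"
    "S \<le> measure lborel (ball s R) / packing_volume"
    "lo * S - annulus_error n R * measure lborel (ball s R) \<le> Re (\<beta> * ball_integral 0 N j s R)"
    "Re (\<beta> * ball_integral 0 N j s R) \<le> hi * S + annulus_error n R * measure lborel (ball s R)"
proof -
  have cr: "c ^ n * radius > 0" using c radius_pos by simp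
  hence "n \<le> N" using R by (intro ball_in_supertile_level[OF sub]) linarith
  then obtain k where N: "N = n + k" by (metis le_Suc_ex)
  let ?I = "inner_supertiles n k j s R"
  define S where "S = (\<Sum>(i, p)\<in>?I. csize n i)"
  define J where "J = (\<Sum>(i, p)\<in>?I. e_char (0 \<bullet> (L ^^ n) p) * twisted_sum 0 (\<psi>hat 0) n i)"
  have J: "Re (\<beta> * J) = (\<Sum>(i, p)\<in>?I. Re (\<beta> * twisted_sum 0 (\<psi>hat 0) n i))"
    by (simp add: J_def case_prod_beta sum_distrib_left)
  have "lo * S \<le> Re (\<beta> * J)" "Re (\<beta> * J) \<le> hi * S"
    unfolding J S_def sum_distrib_left case_prod_beta using lohi by (auto intro!: sum_mono)
  moreover have "\<bar>Re (\<beta> * ball_integral 0 N j s R) - Re (\<beta> * J)\<bar> \<le> annulus_error n R * measure lborel (ball s R)"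
  proof -
    have "\<bar>Re (\<beta> * ball_integral 0 N j s R) - Re (\<beta> * J)\<bar> \<le> norm (\<beta> * (ball_integral 0 N j s R - J))"
      using abs_Re_le_cmod[of "\<beta> * (ball_integral 0 N j s R - J)"] by (simp add: right_diff_distrib)
    also have "\<dots> = norm (ball_integral 0 N j s R - J)" using \<beta> by (simp add: norm_mult)
    also have "\<dots> \<le> annulus_error n R * measure lborel (ball s R)"
      unfolding N J_def using R cr
      by (intro order_trans[OF ball_integral_inner_supertiles annulus_error]) auto
    finally show ?thesis .
  qed
  moreover have "measure lborel (ball s R) / (2 ^ CARD('d) * covering_volume) \<le> S"
  proof -
    have "measure lborel (ball s R) / 2 ^ DIM(real^'d) \<le> measure lborel (ball s (R - 2 * (c ^ n * radius)))"
      using R cr by (intro ball_volume_half) auto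
    also have "\<dots> \<le> covering_volume * S"
      unfolding S_def using sub N by (intro inner_supertiles_lower covering_volume) auto
    finally show ?thesis using covering_volume_pos by (simp add: field_simps)
  qed
  moreover have "S \<le> measure lborel (ball s R) / packing_volume"
  proof -
    have "packing_volume * S \<le> measure lborel (ball s R)"
      unfolding S_def by (intro inner_supertiles_upper packing_volume) auto
    thus ?thesis using packing_volume_pos by (simp add: field_simps)
  qed
  ultimately show ?thesis by (intro that[of S]) linarith+
qed

end

section \<open>Cylindrical functions along orbits\<close>

locale cylindrical_profile = tile_profile T \<zeta> L c \<psi> M
  for T :: "'m::finite \<Rightarrow> 'd::finite tile" and \<zeta> L c \<psi> M +
  fixes f :: "'d tile set \<Rightarrow> complex" and \<Lambda> :: real
  assumes f: "\<And>X i s. X \<in> tiling_space T \<zeta> L \<Longrightarrow> shift (- s) (T i) \<in> X \<Longrightarrow> s \<in> supp i \<Longrightarrow> f X = \<psi> i s"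
    and action_space: "\<And>X s. X \<in> tiling_space T \<zeta> L \<Longrightarrow> action s X \<in> tiling_space T \<zeta> L"
    and \<psi>_Lipschitz: "\<And>i x y. norm (\<psi> i x - \<psi> i y) \<le> \<Lambda> * norm (x - y)"
begin

lemma tile_at:
  assumes X: "X \<in> tiling_space T \<zeta> L"
  obtains i p where "shift p (T i) \<in> X" "x - p \<in> supp i"
proof -
  have "x \<in> psupp X" "over_alphabet T X" using X by (auto simp: tiling_space_def tiling_def)
  then obtain t where "t \<in> X" "x \<in> fst t" unfolding psupp_def by blast
  with \<open>over_alphabet T X\<close> obtain i p where "t = shift p (T i)" by (auto simp: over_alphabet_def)
  with \<open>t \<in> X\<close> \<open>x \<in> fst t\<close> show thesis by (intro that[of p i]) (auto simp: fst_shift_T)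
qed

lemma f_action:
  assumes X: "X \<in> tiling_space T \<zeta> L" and t: "shift p (T i) \<in> X" "x - p \<in> supp i"
  shows "f (action x X) = \<psi> i (x - p)"
proof (rule f[OF action_space[OF X] _ t(2)])
  have "shift (- x) (shift p (T i)) \<in> action x X" using t(1) by (auto simp: action_def)
  thus "shift (- (x - p)) (T i) \<in> action x X" by (simp add: shift_shift)
qed

lemma norm_f_le: assumes "X \<in> tiling_space T \<zeta> L" shows "norm (f X) \<le> M"
proof -
  obtain i p where "shift p (T i) \<in> X" "0 - p \<in> supp i" using tile_at[OF assms] by blast
  hence "f X = \<psi> i (- p)" using f[OF assms, of "- p" i] by simp
  thus ?thesis by (simp add: M)
qed

text \<open>A path that leaves a tile crosses its boundary, where the profile vanishes; so two Lipschitz estimates suffice.\<close>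

lemma f_orbit_Lipschitz:
  assumes X: "X \<in> tiling_space T \<zeta> L"
  shows "norm (f (action x X) - f (action y X)) \<le> 2 * \<Lambda> * norm (x - y)"
proof -
  have L0: "0 \<le> \<Lambda> * norm (x - y)" using \<psi>_Lipschitz norm_ge_zero order_trans by blast
  obtain i p where t: "shift p (T i) \<in> X" "x - p \<in> supp i" by (rule tile_at[OF X])
  obtain i' p' where t': "shift p' (T i') \<in> X" "y - p' \<in> supp i'" by (rule tile_at[OF X])
  note fx = f_action[OF X t] and fy = f_action[OF X t']
  have l: "norm (\<psi> i (x - p) - \<psi> i (y - p)) \<le> \<Lambda> * norm (x - y)"
    using \<psi>_Lipschitz[of i "x - p" "y - p"] by simp
  have l': "norm (\<psi> i' (x - p') - \<psi> i' (y - p')) \<le> \<Lambda> * norm (x - y)"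
    using \<psi>_Lipschitz[of i' "x - p'" "y - p'"] by simp
  consider "y - p \<in> supp i" | "x - p' \<in> supp i'" | "y - p \<notin> supp i" "x - p' \<notin> supp i'" by blast
  thus ?thesis
  proof cases
    case 1
    thus ?thesis using f_action[OF X t(1) 1] fx l L0 by simp
  next
    case 2
    thus ?thesis using f_action[OF X t'(1) 2] fy l' L0 by simp
  next
    case 3
    have "\<psi> i (y - p) = 0" "\<psi> i' (x - p') = 0"
      using 3 interior_subset \<psi>_outside by blast+
    hence "norm (\<psi> i (x - p)) \<le> \<Lambda> * norm (x - y)" "norm (\<psi> i' (y - p')) \<le> \<Lambda> * norm (x - y)"
      using l l' by simp_all
    thus ?thesis using norm_triangle_ineq4[of "f (action x X)" "f (action y X)"] by (simp add: fx fy)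
  qed
qed

text \<open>The finitely many tiles that meet the ball form a patch of a supertile by the definition of the hull.
  They cover the ball, so the further tiles of this supertile have no interior points there.\<close>

lemma orbit_in_supertile:
  assumes X: "X \<in> tiling_space T \<zeta> L"
  obtains N j s where "ball s R \<subseteq> (L ^^ N) ` supp j"
    "\<And>x. x \<in> ball 0 R \<Longrightarrow> f (action x X) = tile_fun N j (x + s)"
proof -
  define P where "P = {t \<in> X. fst t \<inter> cball 0 R \<noteq> {}}"
  have P': "P \<subseteq> X" "finite P" unfolding P_def using supertile_packing_finite[OF X] by auto
  obtain N j s where P: "shift s ` P \<subseteq> (subst_ext T \<zeta> L ^^ N) {T j}"
    by (rule tiling_space_patch[OF X P'])
  have in_st: "(i, p + s) \<in> supertile N j"
    if "shift p (T i) \<in> X" "x - p \<in> supp i" "x \<in> ball 0 R" for i p x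
  proof -
    have "x \<in> fst (shift p (T i)) \<inter> cball 0 R" using that by (auto simp: fst_shift_T)
    hence "shift p (T i) \<in> P" using that by (auto simp: P_def)
    hence "shift s (shift p (T i)) \<in> (subst_ext T \<zeta> L ^^ N) {T j}" using P by blast
    thus ?thesis by (simp add: supertile_def shift_shift add.commute)
  qed
  show thesis
  proof (rule that[of s N j])
    show "ball s R \<subseteq> (L ^^ N) ` supp j"
    proof
      fix y assume y: "y \<in> ball s R"
      obtain i p where t: "shift p (T i) \<in> X" "(y - s) - p \<in> supp i" by (rule tile_at[OF X])
      have "y - s \<in> ball 0 R" using y by (simp add: dist_norm norm_minus_commute)
      hence "(i, p + s) \<in> supertile N j" by (rule in_st[OF t])
      moreover have "y - (p + s) \<in> supp i" using t(2) by (simp add: algebra_simps)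
      ultimately show "y \<in> (L ^^ N) ` supp j" using supertile_supp[of N j y] by blast
    qed
    fix x :: "real^'d" assume x: "x \<in> ball 0 R"
    obtain i p where t: "shift p (T i) \<in> X" "x - p \<in> supp i" by (rule tile_at[OF X])
    note st = in_st[OF t x]
    have "tile_fun N j (x + s) = (\<Sum>t\<in>{(i, p + s)}. case t of (i, p) \<Rightarrow> \<psi> i (x + s - p))"
      unfolding tile_fun_def
    proof (rule sum.mono_neutral_right[OF finite_supertile])
      show "\<forall>t\<in>supertile N j - {(i, p + s)}. (case t of (i, p) \<Rightarrow> \<psi> i (x + s - p)) = 0"
      proof (rule ballI, rule ccontr)
        fix t assume t': "t \<in> supertile N j - {(i, p + s)}" "(case t of (i, p) \<Rightarrow> \<psi> i (x + s - p)) \<noteq> 0"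
        obtain i' p' where eq: "t = (i', p')" by (cases t)
        have *: "(i', p') \<in> supertile N j" "(i', p') \<noteq> (i, p + s)" "\<psi> i' (x + s - p') \<noteq> 0"
          using t' unfolding eq by auto
        have "x + s - p' \<in> interior (supp i')" using *(3) \<psi>_outside by blast
        moreover have "x + s - (p + s) \<in> supp i" using t(2) by simp
        ultimately show False using supertile_interior_unique[OF *(1) st] *(2) by blast
      qed
    qed (use st in simp)
    also have "\<dots> = f (action x X)" using f_action[OF X t] by simp
    finally show "f (action x X) = tile_fun N j (x + s)" by simp
  qed
qed

lemma orbit_integral:
  assumes X: "X \<in> tiling_space T \<zeta> L"
  obtains N j s where "ball s R \<subseteq> (L ^^ N) ` supp j"
    "\<And>\<omega>. (LINT x:ball 0 R|lborel. e_char (\<omega> \<bullet> x) * f (action x X)) = e_char (- (\<omega> \<bullet> s)) * ball_integral \<omega> N j s R"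
    "\<And>\<omega>. set_integrable lborel (ball 0 R) (\<lambda>x. e_char (\<omega> \<bullet> x) * f (action x X))"
proof -
  obtain N j s where *: "ball s R \<subseteq> (L ^^ N) ` supp j"
    "\<And>x. x \<in> ball 0 R \<Longrightarrow> f (action x X) = tile_fun N j (x + s)"
  proof (rule orbit_in_supertile[OF X, of R], goal_cases)
    case prems: (1 s N j)
    show ?case by (rule prems(1)[OF prems(2,3)])
  qed
  have int: "integrable lborel (\<lambda>x. e_char (\<omega> \<bullet> x) * tile_fun N j (x + s))" for \<omega>
    using tile_fun_integrable[of \<omega> N j "- s"] by simp
  have eq: "indicator (ball 0 R) x *\<^sub>R (e_char (\<omega> \<bullet> x) * f (action x X)) =
      indicator (ball 0 R) x *\<^sub>R (e_char (\<omega> \<bullet> x) * tile_fun N j (x + s))" for x \<omega>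
    using *(2)[of x] by (auto simp: indicator_def)
  show thesis
  proof (rule that[of s N j])
    show "ball s R \<subseteq> (L ^^ N) ` supp j" by fact
    fix \<omega>
    show "set_integrable lborel (ball 0 R) (\<lambda>x. e_char (\<omega> \<bullet> x) * f (action x X))"
      unfolding set_integrable_def eq by (rule integrable_mult_indicator[OF _ int]) simp
    define g where "g y = indicator (ball s R) y *\<^sub>R (e_char (\<omega> \<bullet> y) * tile_fun N j y)" for y
    have gm: "g \<in> borel_measurable borel"
    proof -
      have "integrable lborel g"
        unfolding g_def using tile_fun_integrable[of \<omega> N j 0] by (intro integrable_mult_indicator) auto
      thus ?thesis by auto
    qed
    have "(LINT x:ball 0 R|lborel. e_char (\<omega> \<bullet> x) * f (action x X)) =
        (LINT x|lborel. e_char (- (\<omega> \<bullet> s)) * g (x - (- s)))"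
      unfolding set_lebesgue_integral_def eq
    proof (rule Bochner_Integration.integral_cong[OF refl])
      fix x
      have "e_char (- (\<omega> \<bullet> s)) * e_char (\<omega> \<bullet> (x + s)) = e_char (\<omega> \<bullet> x)"
        by (simp add: inner_add_right flip: e_char_add)
      thus "indicator (ball 0 R) x *\<^sub>R (e_char (\<omega> \<bullet> x) * tile_fun N j (x + s)) =
          e_char (- (\<omega> \<bullet> s)) * g (x - (- s))"
        by (auto simp: g_def indicator_def dist_norm norm_minus_commute mult.assoc[symmetric])
    qed
    also have "\<dots> = e_char (- (\<omega> \<bullet> s)) * (LINT y|lborel. g y)"
      using lborel_integral_translation[OF gm, of "- s"] by simp
    finally show "(LINT x:ball 0 R|lborel. e_char (\<omega> \<bullet> x) * f (action x X)) =
        e_char (- (\<omega> \<bullet> s)) * ball_integral \<omega> N j s R"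
      by (simp add: g_def set_lebesgue_integral_def)
  qed
qed

end

section \<open>Riemann sums\<close>

text \<open>The same points and weights serve all Lipschitz functions on the ball at once.\<close>

lemma riemann_sums_ball:
  fixes R h :: real
  assumes R: "R > 0" and h: "h > 0"
  obtains K :: nat and w :: "nat \<Rightarrow> real" and s :: "nat \<Rightarrow> 'a::euclidean_space" where
    "\<And>k. w k \<ge> 0" "\<And>k. s k \<in> ball 0 R" "(\<Sum>k<K. w k) = measure lborel (ball (0 :: 'a) R)"
    "\<And>(G :: 'a \<Rightarrow> complex) Q. set_integrable lborel (ball 0 R) G \<Longrightarrow>
       (\<And>x y. x \<in> ball 0 R \<Longrightarrow> y \<in> ball 0 R \<Longrightarrow> norm (G x - G y) \<le> Q * norm (x - y)) \<Longrightarrow> 0 \<le> Q \<Longrightarrow>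
       norm ((\<Sum>k<K. of_real (w k) * G (s k)) - (LINT x:ball 0 R|lborel. G x)) \<le> Q * h * measure lborel (ball (0 :: 'a) R)"
proof -
  have "compact (cball (0 :: 'a) R)" by simp
  hence "\<forall>e>0. \<exists>S. finite S \<and> cball (0 :: 'a) R \<subseteq> (\<Union>x\<in>S. ball x e)"
    unfolding compact_eq_totally_bounded by (rule conjunct2)
  from this[rule_format, of "h / 2"] obtain S where
    S: "finite S" "cball (0 :: 'a) R \<subseteq> (\<Union>x\<in>S. ball x (h / 2))" using h by auto
  obtain xs where xs: "set xs = S" using S(1) finite_list by blast
  define K where "K = length xs"
  define A where "A k = (if k < K then ball 0 R \<inter> ball (xs ! k) (h / 2) else {})" for k
  define D where "D = disjointed A"
  have Am: "range A \<subseteq> sets lborel" by (auto simp: A_def)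
  have Dm: "D k \<in> sets lborel" for k unfolding D_def using sets.range_disjointed_sets[OF Am] by auto
  have DA: "D k \<subseteq> A k" for k unfolding D_def by (rule disjointed_subset)
  have disj: "disjoint_family D" unfolding D_def by (rule disjoint_family_disjointed)
  have DK: "D k = {}" if "k \<ge> K" for k using DA[of k] that by (auto simp: A_def)
  have UA: "(\<Union>k. A k) = ball 0 R"
  proof
    show "ball 0 R \<subseteq> (\<Union>k. A k)"
    proof
      fix x :: 'a assume x: "x \<in> ball 0 R"
      hence "x \<in> cball 0 R" by simp
      then obtain y where "y \<in> S" "x \<in> ball y (h / 2)" using S(2) by blast
      then obtain k where "k < K" "xs ! k = y" using xs by (auto simp: K_def in_set_conv_nth)
      thus "x \<in> (\<Union>k. A k)" using x \<open>x \<in> ball y (h / 2)\<close> by (intro UN_I[of k]) (auto simp: A_def)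
    qed
  qed (auto simp: A_def split: if_splits)
  have UD: "(\<Union>k<K. D k) = ball 0 R"
  proof -
    have "(\<Union>k. D k) = ball 0 R" using UA by (simp add: D_def UN_disjointed_eq)
    moreover have "k < K" if "x \<in> D k" for x k
      using DK[of k] that by (cases "k < K") auto
    hence "(\<Union>k. D k) = (\<Union>k<K. D k)" by blast
    ultimately show ?thesis by simp
  qed
  define s where "s k = (if D k = {} then 0 else SOME x. x \<in> D k)" for k
  have sD: "s k \<in> D k" if "D k \<noteq> {}" for k using that some_in_eq by (auto simp: s_def)
  have sB: "s k \<in> ball 0 R" for k
    using sD[of k] DA[of k] R by (cases "D k = {}") (auto simp: s_def A_def split: if_splits)
  have near: "norm (s k - x) \<le> h" if "x \<in> D k" for k x
  proof -
    have "x \<in> A k" "s k \<in> A k" using that sD[of k] DA[of k] by auto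
    hence "dist (xs ! k) x < h / 2" "dist (xs ! k) (s k) < h / 2" by (auto simp: A_def split: if_splits)
    hence "dist (s k) x \<le> h" using dist_triangle2[of "s k" x "xs ! k"] by (simp add: dist_commute)
    thus ?thesis by (simp add: dist_norm)
  qed
  define w where "w k = measure lborel (D k)" for k
  have fin: "emeasure lborel (D k) < \<infinity>" for k
  proof -
    have "D k \<subseteq> ball 0 R" using DA[of k] by (auto simp: A_def split: if_splits)
    hence "emeasure lborel (D k) \<le> emeasure lborel (ball (0 :: 'a) R)" by (intro emeasure_mono) auto
    thus ?thesis using emeasure_lborel_ball_finite[of "0 :: 'a" R] by (rule le_less_trans)
  qed
  have disj': "disjoint_family_on D {..<K}" using disj by (auto simp: disjoint_family_on_def)
  have sumw: "(\<Sum>k<K. w k) = measure lborel (ball (0 :: 'a) R)"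
    unfolding w_def UD[symmetric]
    by (rule measure_finite_Union[symmetric]) (use Dm disj' fin in \<open>auto simp: less_top\<close>)
  have approx: "norm ((\<Sum>k<K. of_real (w k) * G (s k)) - (LINT x:ball 0 R|lborel. G x)) \<le> Q * h * measure lborel (ball (0 :: 'a) R)"
    if Gint: "set_integrable lborel (ball 0 R) G" and Q: "0 \<le> Q"
      and Lip: "\<And>x y. x \<in> ball 0 R \<Longrightarrow> y \<in> ball 0 R \<Longrightarrow> norm (G x - G y) \<le> Q * norm (x - y)"
    for G :: "'a \<Rightarrow> complex" and Q
  proof -
    have Gk: "set_integrable lborel (D k) G" for k
      using DA[of k] by (intro set_integrable_subset[OF Gint] Dm) (auto simp: A_def split: if_splits)
    have ind: "indicator (ball 0 R) x = (\<Sum>k<K. indicator (D k) x :: real)" for x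
      unfolding UD[symmetric] using disj' by (simp add: indicator_UN_disjoint)
    have "(LINT x:ball 0 R|lborel. G x) = (LINT x|lborel. (\<Sum>k<K. indicator (D k) x *\<^sub>R G x))"
      unfolding set_lebesgue_integral_def ind by (simp add: scaleR_sum_left)
    also have "\<dots> = (\<Sum>k<K. LINT x:D k|lborel. G x)"
      unfolding set_lebesgue_integral_def
      by (rule Bochner_Integration.integral_sum) (use Gk in \<open>simp add: set_integrable_def\<close>)
    finally have "(\<Sum>k<K. of_real (w k) * G (s k)) - (LINT x:ball 0 R|lborel. G x) =
        (\<Sum>k<K. of_real (w k) * G (s k) - (LINT x:D k|lborel. G x))"
      by (simp add: sum_subtractf)
    also have "norm \<dots> \<le> (\<Sum>k<K. Q * h * w k)"
    proof (rule sum_norm_le)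
      fix k assume "k \<in> {..<K}"
      have ci: "integrable lborel (\<lambda>x. indicator (D k) x *\<^sub>R G (s k))"
        using Dm fin[of k] by (intro integrable_scaleR_left integrable_real_indicator) (auto simp: infinity_ennreal_def)
      have "of_real (w k) * G (s k) = (LINT x|lborel. indicator (D k) x *\<^sub>R G (s k))"
        using Dm fin[of k] by (simp add: w_def scaleR_conv_of_real infinity_ennreal_def)
      hence "of_real (w k) * G (s k) - (LINT x:D k|lborel. G x) =
          (LINT x|lborel. indicator (D k) x *\<^sub>R G (s k) - indicator (D k) x *\<^sub>R G x)"
        unfolding set_lebesgue_integral_def using ci Gk[of k]
        by (simp add: set_integrable_def)
      also have "norm \<dots> \<le> (LINT x|lborel. indicator (D k) x *\<^sub>R (Q * h))"
      proof (rule norm_lebesgue_integral_le)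
        show "integrable lborel (\<lambda>x. indicator (D k) x *\<^sub>R G (s k) - indicator (D k) x *\<^sub>R G x)"
          using ci Gk[of k] by (simp add: set_integrable_def)
        show "integrable lborel (\<lambda>x. indicator (D k) x *\<^sub>R (Q * h))"
          using Dm fin[of k] by (intro integrable_scaleR_left integrable_real_indicator) (auto simp: infinity_ennreal_def)
        fix x
        show "norm (indicator (D k) x *\<^sub>R G (s k) - indicator (D k) x *\<^sub>R G x) \<le> indicator (D k) x *\<^sub>R (Q * h)"
        proof (cases "x \<in> D k")
          case True
          have "x \<in> ball 0 R" using True DA[of k] by (auto simp: A_def split: if_splits)
          hence "norm (G (s k) - G x) \<le> Q * norm (s k - x)" by (intro Lip sB)
          also have "\<dots> \<le> Q * h" using near[OF True] Q by (intro mult_left_mono)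
          finally show ?thesis using True by simp
        qed simp
      qed
      also have "\<dots> = Q * h * w k" by (simp add: w_def mult.commute)
      finally show "norm (of_real (w k) * G (s k) - (LINT x:D k|lborel. G x)) \<le> Q * h * w k" .
    qed
    also have "\<dots> = Q * h * measure lborel (ball (0 :: 'a) R)"
      by (simp add: sumw sum_distrib_left[symmetric])
    finally show ?thesis .
  qed
  show thesis
  proof (rule that[of w s K])
    show "w k \<ge> 0" for k by (simp add: w_def)
  qed (use sB sumw approx in blast)+
qed

section \<open>Spectral measures\<close>

lemma action_action: "action a (action b X) = action (a + b) X"
  by (simp add: action_def image_image shift_shift add.commute)

lemma norm_e_char_diff_le: "norm (e_char a - e_char b) \<le> 2 * pi * \<bar>a - b\<bar>"
proof -
  have "e_char a - e_char b = e_char b * (e_char (a - b) - 1)"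
    by (simp add: right_diff_distrib flip: e_char_add)
  hence "norm (e_char a - e_char b) = norm (exp (\<i> * of_real (2 * pi * (a - b))) - 1)"
    by (simp add: norm_mult e_char_eq_cis cis_conv_exp)
  also have "\<dots> \<le> \<bar>2 * pi * (a - b)\<bar>"
    using abs_sin_x_le_abs_x[of "2 * pi * (a - b) / 2"] unfolding dist_exp_i_1 by simp
  finally show ?thesis by (simp add: abs_mult)
qed

locale spectral_setting =
  fixes \<mu> :: "'d::finite tile set measure" and f :: "'d tile set \<Rightarrow> complex"
    and \<sigma> :: "(real^'d) measure" and M :: real
  assumes prob: "prob_space \<mu>"
    and action_measurable: "\<And>s. action s \<in> measurable \<mu> \<mu>"
    and invariant: "\<And>s. distr \<mu> \<mu> (action s) = \<mu>"
    and f_measurable: "f \<in> borel_measurable \<mu>"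
    and f_bounded: "\<And>X. X \<in> space \<mu> \<Longrightarrow> norm (f X) \<le> M"
    and spectral: "spectral_measure \<mu> f \<sigma>"
begin

lemma f_action_measurable: "(\<lambda>X. f (action s X)) \<in> borel_measurable \<mu>"
  using measurable_comp[OF action_measurable f_measurable] by (simp add: o_def)

lemma f_action_bounded: "X \<in> space \<mu> \<Longrightarrow> norm (f (action s X)) \<le> M"
  using f_bounded measurable_space[OF action_measurable] by blast

lemma M_nonneg': "0 \<le> M"
proof -
  obtain X where "X \<in> space \<mu>" using prob_space.not_empty[OF prob] by blast
  thus ?thesis using f_bounded norm_ge_zero order_trans by blast
qed

lemma integral_action:
  fixes g :: "'d tile set \<Rightarrow> complex"
  assumes "g \<in> borel_measurable \<mu>"
  shows "(LINT X|\<mu>. g (action s X)) = (LINT X|\<mu>. g X)"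
proof -
  have "(LINT X|\<mu>. g X) = (LINT X|distr \<mu> \<mu> (action s). g X)" by (simp add: invariant)
  also have "\<dots> = (LINT X|\<mu>. g (action s X))"
    by (rule integral_distr[OF action_measurable assms])
  finally show ?thesis ..
qed

lemma product_integrable: "integrable \<mu> (\<lambda>X. f (action s X) * cnj (f (action t X)))"
proof (rule finite_measure.integrable_const_bound[where B = "M * M"])
  show "finite_measure \<mu>" using prob by (simp add: prob_space_def)
  show "AE X in \<mu>. norm (f (action s X) * cnj (f (action t X))) \<le> M * M"
    using f_action_bounded M_nonneg' by (intro AE_I2) (auto simp: norm_mult intro!: mult_mono)
  show "(\<lambda>X. f (action s X) * cnj (f (action t X))) \<in> borel_measurable \<mu>"
    using f_action_measurable by (intro borel_measurable_times measurable_comp[OF f_action_measurable, of cnj borel, unfolded o_def])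
      (auto intro: borel_measurable_continuous_onI continuous_intros)
qed

lemma sets_\<sigma>: "sets \<sigma> = sets borel" and finite_\<sigma>: "finite_measure \<sigma>"
  using spectral by (auto simp: spectral_measure_def)

lemma borel_measurable_\<sigma>: "g \<in> borel_measurable borel \<Longrightarrow> g \<in> borel_measurable \<sigma>"
  using measurable_cong_sets[OF sets_\<sigma> refl] by blast

text \<open>Invariance reduces the correlation of two translates to that of \<open>f\<close> with one translate.\<close>

lemma inner_product_action:
  "(LINT X|\<mu>. f (action s X) * cnj (f (action t X))) = (LINT \<eta>|\<sigma>. e_char (- (\<eta> \<bullet> s)) * cnj (e_char (- (\<eta> \<bullet> t))))"
proof -
  define g where "g X = f (action (s - t) X) * cnj (f X)" for X
  have "action 0 X = X" for X :: "'d tile set" by (simp add: action_def image_def)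
  hence "(\<lambda>X. f (action (s - t) X) * cnj (f (action 0 X))) \<in> borel_measurable \<mu>"
    using product_integrable by (intro borel_measurable_integrable)
  hence gm: "g \<in> borel_measurable \<mu>" using \<open>\<And>X :: 'd tile set. action 0 X = X\<close> by (simp add: g_def[abs_def])
  have "(LINT X|\<mu>. f (action s X) * cnj (f (action t X))) = (LINT X|\<mu>. g (action t X))"
    by (simp add: g_def action_action)
  also have "\<dots> = (LINT X|\<mu>. g X)" by (rule integral_action[OF gm])
  also have "\<dots> = (LINT \<eta>|\<sigma>. e_char (- (\<eta> \<bullet> (s - t))))"
    using spectral by (simp add: spectral_measure_def g_def)
  also have "\<dots> = (LINT \<eta>|\<sigma>. e_char (- (\<eta> \<bullet> s)) * cnj (e_char (- (\<eta> \<bullet> t))))"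
    by (intro Bochner_Integration.integral_cong refl)
      (simp add: inner_diff_right e_char_minus[symmetric] flip: e_char_add)
  finally show ?thesis .
qed

lemma spectral_isometry:
  fixes K :: nat
  shows "(LINT \<eta>|\<sigma>. (norm (\<Sum>k<K. a k * e_char (- (\<eta> \<bullet> s k))))\<^sup>2) =
     (LINT X|\<mu>. (norm (\<Sum>k<K. a k * f (action (s k) X)))\<^sup>2)"
proof -
  have sq: "complex_of_real ((norm (\<Sum>k<K. z k))\<^sup>2) = (\<Sum>k<K. \<Sum>l<K. z k * cnj (z l))" for z :: "nat \<Rightarrow> complex"
    by (simp add: complex_norm_square sum_product cnj_sum del: of_real_power)
  have ei: "integrable \<sigma> (\<lambda>\<eta>. e_char (- (\<eta> \<bullet> s)) * cnj (e_char (- (\<eta> \<bullet> t))))" for s t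
  proof (rule finite_measure.integrable_const_bound[OF finite_\<sigma>, where B = 1])
    have "continuous_on UNIV (\<lambda>\<eta> :: real^'d. e_char (- (\<eta> \<bullet> s)) * cnj (e_char (- (\<eta> \<bullet> t))))"
      unfolding e_char_def by (intro continuous_intros)
    thus "(\<lambda>\<eta>. e_char (- (\<eta> \<bullet> s)) * cnj (e_char (- (\<eta> \<bullet> t)))) \<in> borel_measurable \<sigma>"
      by (intro borel_measurable_\<sigma> borel_measurable_continuous_onI)
  qed (simp add: norm_mult)
  have "complex_of_real (LINT \<eta>|\<sigma>. (norm (\<Sum>k<K. a k * e_char (- (\<eta> \<bullet> s k))))\<^sup>2) =
     (LINT \<eta>|\<sigma>. (\<Sum>k<K. \<Sum>l<K. (a k * cnj (a l)) * (e_char (- (\<eta> \<bullet> s k)) * cnj (e_char (- (\<eta> \<bullet> s l))))))"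
    unfolding integral_complex_of_real[symmetric] sq by (simp add: mult_ac)
  also have "\<dots> = (\<Sum>k<K. \<Sum>l<K. (a k * cnj (a l)) * (LINT \<eta>|\<sigma>. e_char (- (\<eta> \<bullet> s k)) * cnj (e_char (- (\<eta> \<bullet> s l)))))"
    by (simp add: Bochner_Integration.integral_sum Bochner_Integration.integrable_sum ei)
  also have "\<dots> = (\<Sum>k<K. \<Sum>l<K. (a k * cnj (a l)) * (LINT X|\<mu>. f (action (s k) X) * cnj (f (action (s l) X))))"
    by (simp add: inner_product_action)
  also have "\<dots> = (LINT X|\<mu>. (\<Sum>k<K. \<Sum>l<K. (a k * cnj (a l)) * (f (action (s k) X) * cnj (f (action (s l) X)))))"
    by (simp add: Bochner_Integration.integral_sum Bochner_Integration.integrable_sum product_integrable)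
  also have "\<dots> = complex_of_real (LINT X|\<mu>. (norm (\<Sum>k<K. a k * f (action (s k) X)))\<^sup>2)"
    unfolding integral_complex_of_real[symmetric] sq by (simp add: mult_ac)
  finally show ?thesis by (simp only: of_real_eq_iff)
qed

text \<open>Chebyshev's inequality for the square of the trigonometric polynomial, whose integral is an \<open>L\<^sup>2\<close> norm over the hull.\<close>

lemma spectral_measure_le:
  fixes K :: nat
  assumes E: "E \<in> sets borel" and b: "b > 0"
    and lower: "\<And>\<eta>. \<eta> \<in> E \<Longrightarrow> b \<le> norm (\<Sum>k<K. a k * e_char (- (\<eta> \<bullet> s k)))"
    and upper: "\<And>X. X \<in> space \<mu> \<Longrightarrow> norm (\<Sum>k<K. a k * f (action (s k) X)) \<le> B"
  shows "measure \<sigma> E \<le> (B / b)\<^sup>2"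
proof -
  define A where "A = (\<Sum>k<K. norm (a k))"
  have "b\<^sup>2 * measure \<sigma> E = (LINT \<eta>|\<sigma>. indicator E \<eta> *\<^sub>R b\<^sup>2)"
    using E sets_\<sigma> finite_measure.emeasure_finite[OF finite_\<sigma>] by (simp add: less_top[symmetric])
  also have "\<dots> \<le> (LINT \<eta>|\<sigma>. (norm (\<Sum>k<K. a k * e_char (- (\<eta> \<bullet> s k))))\<^sup>2)"
  proof (rule integral_mono)
    show "integrable \<sigma> (\<lambda>\<eta>. indicator E \<eta> *\<^sub>R b\<^sup>2)"
      using E sets_\<sigma> finite_measure.emeasure_finite[OF finite_\<sigma>, of E]
      by (intro integrable_scaleR_left integrable_real_indicator) (auto simp: less_top)
    show "integrable \<sigma> (\<lambda>\<eta>. (norm (\<Sum>k<K. a k * e_char (- (\<eta> \<bullet> s k))))\<^sup>2)"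
    proof (rule finite_measure.integrable_const_bound[OF finite_\<sigma>, where B = "A\<^sup>2"])
      have "continuous_on UNIV (\<lambda>\<eta> :: real^'d. (norm (\<Sum>k<K. a k * e_char (- (\<eta> \<bullet> s k))))\<^sup>2)"
        unfolding e_char_def by (intro continuous_intros)
      thus "(\<lambda>\<eta>. (norm (\<Sum>k<K. a k * e_char (- (\<eta> \<bullet> s k))))\<^sup>2) \<in> borel_measurable \<sigma>"
        by (intro borel_measurable_\<sigma> borel_measurable_continuous_onI)
      have "norm (\<Sum>k<K. a k * e_char (- (\<eta> \<bullet> s k))) \<le> A" for \<eta>
        unfolding A_def by (rule sum_norm_le) (simp add: norm_mult)
      thus "AE \<eta> in \<sigma>. norm ((norm (\<Sum>k<K. a k * e_char (- (\<eta> \<bullet> s k))))\<^sup>2) \<le> A\<^sup>2"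
        by (intro AE_I2) (simp add: power_mono)
    qed
    fix \<eta>
    show "indicator E \<eta> *\<^sub>R b\<^sup>2 \<le> (norm (\<Sum>k<K. a k * e_char (- (\<eta> \<bullet> s k))))\<^sup>2"
      using lower[of \<eta>] b by (auto simp: indicator_def intro!: power_mono)
  qed
  also have "\<dots> = (LINT X|\<mu>. (norm (\<Sum>k<K. a k * f (action (s k) X)))\<^sup>2)" by (rule spectral_isometry)
  also have "\<dots> \<le> B\<^sup>2"
  proof (rule prob_space.integral_le_const[OF prob])
    have "(\<lambda>X. (norm (\<Sum>k<K. a k * f (action (s k) X)))\<^sup>2) \<in> borel_measurable \<mu>"
      using f_action_measurable by measurable
    moreover have "AE X in \<mu>. norm ((norm (\<Sum>k<K. a k * f (action (s k) X)))\<^sup>2) \<le> B\<^sup>2"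
      using upper by (intro AE_I2) (simp add: power_mono)
    ultimately show "integrable \<mu> (\<lambda>X. (norm (\<Sum>k<K. a k * f (action (s k) X)))\<^sup>2)"
      using prob by (intro finite_measure.integrable_const_bound[where B = "B\<^sup>2"]) (auto simp: prob_space_def)
    show "AE X in \<mu>. (norm (\<Sum>k<K. a k * f (action (s k) X)))\<^sup>2 \<le> B\<^sup>2"
      using upper by (intro AE_I2) (simp add: power_mono)
  qed
  finally show ?thesis using b by (simp add: power_divide field_simps)
qed

text \<open>On a cube of side \<open>2 r\<close> about \<open>\<omega>\<close> the phases of the twisted sum over a ball of radius at most
  \<open>1 / (8 d r)\<close> hardly vary.\<close>

lemma spectral_measure_cube_le:
  fixes K :: nat and r R :: real
  assumes r: "0 \<le> r" and R: "CARD('d) * r * R \<le> 1 / 8"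
    and w: "\<And>k. w k \<ge> 0" "(\<Sum>k<K. w k) = W" "W > 0" and s: "\<And>k. norm (s k) \<le> R"
    and upper: "\<And>X. X \<in> space \<mu> \<Longrightarrow>
      norm (\<Sum>k<K. of_real (w k) * (e_char (\<omega> \<bullet> s k) * f (action (s k) X))) \<le> B * W"
  shows "measure \<sigma> (cube \<omega> r) \<le> 4 * B\<^sup>2"
proof -
  have "measure \<sigma> (cube \<omega> r) \<le> ((B * W) / (W / 2))\<^sup>2"
  proof (rule spectral_measure_le[where a = "\<lambda>k. of_real (w k) * e_char (\<omega> \<bullet> s k)" and s = s and K = K])
    show "cube \<omega> r \<in> sets borel" by (simp add: cube_def)
    show "norm (\<Sum>k<K. of_real (w k) * e_char (\<omega> \<bullet> s k) * f (action (s k) X)) \<le> B * W" if "X \<in> space \<mu>" for X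
      using upper[OF that] by (simp add: mult.assoc)
    fix \<eta> assume \<eta>: "\<eta> \<in> cube \<omega> r"
    have comp: "\<bar>(\<omega> - \<eta>) $ i\<bar> \<le> r" for i
    proof -
      have "\<omega> $ i - r \<le> \<eta> $ i \<and> \<eta> $ i \<le> \<omega> $ i + r"
        using \<eta> by (simp add: cube_def mem_box_cart)
      thus ?thesis by (simp add: abs_le_iff)
    qed
    have "norm (\<omega> - \<eta>) \<le> (\<Sum>i\<in>UNIV. \<bar>(\<omega> - \<eta>) $ i\<bar>)" by (rule norm_le_l1_cart)
    also have "\<dots> \<le> (\<Sum>i\<in>(UNIV :: 'd set). r)" using comp by (intro sum_mono)
    finally have no: "norm (\<omega> - \<eta>) \<le> CARD('d) * r" by simp
    have "1 / 2 \<le> cos (2 * pi * ((\<omega> - \<eta>) \<bullet> s k))" for k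
    proof -
      have "\<bar>(\<omega> - \<eta>) \<bullet> s k\<bar> \<le> norm (\<omega> - \<eta>) * norm (s k)" by (rule Cauchy_Schwarz_ineq2)
      also have "\<dots> \<le> (CARD('d) * r) * R" using no s[of k] r by (intro mult_mono) auto
      finally have "\<bar>(\<omega> - \<eta>) \<bullet> s k\<bar> \<le> 1 / 8" using R by simp
      hence "2 * pi * \<bar>(\<omega> - \<eta>) \<bullet> s k\<bar> \<le> 2 * pi * (1 / 6)" by (intro mult_left_mono) auto
      hence "cos (pi / 3) \<le> cos (2 * pi * \<bar>(\<omega> - \<eta>) \<bullet> s k\<bar>)"
        by (intro cos_monotone_0_pi_le) auto
      also have "\<dots> = cos (2 * pi * ((\<omega> - \<eta>) \<bullet> s k))" by (cases "(\<omega> - \<eta>) \<bullet> s k \<ge> 0") auto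
      finally show ?thesis by (simp add: cos_60)
    qed
    hence "(\<Sum>k<K. w k * (1 / 2)) \<le> (\<Sum>k<K. w k * cos (2 * pi * ((\<omega> - \<eta>) \<bullet> s k)))"
      using w(1) by (intro sum_mono mult_left_mono)
    also have "\<dots> = Re (\<Sum>k<K. of_real (w k) * e_char ((\<omega> - \<eta>) \<bullet> s k))"
      by (simp add: e_char_eq_cis)
    also have "\<dots> = Re (\<Sum>k<K. of_real (w k) * e_char (\<omega> \<bullet> s k) * e_char (- (\<eta> \<bullet> s k)))"
      by (simp add: inner_diff_left mult.assoc flip: e_char_add)
    also have "\<dots> \<le> norm (\<Sum>k<K. of_real (w k) * e_char (\<omega> \<bullet> s k) * e_char (- (\<eta> \<bullet> s k)))"
      by (rule complex_Re_le_cmod)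
    finally show "W / 2 \<le> norm (\<Sum>k<K. of_real (w k) * e_char (\<omega> \<bullet> s k) * e_char (- (\<eta> \<bullet> s k)))"
      using w(2) by (simp add: sum_distrib_right[symmetric] flip: sum_divide_distrib)
  qed (use w(3) in simp)
  also have "\<dots> = 4 * B\<^sup>2" using w(3) by (simp add: power2_eq_square)
  finally show ?thesis .
qed

text \<open>At large frequencies the decay comes from the Lipschitz continuity of \<open>f\<close> along orbits.\<close>

lemma spectral_measure_cube_large_frequency:
  assumes Lip: "\<And>X s. X \<in> space \<mu> \<Longrightarrow> norm (f X - f (action s X)) \<le> Q * norm s" and Q: "Q \<ge> 0"
    and r: "0 \<le> r" "r \<le> 1 / 4" and i: "1 \<le> \<bar>\<omega> $ i\<bar>"
  shows "measure \<sigma> (cube \<omega> r) \<le> (Q / (2 * \<bar>\<omega> $ i\<bar>))\<^sup>2"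
proof -
  (* translation by z multiplies the frequency \<omega> by e(1/2) = -1 *)
  define z where "z = (1 / (2 * \<omega> $ i)) *\<^sub>R axis i (1 :: real)"
  have \<omega>0: "\<omega> $ i \<noteq> 0" using i by auto
  have nz: "norm z = 1 / (2 * \<bar>\<omega> $ i\<bar>)" by (simp add: z_def abs_mult norm_axis_1)
  define a :: "nat \<Rightarrow> complex" where "a k = (if k = 0 then 1 else - 1)" for k
  define s where "s k = (if k = 0 then 0 else z)" for k :: nat
  have two: "(\<Sum>k<2. g k) = g 0 + g 1" for g :: "nat \<Rightarrow> complex" by (simp add: numeral_2_eq_2)
  have "measure \<sigma> (cube \<omega> r) \<le> ((Q * norm z) / 1)\<^sup>2"
  proof (rule spectral_measure_le[where a = a and s = s and K = 2])
    show "cube \<omega> r \<in> sets borel" by (simp add: cube_def)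
    have "action 0 X = X" for X :: "'d tile set" by (simp add: action_def image_def)
    thus "norm (\<Sum>k<2. a k * f (action (s k) X)) \<le> Q * norm z" if "X \<in> space \<mu>" for X
      using Lip[OF that, of z] by (simp add: two a_def s_def)
    fix \<eta> assume \<eta>: "\<eta> \<in> cube \<omega> r"
    define t where "t = \<eta> \<bullet> z"
    have "\<omega> $ i - r \<le> \<eta> $ i" "\<eta> $ i \<le> \<omega> $ i + r"
      using \<eta> by (simp_all add: cube_def mem_box_cart)
    hence "\<bar>\<eta> $ i - \<omega> $ i\<bar> \<le> 1 / 4 * \<bar>\<omega> $ i\<bar>" using r i by linarith
    moreover have "t - 1 / 2 = (\<eta> $ i - \<omega> $ i) / (2 * \<omega> $ i)"
      using \<omega>0 by (simp add: t_def z_def inner_axis field_simps)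
    ultimately have "\<bar>t - 1 / 2\<bar> \<le> (1 / 4 * \<bar>\<omega> $ i\<bar>) / (2 * \<bar>\<omega> $ i\<bar>)"
      by (simp only: abs_divide abs_mult abs_numeral) (intro divide_right_mono, auto)
    hence t: "\<bar>t - 1 / 2\<bar> \<le> 1 / 8" using \<omega>0 by simp
    have "cos (2 * pi * t) \<le> 0"
    proof -
      have "cos (2 * pi * t) = - cos (2 * pi * (t - 1 / 2))"
        by (simp add: right_diff_distrib cos_diff)
      moreover have "0 \<le> cos (2 * pi * (t - 1 / 2))"
      proof (rule cos_ge_zero)
        have t': "t - 1 / 2 \<le> 1 / 4" "- (1 / 4) \<le> t - 1 / 2" using t by linarith+
        have u: "2 * pi * (t - 1 / 2) \<le> 2 * pi * (1 / 4)" by (rule mult_left_mono[OF t'(1)]) simp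
        have l: "2 * pi * (- (1 / 4)) \<le> 2 * pi * (t - 1 / 2)" by (rule mult_left_mono[OF t'(2)]) simp
        show "2 * pi * (t - 1 / 2) \<le> pi / 2" by (rule order_trans[OF u]) simp
        show "- (pi / 2) \<le> 2 * pi * (t - 1 / 2)" by (rule order_trans[OF _ l]) simp
      qed
      ultimately show ?thesis by simp
    qed
    hence "1 \<le> Re (1 - e_char (- t))" by (simp add: e_char_eq_cis)
    also have "\<dots> \<le> norm (1 - e_char (- t))" by (rule complex_Re_le_cmod)
    finally show "1 \<le> norm (\<Sum>k<2. a k * e_char (- (\<eta> \<bullet> s k)))" by (simp add: two a_def s_def t_def)
  qed simp
  thus ?thesis using nz by simp
qed

end

section \<open>Spectral estimates for cylindrical functions of mean zero\<close>

locale spectral_profile =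
  cylindrical_profile T \<zeta> L c \<psi> M f M + spectral_setting \<mu> f \<sigma> M
  for T :: "'m::finite \<Rightarrow> 'd::finite tile" and \<zeta> L c \<psi> M f \<mu> \<sigma> +
  assumes space_\<mu>: "space \<mu> = tiling_space T \<zeta> L"
    and mean_zero: "(LINT X|\<mu>. f X) = 0"
begin

lemma twisted_orbit_Lipschitz:
  assumes "X \<in> tiling_space T \<zeta> L"
  shows "norm (e_char (\<omega> \<bullet> x) * f (action x X) - e_char (\<omega> \<bullet> y) * f (action y X)) \<le>
    (2 * pi * norm \<omega> * M + 2 * M) * norm (x - y)"
proof -
  have "e_char (\<omega> \<bullet> x) * f (action x X) - e_char (\<omega> \<bullet> y) * f (action y X) =
      (e_char (\<omega> \<bullet> x) - e_char (\<omega> \<bullet> y)) * f (action x X) + e_char (\<omega> \<bullet> y) * (f (action x X) - f (action y X))"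
    by (simp add: algebra_simps)
  also have "norm \<dots> \<le> norm (e_char (\<omega> \<bullet> x) - e_char (\<omega> \<bullet> y)) * norm (f (action x X)) + norm (f (action x X) - f (action y X))"
    by (rule order_trans[OF norm_triangle_ineq]) (simp add: norm_mult)
  also have "\<dots> \<le> (2 * pi * (norm \<omega> * norm (x - y))) * M + 2 * M * norm (x - y)"
  proof (intro add_mono mult_mono f_orbit_Lipschitz assms norm_f_le action_space)
    have "norm (e_char (\<omega> \<bullet> x) - e_char (\<omega> \<bullet> y)) \<le> 2 * pi * \<bar>\<omega> \<bullet> x - \<omega> \<bullet> y\<bar>" by (rule norm_e_char_diff_le)
    also have "\<dots> \<le> 2 * pi * (norm \<omega> * norm (x - y))"
      using Cauchy_Schwarz_ineq2[of \<omega> "x - y"] by (intro mult_left_mono) (simp_all add: inner_diff_right)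
    finally show "norm (e_char (\<omega> \<bullet> x) - e_char (\<omega> \<bullet> y)) \<le> 2 * pi * (norm \<omega> * norm (x - y))" .
  qed auto
  finally show ?thesis by (simp add: algebra_simps)
qed

lemma set_integrable_orbit:
  assumes "X \<in> tiling_space T \<zeta> L"
  shows "set_integrable lborel (ball 0 R) (\<lambda>x. e_char (\<omega> \<bullet> x) * f (action x X))"
  using orbit_integral[OF assms] by metis

text \<open>The Riemann sums have an error as small as desired compared with \<open>B\<close>, for all tilings at once; the case
  \<open>B = 0\<close> follows by letting the bound tend to 0.\<close>

lemma spectral_measure_cube_from_balls:
  fixes r R B :: real
  assumes r: "0 < r" and R: "R = 1 / (8 * real CARD('d) * r)" and B: "0 \<le> B"
    and bound: "\<And>X. X \<in> tiling_space T \<zeta> L \<Longrightarrow>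
      norm (LINT x:ball 0 R|lborel. e_char (\<omega> \<bullet> x) * f (action x X)) \<le> B * measure lborel (ball (0 :: real^'d) R)"
  shows "measure \<sigma> (cube \<omega> r) \<le> 16 * B\<^sup>2"
proof -
  have R0: "R > 0" using r by (simp add: R)
  have V0: "measure lborel (ball (0 :: real^'d) R) > 0" using R0 by (rule content_ball_pos)
  have main: "measure \<sigma> (cube \<omega> r) \<le> 16 * B'\<^sup>2" if B': "B' > 0" "B \<le> B'" for B'
  proof -
    define Q where "Q = 2 * pi * norm \<omega> * M + 2 * M"
    have Q: "Q \<ge> 0" using M_nonneg by (simp add: Q_def)
    (* the mesh may depend on \<omega>, which enters the Lipschitz constant Q of the twisted orbit *)
    define h where "h = B' / (Q + 1)"
    have h: "h > 0" using B' Q by (simp add: h_def)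
    obtain K :: nat and w s where rs: "\<And>k. w k \<ge> 0" "\<And>k. s k \<in> ball (0 :: real^'d) R" "(\<Sum>k<K. w k) = measure lborel (ball (0 :: real^'d) R)"
      "\<And>(G :: real^'d \<Rightarrow> complex) Q. set_integrable lborel (ball 0 R) G \<Longrightarrow>
       (\<And>x y. x \<in> ball 0 R \<Longrightarrow> y \<in> ball 0 R \<Longrightarrow> norm (G x - G y) \<le> Q * norm (x - y)) \<Longrightarrow> 0 \<le> Q \<Longrightarrow>
       norm ((\<Sum>k<K. of_real (w k) * G (s k)) - (LINT x:ball 0 R|lborel. G x)) \<le> Q * h * measure lborel (ball (0 :: real^'d) R)"
    proof (rule riemann_sums_ball[OF R0 h, where 'a = "real^'d"], goal_cases)
      case prems: (1 w s K)
      show ?case by (rule prems(1)[OF prems(2-5)])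
    qed
    have "measure \<sigma> (cube \<omega> r) \<le> 4 * (2 * B')\<^sup>2"
    proof (rule spectral_measure_cube_le[OF _ _ rs(1) rs(3) V0])
      show "0 \<le> r" using r by simp
      show "CARD('d) * r * R \<le> 1 / 8" using r by (simp add: R)
      show "norm (s k) \<le> R" for k using rs(2)[of k] by simp
      fix X assume "X \<in> space \<mu>"
      hence X: "X \<in> tiling_space T \<zeta> L" by (simp add: space_\<mu>)
      have "norm ((\<Sum>k<K. of_real (w k) * (e_char (\<omega> \<bullet> s k) * f (action (s k) X))) -
          (LINT x:ball 0 R|lborel. e_char (\<omega> \<bullet> x) * f (action x X))) \<le> Q * h * measure lborel (ball (0 :: real^'d) R)"
        by (rule rs(4)[OF set_integrable_orbit[OF X] _ Q]) (use twisted_orbit_Lipschitz[OF X] in \<open>simp add: Q_def\<close>)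
      also have "\<dots> \<le> B' * measure lborel (ball (0 :: real^'d) R)"
        using Q B' V0 by (intro mult_right_mono) (auto simp: h_def field_simps)
      finally have 1: "norm ((\<Sum>k<K. of_real (w k) * (e_char (\<omega> \<bullet> s k) * f (action (s k) X))) -
          (LINT x:ball 0 R|lborel. e_char (\<omega> \<bullet> x) * f (action x X))) \<le> B' * measure lborel (ball (0 :: real^'d) R)" .
      have "B * measure lborel (ball (0 :: real^'d) R) \<le> B' * measure lborel (ball (0 :: real^'d) R)" using B'(2) V0 by (intro mult_right_mono) auto
      with bound[OF X] have 2: "norm (LINT x:ball 0 R|lborel. e_char (\<omega> \<bullet> x) * f (action x X)) \<le> B' * measure lborel (ball (0 :: real^'d) R)"
        by linarith
      show "norm (\<Sum>k<K. of_real (w k) * (e_char (\<omega> \<bullet> s k) * f (action (s k) X))) \<le> 2 * B' * measure lborel (ball (0 :: real^'d) R)"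
        using norm_triangle_sub[of "\<Sum>k<K. of_real (w k) * (e_char (\<omega> \<bullet> s k) * f (action (s k) X))"
           "LINT x:ball 0 R|lborel. e_char (\<omega> \<bullet> x) * f (action x X)"] 1 2 by linarith
    qed
    thus ?thesis by (simp add: power_mult_distrib)
  qed
  show ?thesis
  proof (cases "B > 0")
    case True
    thus ?thesis using main by simp
  next
    case False
    have "measure \<sigma> (cube \<omega> r) \<le> 0"
    proof (rule ccontr)
      define m where "m = measure \<sigma> (cube \<omega> r)"
      assume "\<not> measure \<sigma> (cube \<omega> r) \<le> 0"
      hence m: "m > 0" by (simp add: m_def)
      have B0: "B = 0" using False B by simp
      have "m \<le> 16 * (sqrt (m / 32))\<^sup>2" unfolding m_def by (rule main) (use m B0 in \<open>simp_all add: m_def\<close>)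
      also have "\<dots> = m / 2" using m by simp
      finally show False using m by simp
    qed
    thus ?thesis by (rule order_trans) simp
  qed
qed

text \<open>Since \<open>f\<close> and its translates have mean zero, a weighted sum of translates cannot have positive
  real part on the whole hull.\<close>

lemma exists_nonpositive_ball_integral:
  assumes R: "R > 0" and \<epsilon>: "\<epsilon> > 0" and \<beta>: "norm \<beta> = 1"
  shows "\<exists>X\<in>tiling_space T \<zeta> L. Re (\<beta> * (LINT x:ball 0 R|lborel. f (action x X))) \<le> \<epsilon> * measure lborel (ball (0 :: real^'d) R)"
proof -
  define Q where "Q = 2 * M"
  have Q: "Q \<ge> 0" using M_nonneg by (simp add: Q_def)
  define h where "h = \<epsilon> / (Q + 1)"
  have h: "h > 0" using \<epsilon> Q by (simp add: h_def)
  obtain K :: nat and w s where rs: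
    "\<And>(G :: real^'d \<Rightarrow> complex) Q. set_integrable lborel (ball 0 R) G \<Longrightarrow>
     (\<And>x y. x \<in> ball 0 R \<Longrightarrow> y \<in> ball 0 R \<Longrightarrow> norm (G x - G y) \<le> Q * norm (x - y)) \<Longrightarrow> 0 \<le> Q \<Longrightarrow>
     norm ((\<Sum>k<K. of_real (w k) * G (s k)) - (LINT x:ball 0 R|lborel. G x)) \<le> Q * h * measure lborel (ball (0 :: real^'d) R)"
  proof (rule riemann_sums_ball[OF R h, where 'a = "real^'d"], goal_cases)
    case prems: (1 w s K)
    show ?case by (rule prems(1)[OF prems(5)])
  qed
  define F where "F X = (\<Sum>k<K. of_real (w k) * f (action (s k) X))" for X
  have fi: "integrable \<mu> (\<lambda>X. f (action s X))" for s
    using prob f_action_bounded f_action_measurable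
    by (intro finite_measure.integrable_const_bound[where B = M]) (auto simp: prob_space_def)
  have Fi: "integrable \<mu> F" unfolding F_def by (intro Bochner_Integration.integrable_sum integrable_mult_right fi)
  have "(LINT X|\<mu>. F X) = (\<Sum>k<K. of_real (w k) * (LINT X|\<mu>. f (action (s k) X)))"
    unfolding F_def by (subst Bochner_Integration.integral_sum) (auto intro: fi)
  also have "\<dots> = 0" by (simp add: integral_action[OF f_measurable] mean_zero)
  finally have F0: "(LINT X|\<mu>. F X) = 0" .
  have "\<exists>X\<in>space \<mu>. Re (\<beta> * F X) \<le> 0"
  proof (rule ccontr)
    assume "\<not> ?thesis"
    hence pos: "\<And>X. X \<in> space \<mu> \<Longrightarrow> 0 < Re (\<beta> * F X)" by (auto simp: not_le)
    have bi: "integrable \<mu> (\<lambda>X. \<beta> * F X)" using Fi by (rule integrable_mult_right)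
    have "(LINT X|\<mu>. 0) < (LINT X|\<mu>. Re (\<beta> * F X))"
    proof (rule finite_measure.integral_less_AE_space)
      show "finite_measure \<mu>" using prob by (simp add: prob_space_def)
      show "integrable \<mu> (\<lambda>X. Re (\<beta> * F X))" using bi by (rule integrable_Re)
      show "emeasure \<mu> (space \<mu>) \<noteq> 0" using prob_space.emeasure_space_1[OF prob] by simp
      show "AE X in \<mu>. 0 < Re (\<beta> * F X)" using pos by (intro AE_I2)
    qed simp
    also have "(LINT X|\<mu>. Re (\<beta> * F X)) = Re (LINT X|\<mu>. \<beta> * F X)" by (rule integral_Re[OF bi])
    also have "\<dots> = 0" using Fi F0 by simp
    finally show False by simp
  qed
  then obtain X where X: "X \<in> tiling_space T \<zeta> L" "Re (\<beta> * F X) \<le> 0" by (auto simp: space_\<mu>)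
  have "norm (F X - (LINT x:ball 0 R|lborel. f (action x X))) \<le> Q * h * measure lborel (ball (0 :: real^'d) R)"
    unfolding F_def
  proof (rule rs[OF _ _ Q])
    show "set_integrable lborel (ball 0 R) (\<lambda>x. f (action x X))"
      using set_integrable_orbit[OF X(1), of R 0] by simp
    show "norm (f (action x X) - f (action y X)) \<le> Q * norm (x - y)" for x y
      using f_orbit_Lipschitz[OF X(1)] by (simp add: Q_def)
  qed
  also have "\<dots> \<le> \<epsilon> * measure lborel (ball (0 :: real^'d) R)"
    using Q \<epsilon> by (intro mult_right_mono) (auto simp: h_def field_simps)
  finally have "norm (\<beta> * (LINT x:ball 0 R|lborel. f (action x X)) - \<beta> * F X) \<le> \<epsilon> * measure lborel (ball (0 :: real^'d) R)"
    using \<beta> by (simp add: norm_mult norm_minus_commute flip: right_diff_distrib)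
  hence "Re (\<beta> * (LINT x:ball 0 R|lborel. f (action x X))) - Re (\<beta> * F X) \<le> \<epsilon> * measure lborel (ball (0 :: real^'d) R)"
    using complex_Re_le_cmod[of "\<beta> * (LINT x:ball 0 R|lborel. f (action x X)) - \<beta> * F X"] by simp
  thus ?thesis using X by (intro bexI[of _ X]) auto
qed

lemma ball_volume_translate: "measure lborel (ball (s :: real^'d) R) = measure lborel (ball (0 :: real^'d) R)"
  by (cases "R \<ge> 0") (simp_all add: content_ball ball_empty)

lemma orbit_ball_bound:
  assumes X: "X \<in> tiling_space T \<zeta> L" and R: "2 * (c ^ n * radius) \<le> R"
    and B: "twisted_bound \<omega> (\<psi>hat \<omega>) n B" "B \<ge> 0"
  shows "norm (LINT x:ball 0 R|lborel. e_char (\<omega> \<bullet> x) * f (action x X)) \<le>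
     (annulus_error n R + B / packing_volume) * measure lborel (ball (0 :: real^'d) R)"
proof (rule orbit_integral[OF X, of R], goal_cases)
  case (1 N j s)
  show ?case
    using ball_integral_bound[OF 1(1) R B] unfolding 1(2)[of \<omega>] ball_volume_translate[of s R] by (simp add: norm_mult)
qed

text \<open>The integral over a ball is, up to boundary terms, a number \<open>S\<close> of tiles times an average between \<open>lo\<close> and
  \<open>hi\<close>. As it is not positive for some tiling, \<open>lo\<close> is at most of the order of the boundary terms, and \<open>hi\<close>
  exceeds \<open>lo\<close> by at most \<open>D\<close>. Rotating by all \<open>\<beta>\<close> bounds the modulus.\<close>

lemma orbit_zero_frequency_bound:
  assumes R: "4 * (c ^ n * radius) \<le> R" and E: "E = annulus_error n R"
    and lohi: "\<And>\<beta>. norm \<beta> = 1 \<Longrightarrow> \<exists>lo hi. hi - lo \<le> D \<and>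
      (\<forall>i. lo * csize n i \<le> Re (\<beta> * twisted_sum 0 (\<psi>hat 0) n i) \<and> Re (\<beta> * twisted_sum 0 (\<psi>hat 0) n i) \<le> hi * csize n i)"
    and D: "D \<ge> 0" and X: "X \<in> tiling_space T \<zeta> L"
  shows "norm (LINT x:ball 0 R|lborel. f (action x X)) \<le>
    ((D + E * (2 ^ CARD('d) * covering_volume)) / packing_volume + E) * measure lborel (ball (0 :: real^'d) R)"
proof -
  have cr: "c ^ n * radius > 0" using c radius_pos by simp
  have R0: "R > 0" using R cr by linarith
  have V0: "measure lborel (ball (0 :: real^'d) R) > 0" using R0 by (rule content_ball_pos)
  have E0: "E \<ge> 0" using M_nonneg cr R0 by (simp add: E annulus_error_def)
  define q where "q = 2 ^ CARD('d) * covering_volume"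
  have q: "q > 0" using covering_volume_pos by (simp add: q_def)
  have main: "Re (\<beta> * (LINT x:ball 0 R|lborel. f (action x X))) \<le> ((D + E * q) / packing_volume + E) * measure lborel (ball (0 :: real^'d) R)"
    if \<beta>: "norm \<beta> = 1" for \<beta>
  proof -
    obtain lo hi where lh: "hi - lo \<le> D" "\<And>i. lo * csize n i \<le> Re (\<beta> * twisted_sum 0 (\<psi>hat 0) n i)"
      "\<And>i. Re (\<beta> * twisted_sum 0 (\<psi>hat 0) n i) \<le> hi * csize n i" using lohi[OF \<beta>] by blast
    have orbit: "\<exists>S. measure lborel (ball (0 :: real^'d) R) / q \<le> S \<and> S \<le> measure lborel (ball (0 :: real^'d) R) / packing_volume \<and>
        lo * S - E * measure lborel (ball (0 :: real^'d) R) \<le> Re (\<beta> * (LINT x:ball 0 R|lborel. f (action x X))) \<and>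
        Re (\<beta> * (LINT x:ball 0 R|lborel. f (action x X))) \<le> hi * S + E * measure lborel (ball (0 :: real^'d) R)"
      if X: "X \<in> tiling_space T \<zeta> L" for X
    proof (rule orbit_integral[OF X, of R], goal_cases)
      case (1 N j s)
      have J: "(LINT x:ball 0 R|lborel. f (action x X)) = ball_integral 0 N j s R"
        using 1(2)[of 0] by simp
      show ?case
        by (rule ball_integral_zero_frequency[OF 1(1) R lh(2,3) \<beta>])
          (unfold J ball_volume_translate[of s R] E q_def, blast)
    qed
    have "lo \<le> E * q"
    proof (rule field_le_epsilon)
      fix e :: real assume e: "e > 0"
      obtain Y where Y: "Y \<in> tiling_space T \<zeta> L"
        "Re (\<beta> * (LINT x:ball 0 R|lborel. f (action x Y))) \<le> (e / q) * measure lborel (ball (0 :: real^'d) R)"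
        using exists_nonpositive_ball_integral[OF R0 _ \<beta>, of "e / q"] e q by auto
      obtain S where S: "measure lborel (ball (0 :: real^'d) R) / q \<le> S" "lo * S - E * measure lborel (ball (0 :: real^'d) R) \<le> Re (\<beta> * (LINT x:ball 0 R|lborel. f (action x Y)))"
        using orbit[OF Y(1)] by blast
      show "lo \<le> E * q + e"
      proof (cases "lo \<le> 0")
        case True
        have "0 \<le> E * q" using E0 q by simp
        thus ?thesis using True e by linarith
      next
        case False
        hence "lo * (measure lborel (ball (0 :: real^'d) R) / q) \<le> lo * S" using S(1) by (intro mult_left_mono) auto
        also have "\<dots> \<le> (E + e / q) * measure lborel (ball (0 :: real^'d) R)" using S(2) Y(2) by (simp add: distrib_right)
        finally have "(lo / q) * measure lborel (ball (0 :: real^'d) R) \<le> (E + e / q) * measure lborel (ball (0 :: real^'d) R)" by simp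
        hence "lo / q \<le> E + e / q" using V0 by (simp only: mult_le_cancel_right_pos)
        thus ?thesis using q by (simp add: field_simps)
      qed
    qed
    hence hi: "hi \<le> D + E * q" using lh(1) by linarith
    obtain S where S: "measure lborel (ball (0 :: real^'d) R) / q \<le> S" "S \<le> measure lborel (ball (0 :: real^'d) R) / packing_volume"
        "Re (\<beta> * (LINT x:ball 0 R|lborel. f (action x X))) \<le> hi * S + E * measure lborel (ball (0 :: real^'d) R)"
      using orbit[OF X] by blast
    have "0 \<le> measure lborel (ball (0 :: real^'d) R) / q" using V0 q by simp
    hence S0: "S \<ge> 0" using S(1) by linarith
    have "hi * S \<le> (D + E * q) * S" using hi S0 by (intro mult_right_mono)
    also have "\<dots> \<le> (D + E * q) * (measure lborel (ball (0 :: real^'d) R) / packing_volume)"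
      using S(2) D E0 q by (intro mult_left_mono) auto
    finally show ?thesis using S(3) by (simp add: distrib_right)
  qed
  define J where "J = (LINT x:ball 0 R|lborel. f (action x X))"
  show ?thesis
  proof (cases "J = 0")
    case True
    have "0 \<le> ((D + E * q) / packing_volume + E) * measure lborel (ball (0 :: real^'d) R)"
      using D E0 q packing_volume_pos V0 by (intro mult_nonneg_nonneg add_nonneg_nonneg divide_nonneg_nonneg) auto
    thus ?thesis using True by (simp add: J_def q_def)
  next
    case False
    define \<beta> where "\<beta> = cnj J / of_real (norm J)"
    have "norm \<beta> = 1" using False by (simp add: \<beta>_def norm_divide)
    moreover have "\<beta> * J = of_real (norm J)"
    proof -
      have "cnj J * J = of_real (norm J) * of_real (norm J)"
        using complex_norm_square[of J] by (simp add: power2_eq_square mult.commute)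
      thus ?thesis using False by (simp add: \<beta>_def)
    qed
    ultimately show ?thesis using main[of \<beta>] by (simp add: J_def q_def)
  qed
qed

lemma spectral_cube_bound_contraction:
  assumes r: "0 < r" and R: "R = 1 / (8 * real CARD('d) * r)" and n: "2 * (c ^ n * radius) \<le> R"
    and t: "t \<ge> 0" and tw: "\<And>h B. 0 \<le> B \<Longrightarrow> (\<And>i. norm (h i) \<le> B) \<Longrightarrow> twisted_bound \<omega> h n (t * B)"
  shows "measure \<sigma> (cube \<omega> r) \<le> 16 * (M * (real CARD('d) * (2 * (c ^ n * radius)) / R +
     t * measure lborel (cball (0 :: real^'d) radius) / packing_volume))\<^sup>2"
proof (rule spectral_measure_cube_from_balls[OF r R])
  have cr: "c ^ n * radius > 0" using c radius_pos by simp
  hence R0: "R > 0" using n by linarith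
  show "0 \<le> M * (real CARD('d) * (2 * (c ^ n * radius)) / R + t * measure lborel (cball (0 :: real^'d) radius) / packing_volume)"
    using c radius_pos R0 t packing_volume_pos M_nonneg
    by (intro mult_nonneg_nonneg add_nonneg_nonneg divide_nonneg_nonneg) auto
  have M0: "0 \<le> M * volume_bound" using M_nonneg by (simp add: volume_bound_def)
  fix X assume X: "X \<in> tiling_space T \<zeta> L"
  have "norm (LINT x:ball 0 R|lborel. e_char (\<omega> \<bullet> x) * f (action x X)) \<le>
     (annulus_error n R + t * (M * volume_bound) / packing_volume) * measure lborel (ball (0 :: real^'d) R)"
    using M0 t by (intro orbit_ball_bound X n tw norm_\<psi>hat_le) auto
  also have "annulus_error n R + t * (M * volume_bound) / packing_volume =
      M * (real CARD('d) * (2 * (c ^ n * radius)) / R + t * measure lborel (cball (0 :: real^'d) radius) / packing_volume)"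
    by (simp add: annulus_error_def volume_bound_def algebra_simps)
  finally show "norm (LINT x:ball 0 R|lborel. e_char (\<omega> \<bullet> x) * f (action x X)) \<le>
      M * (real CARD('d) * (2 * (c ^ n * radius)) / R + t * measure lborel (cball (0 :: real^'d) radius) / packing_volume) *
      measure lborel (ball (0 :: real^'d) R)" .
qed

lemma spectral_cube_bound_zero:
  assumes r: "0 < r" and R: "R = 1 / (8 * real CARD('d) * r)" and n: "4 * (c ^ n * radius) \<le> R"
    and t: "t \<ge> 0" and tw: "\<And>h B. (\<forall>i. norm (h i) \<le> B) \<Longrightarrow> \<exists>lo hi. hi - lo \<le> t * (2 * B) \<and>
      (\<forall>i. lo * csize n i \<le> Re (twisted_sum 0 h n i) \<and> Re (twisted_sum 0 h n i) \<le> hi * csize n i)"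
    and e: "e = real CARD('d) * (2 * (c ^ n * radius)) / R"
  shows "measure \<sigma> (cube 0 r) \<le> 16 * (M * ((t * (2 * measure lborel (cball (0 :: real^'d) radius)) +
     e * (2 ^ CARD('d) * covering_volume)) / packing_volume + e))\<^sup>2"
proof (rule spectral_measure_cube_from_balls[OF r R])
  have cr: "c ^ n * radius > 0" using c radius_pos by simp
  hence R0: "R > 0" using n by linarith
  have e0: "e \<ge> 0" using cr R0 by (simp add: e)
  let ?b = "(t * (2 * measure lborel (cball (0 :: real^'d) radius)) + e * (2 ^ CARD('d) * covering_volume)) / packing_volume + e"
  show "0 \<le> M * ?b"
    using e0 t packing_volume_pos covering_volume_pos M_nonneg
    by (intro mult_nonneg_nonneg add_nonneg_nonneg divide_nonneg_nonneg) auto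
  define B where "B = M * volume_bound"
  have B0: "0 \<le> B" using M_nonneg by (simp add: B_def volume_bound_def)
  fix X assume X: "X \<in> tiling_space T \<zeta> L"
  have "norm (LINT x:ball 0 R|lborel. f (action x X)) \<le>
    ((t * (2 * B) + annulus_error n R * (2 ^ CARD('d) * covering_volume)) / packing_volume + annulus_error n R)
      * measure lborel (ball (0 :: real^'d) R)"
  proof (rule orbit_zero_frequency_bound[OF n refl _ _ X])
    show "0 \<le> t * (2 * B)" using t B0 by simp
    fix \<beta> :: complex assume \<beta>: "norm \<beta> = 1"
    have "twisted_sum 0 (\<lambda>i. \<beta> * \<psi>hat 0 i) n i = \<beta> * twisted_sum 0 (\<psi>hat 0) n i" for i
      by (simp add: twisted_sum_def sum_distrib_left case_prod_beta)
    moreover have "\<forall>i. norm (\<beta> * \<psi>hat 0 i) \<le> B" using norm_\<psi>hat_le \<beta> by (simp add: norm_mult B_def)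
    ultimately show "\<exists>lo hi. hi - lo \<le> t * (2 * B) \<and>
      (\<forall>i. lo * csize n i \<le> Re (\<beta> * twisted_sum 0 (\<psi>hat 0) n i) \<and> Re (\<beta> * twisted_sum 0 (\<psi>hat 0) n i) \<le> hi * csize n i)"
      using tw[of "\<lambda>i. \<beta> * \<psi>hat 0 i" B] by simp
  qed
  also have "(t * (2 * B) + annulus_error n R * (2 ^ CARD('d) * covering_volume)) / packing_volume + annulus_error n R = M * ?b"
    by (simp add: annulus_error_def B_def volume_bound_def e algebra_simps add_divide_distrib)
  finally show "norm (LINT x:ball 0 R|lborel. e_char (0 \<bullet> x) * f (action x X)) \<le> M * ?b * measure lborel (ball (0 :: real^'d) R)"
    by simp
qed

end

section \<open>Small, middle and large frequencies\<close>

lemma eventually_exp_le_powr: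
  fixes a C g :: real
  assumes "a > 0" "C > 0"
  shows "eventually (\<lambda>H. C * exp (- a * H) \<le> H powr (- g)) at_top"
proof -
  have "((\<lambda>H. C * (H powr g * exp (- a * H))) \<longlongrightarrow> 0) at_top"
    using assms by real_asymp
  hence "eventually (\<lambda>H. C * (H powr g * exp (- a * H)) < 1) at_top"
    by (rule order_tendstoD) simp
  moreover have "eventually (\<lambda>H :: real. H > 0) at_top" by (rule eventually_gt_at_top)
  ultimately show ?thesis
  proof eventually_elim
    case (elim H)
    thus ?case by (simp add: powr_minus field_simps)
  qed
qed

lemma eventually_sqrt_ln_le:
  fixes u d :: real
  assumes "u > 0" "d > 0"
  shows "eventually (\<lambda>H. sqrt H * (2 + ln (d * H) / u) \<le> H / (8 * u)) at_top"
proof -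
  have "((\<lambda>H. sqrt H * (2 + ln (d * H) / u) / H) \<longlongrightarrow> 0) at_top"
    using assms by real_asymp
  hence "eventually (\<lambda>H. sqrt H * (2 + ln (d * H) / u) / H < 1 / (8 * u)) at_top"
    using assms by (intro order_tendstoD) auto
  moreover have "eventually (\<lambda>H :: real. H > 0) at_top" by (rule eventually_gt_at_top)
  ultimately show ?thesis
  proof eventually_elim
    case (elim H)
    thus ?case using assms by (simp add: field_simps)
  qed
qed

text \<open>The level at which supertiles have diameter of order \<open>sqrt R\<close>: small compared with the ball, and still
  logarithmic in \<open>R\<close>.\<close>

lemma power_le_sqrt_level:
  fixes c R :: real and k :: nat
  assumes c: "c > 1" and R: "R \<ge> 1" and k: "k > 0"
  obtains l where "c ^ (k * l) \<le> sqrt R" "real l \<ge> log c R / (2 * k) - 1"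
proof
  define l where "l = nat \<lfloor>log c R / (2 * k)\<rfloor>"
  have nn: "log c R / (2 * k) \<ge> 0" using c R by simp
  have l: "real l \<le> log c R / (2 * k)" "log c R / (2 * k) < real l + 1"
    unfolding l_def using nn by linarith+
  show "real l \<ge> log c R / (2 * k) - 1" using l by linarith
  have "real (k * l) \<le> log c R / 2" using l(1) k by (simp add: field_simps)
  hence "c powr real (k * l) \<le> c powr (log c R / 2)" using c by (intro powr_mono) auto
  also have "c powr (log c R / 2) = (c powr log c R) powr (1 / 2)" by (simp add: powr_powr)
  also have "\<dots> = sqrt R" using c R by (simp add: powr_half_sqrt)
  finally have "c powr real (k * l) \<le> sqrt R" .
  moreover have "c powr real (k * l) = c ^ (k * l)" by (rule powr_realpow) (use c in simp)
  ultimately show "c ^ (k * l) \<le> sqrt R" by (simp only:)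
qed

lemma cube_subset_cube_zero:
  fixes \<omega> :: "real^'d::finite"
  assumes "norm \<omega> + r \<le> r'"
  shows "cube \<omega> r \<subseteq> cube 0 r'"
proof
  fix x assume x: "x \<in> cube \<omega> r"
  have "- r' \<le> x $ i \<and> x $ i \<le> r'" for i
  proof -
    have "\<omega> $ i - r \<le> x $ i" "x $ i \<le> \<omega> $ i + r" using x by (simp_all add: cube_def mem_box_cart)
    moreover have "\<bar>\<omega> $ i\<bar> \<le> norm \<omega>" by (rule component_le_norm_cart)
    ultimately show ?thesis using assms by linarith
  qed
  thus "x \<in> cube 0 r'" by (simp add: cube_def mem_box_cart)
qed

context self_similar_substitution
begin

lemma annulus_ratio:
  assumes "c ^ n \<le> sqrt R" "4 * radius \<le> sqrt R" "R > 0"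
  shows "4 * (c ^ n * radius) \<le> R"
    and "real CARD('d) * (2 * (c ^ n * radius)) / R \<le> real CARD('d) * (2 * radius) / sqrt R"
proof -
  have s: "sqrt R > 0" "R = sqrt R * sqrt R" using assms(3) by auto
  have "c ^ n * (4 * radius) \<le> sqrt R * sqrt R"
    using assms(1,2) s(1) radius_pos by (intro mult_mono) auto
  thus "4 * (c ^ n * radius) \<le> R" using s(2) by simp
  have "real CARD('d) * (2 * (c ^ n * radius)) \<le> real CARD('d) * (2 * radius) * sqrt R"
    using assms(1) radius_pos by (simp add: mult.assoc mult.commute mult_left_mono)
  hence "real CARD('d) * (2 * (c ^ n * radius)) / R \<le> real CARD('d) * (2 * radius) * sqrt R / R"
    using assms(3) by (intro divide_right_mono) auto
  also have "\<dots> = real CARD('d) * (2 * radius) / sqrt R"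
    using s by (metis mult_divide_mult_cancel_right less_irrefl)
  finally show "real CARD('d) * (2 * (c ^ n * radius)) / R \<le> real CARD('d) * (2 * radius) / sqrt R" .
qed

text \<open>Frequencies that are neither very small nor very large: about \<open>log H\<close> windows fit between
  the level where \<open>L ^ n \<omega>\<close> has size 1 and the level of the ball, and each yields a factor \<open>\<theta>\<close>.\<close>

lemma middle_frequencies:
  assumes np: "strongly_totally_non_pisot (complex_eigenvalues L)"
  shows "\<exists>A>0. \<exists>g>0. \<forall>\<^sub>F H in at_top. \<forall>\<psi> M f \<mu> \<sigma> \<omega>. spectral_profile T \<zeta> L c \<psi> M f \<mu> \<sigma> \<longrightarrow>
     exp (- H / 4) \<le> norm \<omega> \<longrightarrow> norm \<omega> \<le> real CARD('d) * H \<longrightarrow>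
     measure \<sigma> (cube \<omega> (exp (- H))) \<le> A * M\<^sup>2 * H powr (- g)"
proof -
  obtain G \<theta> where G: "G > 1" and \<theta>: "0 < \<theta>" "\<theta> < 1" and decay: "\<And>\<omega> h B n0 l n. 0 \<le> B \<Longrightarrow> 1 \<le> c ^ n0 * norm \<omega> \<Longrightarrow>
     twisted_bound \<omega> h n0 B \<Longrightarrow> n0 \<le> n \<Longrightarrow>
     G ^ l * (1 + log c (c ^ n0 * norm \<omega>)) \<le> 1 + log c (c ^ n * norm \<omega>) \<Longrightarrow>
     twisted_bound \<omega> h n (\<theta> ^ l * B)"
    using cocycle_decay[OF np] by metis
  define d where "d = real CARD('d)"
  have d: "d \<ge> 1" by (simp add: d_def Suc_le_eq)
  define u where "u = ln c"
  have u: "u > 0" using c by (simp add: u_def)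
  define g where "g = - ln \<theta> / (2 * ln G)"
  have lnG: "ln G > 0" using G by simp
  have "ln \<theta> < 0" using \<theta> by simp
  hence g: "g > 0" using lnG by (auto simp: g_def intro!: divide_neg_pos)
  define C1 where "C1 = d * (2 * radius) * sqrt (8 * d)"
  have C1: "C1 > 0" using d radius_pos by (simp add: C1_def)
  define C2 where "C2 = measure lborel (cball (0 :: real^'d) radius) / (\<theta> * packing_volume)"
  have C2: "C2 \<ge> 0" using \<theta> packing_volume_pos by (simp add: C2_def)
  have "eventually (\<lambda>H. C1 * exp (- (1 / 2) * H) \<le> H powr (- g)) at_top"
    using C1 by (intro eventually_exp_le_powr) auto
  moreover have "eventually (\<lambda>H. sqrt H * (2 + ln (d * H) / u) \<le> H / (8 * u)) at_top"
    using u d by (intro eventually_sqrt_ln_le) auto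
  moreover have "eventually (\<lambda>H. H \<ge> 1 + 8 * u + 4 * ln (8 * d) + 2 * ln (1 + 16 * radius\<^sup>2)) at_top"
    by (rule eventually_ge_at_top)
  ultimately have ev: "\<forall>\<^sub>F H in at_top. \<forall>\<psi> M f \<mu> \<sigma> \<omega>. spectral_profile T \<zeta> L c \<psi> M f \<mu> \<sigma> \<longrightarrow>
     exp (- H / 4) \<le> norm \<omega> \<longrightarrow> norm \<omega> \<le> d * H \<longrightarrow>
     measure \<sigma> (cube \<omega> (exp (- H))) \<le> 16 * (1 + C2)\<^sup>2 * M\<^sup>2 * H powr (- (2 * g))"
  proof (eventually_elim, intro allI impI)
    fix H \<psi> M f \<mu> \<sigma> and \<omega> :: "real^'d"
    assume H1: "C1 * exp (- (1 / 2) * H) \<le> H powr (- g)"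
      and H2: "sqrt H * (2 + ln (d * H) / u) \<le> H / (8 * u)"
      and H3: "H \<ge> 1 + 8 * u + 4 * ln (8 * d) + 2 * ln (1 + 16 * radius\<^sup>2)"
      and sp: "spectral_profile T \<zeta> L c \<psi> M f \<mu> \<sigma>"
      and \<omega>1: "exp (- H / 4) \<le> norm \<omega>" and \<omega>2: "norm \<omega> \<le> d * H"
    interpret S: spectral_profile T \<zeta> L c \<psi> M f \<mu> \<sigma> by (rule sp)
    have ld: "ln (8 * d) > 0" using d by (intro ln_gt_zero) auto
    have lr: "ln (1 + 16 * radius\<^sup>2) \<ge> 0" by (intro ln_ge_zero) simp
    have Hge: "H \<ge> 1" "H \<ge> 8 * u + 2 * ln (8 * d)" "H \<ge> 4 * ln (8 * d)"
      "H \<ge> ln (8 * d) + ln (1 + 16 * radius\<^sup>2)"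
      using H3 ld lr u by linarith+
    define R where "R = exp H / (8 * d)"
    have R0: "R > 0" using d by (simp add: R_def)
    have lnR: "ln R = H - ln (8 * d)" using d by (simp add: R_def ln_div)
    have "exp (ln (1 + 16 * radius\<^sup>2)) \<le> exp (ln R)" using Hge(4) lnR by simp
    hence "1 + 16 * radius\<^sup>2 \<le> R" using R0 by (simp add: add_pos_nonneg)
    hence Rge: "R \<ge> 1" "16 * radius\<^sup>2 \<le> R" using zero_le_power2[of radius] by linarith+
    have sR: "4 * radius \<le> sqrt R"
      by (rule real_le_rsqrt) (use Rge(2) in \<open>simp add: power_mult_distrib\<close>)
    obtain n where n: "c ^ n \<le> sqrt R" "real n \<ge> log c R / 2 - 1"
      by (rule power_le_sqrt_level[OF c Rge(1), of 1]) auto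
    have logR: "log c R = (H - ln (8 * d)) / u" by (simp add: log_def lnR u_def)
    define x where "x = log c (norm \<omega>)"
    have \<omega>0: "norm \<omega> > 0" using \<omega>1 exp_gt_zero[of "- H / 4"] by linarith
    have lgw: "log c (c ^ m * norm \<omega>) = real m + x" for m
      using \<omega>0 c by (simp add: x_def log_mult log_nat_power)
    have xge: "x \<ge> - H / (4 * u)"
    proof -
      have "- H / 4 \<le> ln (norm \<omega>)" using \<omega>1 \<omega>0 by (simp add: ln_ge_iff)
      hence "(- H / 4) / u \<le> ln (norm \<omega>) / u" using u by (intro divide_right_mono) auto
      thus ?thesis by (simp add: x_def log_def u_def)
    qed
    have dH: "1 \<le> d * H" using d Hge(1) mult_mono[of 1 d 1 H] by simp
    have xle: "x \<le> ln (d * H) / u"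
    proof -
      have "ln (norm \<omega>) \<le> ln (d * H)" using \<omega>0 \<omega>2 by (intro ln_mono) auto
      thus ?thesis using u by (simp add: x_def log_def u_def divide_right_mono)
    qed
    (* the first level at which L ^ n \<omega> has norm at least 1 *)
    define n0 where "n0 = nat \<lceil>- x\<rceil>"
    have l0: "0 \<le> ln (d * H) / u" using dH u by simp
    have n0: "real n0 + x \<ge> 0" "real n0 + x \<le> 1 + ln (d * H) / u" "real n0 \<le> 1 + H / (4 * u)"
    proof -
      have "0 \<le> H / (4 * u)" using Hge(1) u by simp
      show "real n0 + x \<ge> 0" unfolding n0_def by linarith
      show "real n0 + x \<le> 1 + ln (d * H) / u" using xle l0 unfolding n0_def by linarith
      show "real n0 \<le> 1 + H / (4 * u)" using xge \<open>0 \<le> H / (4 * u)\<close> unfolding n0_def by linarith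
    qed
    have frac: "(H - ln (8 * d)) / u / 2 - H / (4 * u) = (H / 4 - ln (8 * d) / 2) / u"
      using u by (simp add: field_simps)
    have "2 \<le> (H / 4 - ln (8 * d) / 2) / u" using Hge(2) u by (simp add: field_simps)
    hence n0n: "n0 \<le> n" using n0(3) n(2) frac unfolding logR by linarith
    have one: "1 \<le> c ^ n0 * norm \<omega>"
    proof -
      have "0 \<le> log c (c ^ n0 * norm \<omega>)" using n0(1) by (simp add: lgw)
      moreover have "0 < c ^ n0 * norm \<omega>" using c \<omega>0 by simp
      ultimately show ?thesis using c zero_le_log_cancel_iff[of c "c ^ n0 * norm \<omega>"] by blast
    qed
    (* the number of windows; half of log H is left for the logarithmic factor at their start *)
    define l where "l = nat \<lfloor>log G (sqrt H)\<rfloor>"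
    have lg: "0 \<le> log G (sqrt H)" using G Hge(1) by simp
    have l: "real l \<le> log G (sqrt H)" "log G (sqrt H) - 1 \<le> real l" unfolding l_def using lg by linarith+
    have "G powr real l \<le> G powr log G (sqrt H)" using l(1) G by (intro powr_mono) auto
    hence Gl: "G ^ l \<le> sqrt H" using G Hge(1) by (simp add: powr_realpow)
    have large: "G ^ l * (1 + log c (c ^ n0 * norm \<omega>)) \<le> 1 + log c (c ^ n * norm \<omega>)"
    proof -
      have "G ^ l * (1 + log c (c ^ n0 * norm \<omega>)) \<le> sqrt H * (2 + ln (d * H) / u)"
        using Gl n0(1,2) Hge(1) by (intro mult_mono) (auto simp: lgw)
      also have "\<dots> \<le> H / (8 * u)" by (rule H2)
      also have "\<dots> \<le> (H / 4 - ln (8 * d) / 2) / u" using Hge(3) u by (simp add: field_simps)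
      also have "\<dots> \<le> 1 + log c (c ^ n * norm \<omega>)" using n(2) xge frac unfolding lgw logR by linarith
      finally show ?thesis .
    qed
    have tl: "\<theta> ^ l \<le> H powr (- g) / \<theta>"
    proof -
      have "\<theta> ^ l = \<theta> powr real l" using \<theta> by (simp add: powr_realpow)
      also have "\<dots> \<le> \<theta> powr (log G (sqrt H) - 1)" using \<theta> l(2) by (intro powr_mono') auto
      also have "\<dots> = \<theta> powr (log G (sqrt H)) / \<theta>" using \<theta> by (simp add: powr_diff)
      also have "\<theta> powr (log G (sqrt H)) = H powr (- g)"
        using \<theta> Hge(1) lnG by (simp add: powr_def g_def log_def ln_sqrt)
      finally show ?thesis .
    qed
    have "measure \<sigma> (cube \<omega> (exp (- H))) \<le> 16 * (M * (real CARD('d) * (2 * (c ^ n * radius)) / R +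
       \<theta> ^ l * measure lborel (cball (0 :: real^'d) radius) / packing_volume))\<^sup>2"
    proof (rule S.spectral_cube_bound_contraction)
      show "R = 1 / (8 * real CARD('d) * exp (- H))" by (simp add: R_def d_def exp_minus field_simps)
      have "0 \<le> c ^ n * radius" using c radius_pos by simp
      thus "2 * (c ^ n * radius) \<le> R" using annulus_ratio(1)[OF n(1) sR R0] by linarith
      show "twisted_bound \<omega> h n (\<theta> ^ l * B)" if "0 \<le> B" "\<And>i. norm (h i) \<le> B" for h B
        using twisted_bound_mono[OF twisted_bound_0[of h B \<omega>, OF that(2)], of n0]
        by (intro decay[OF that(1) one _ n0n large]) simp
    qed (use \<theta> in auto)
    also have "\<dots> \<le> 16 * (M * ((1 + C2) * H powr (- g)))\<^sup>2"
    proof (intro mult_left_mono power_mono S.M_nonneg)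
      have "1 / sqrt R = sqrt (8 * d) * exp (- (1 / 2) * H)"
      proof -
        have "sqrt (exp H) = exp (H / 2)" by (rule real_sqrt_unique) (simp_all flip: exp_double)
        thus ?thesis by (simp add: R_def real_sqrt_divide exp_minus field_simps)
      qed
      hence "d * (2 * radius) * (1 / sqrt R) = C1 * exp (- (1 / 2) * H)"
        by (simp only: C1_def mult.assoc)
      hence sq: "d * (2 * radius) / sqrt R = C1 * exp (- (1 / 2) * H)" by simp
      hence e: "real CARD('d) * (2 * (c ^ n * radius)) / R \<le> H powr (- g)"
        using annulus_ratio(2)[OF n(1) sR R0] H1 sq unfolding d_def by linarith
      have "\<theta> ^ l * measure lborel (cball (0 :: real^'d) radius) / packing_volume \<le>
          H powr (- g) / \<theta> * measure lborel (cball (0 :: real^'d) radius) / packing_volume"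
        using tl packing_volume_pos by (intro divide_right_mono mult_right_mono) auto
      also have "\<dots> = C2 * H powr (- g)" by (simp add: C2_def)
      finally show "real CARD('d) * (2 * (c ^ n * radius)) / R +
         \<theta> ^ l * measure lborel (cball (0 :: real^'d) radius) / packing_volume \<le> (1 + C2) * H powr (- g)"
        using e by (simp add: distrib_right)
      show "0 \<le> M * (real CARD('d) * (2 * (c ^ n * radius)) / R +
         \<theta> ^ l * measure lborel (cball (0 :: real^'d) radius) / packing_volume)"
        using c radius_pos R0 \<theta> packing_volume_pos S.M_nonneg
        by (intro mult_nonneg_nonneg add_nonneg_nonneg divide_nonneg_nonneg) auto
    qed auto
    also have "\<dots> = 16 * (1 + C2)\<^sup>2 * M\<^sup>2 * H powr (- (2 * g))"
      using Hge(1) by (simp add: power_mult_distrib power2_eq_square[of "H powr _"] flip: powr_add)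
    finally show "measure \<sigma> (cube \<omega> (exp (- H))) \<le> 16 * (1 + C2)\<^sup>2 * M\<^sup>2 * H powr (- (2 * g))" .
  qed
  have "16 * (1 + C2)\<^sup>2 > 0" using C2 by (simp add: add_pos_nonneg)
  thus ?thesis using ev g unfolding d_def
    by (intro exI[of _ "16 * (1 + C2)\<^sup>2"] conjI exI[of _ "2 * g"]) auto
qed

text \<open>A cube near the origin lies in a slightly larger cube about the origin, where the convergence
  of averages over supertiles is exponentially fast.\<close>

lemma small_frequencies:
  "\<exists>A>0. \<forall>\<^sub>F H in at_top. \<forall>\<psi> M f \<mu> \<sigma> \<omega>. spectral_profile T \<zeta> L c \<psi> M f \<mu> \<sigma> \<longrightarrow>
     norm \<omega> \<le> exp (- H / 4) \<longrightarrow> measure \<sigma> (cube \<omega> (exp (- H))) \<le> A * M\<^sup>2 * H powr (- 2)"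
proof -
  obtain k \<theta> where k: "k > 0" and \<theta>: "0 < \<theta>" "\<theta> < 1" and contr: "\<And>h B l. (\<forall>i. norm (h i) \<le> B) \<Longrightarrow>
     (\<exists>lo hi. hi - lo \<le> \<theta> ^ l * (2 * B) \<and> (\<forall>i. lo * csize (k * l) i \<le> Re (twisted_sum 0 h (k * l) i) \<and>
        Re (twisted_sum 0 h (k * l) i) \<le> hi * csize (k * l) i))"
    using zero_frequency_contraction by metis
  define d where "d = real CARD('d)"
  have d: "d \<ge> 1" by (simp add: d_def Suc_le_eq)
  define u where "u = ln c"
  have u: "u > 0" using c by (simp add: u_def)
  define a where "a = - ln \<theta> / (8 * k * u)"
  have "ln \<theta> < 0" using \<theta> by simp
  hence a: "a > 0" using k u by (auto simp: a_def intro!: divide_neg_pos)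
  define C0 where "C0 = exp (- ln \<theta> * ln (16 * d) / (2 * k * u)) / \<theta>"
  have C0: "C0 > 0" using \<theta> by (simp add: C0_def)
  define C1 where "C1 = d * (2 * radius) * sqrt (16 * d)"
  have C1: "C1 > 0" using d radius_pos by (simp add: C1_def)
  define vb where "vb = measure lborel (cball (0 :: real^'d) radius)"
  define q where "q = 2 ^ CARD('d) * covering_volume"
  have q: "q > 0" using covering_volume_pos by (simp add: q_def)
  define C2 where "C2 = (2 * vb + q) / packing_volume + 1"
  have C2: "C2 > 0" using packing_volume_pos q by (auto simp: C2_def vb_def intro!: add_nonneg_pos)
  have "eventually (\<lambda>H. C0 * exp (- a * H) \<le> H powr (- 1)) at_top"
    using C0 a by (intro eventually_exp_le_powr) auto
  moreover have "eventually (\<lambda>H. C1 * exp (- (1 / 8) * H) \<le> H powr (- 1)) at_top"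
    using C1 by (intro eventually_exp_le_powr) auto
  moreover have "eventually (\<lambda>H. H \<ge> 1 + 4 * ln (16 * d) + 4 * ln (1 + 16 * radius\<^sup>2)) at_top"
    by (rule eventually_ge_at_top)
  ultimately have ev: "\<forall>\<^sub>F H in at_top. \<forall>\<psi> M f \<mu> \<sigma> \<omega>. spectral_profile T \<zeta> L c \<psi> M f \<mu> \<sigma> \<longrightarrow>
     norm \<omega> \<le> exp (- H / 4) \<longrightarrow> measure \<sigma> (cube \<omega> (exp (- H))) \<le> 16 * C2\<^sup>2 * M\<^sup>2 * H powr (- 2)"
  proof (eventually_elim, intro allI impI)
    fix H \<psi> M f \<mu> \<sigma> and \<omega> :: "real^'d"
    assume H1: "C0 * exp (- a * H) \<le> H powr (- 1)"
      and H2: "C1 * exp (- (1 / 8) * H) \<le> H powr (- 1)"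
      and H3: "H \<ge> 1 + 4 * ln (16 * d) + 4 * ln (1 + 16 * radius\<^sup>2)"
      and sp: "spectral_profile T \<zeta> L c \<psi> M f \<mu> \<sigma>"
      and \<omega>: "norm \<omega> \<le> exp (- H / 4)"
    interpret S: spectral_profile T \<zeta> L c \<psi> M f \<mu> \<sigma> by (rule sp)
    have ld: "ln (16 * d) > 0" using d by (intro ln_gt_zero) auto
    have lr: "ln (1 + 16 * radius\<^sup>2) \<ge> 0" by (intro ln_ge_zero) simp
    have Hge: "H \<ge> 1" "H / 4 \<ge> ln (16 * d) + ln (1 + 16 * radius\<^sup>2)" using H3 ld lr by linarith+
    (* twice the size of \<omega>, which leaves room for the cube of side 2 exp (- H) *)
    define r where "r = 2 * exp (- H / 4)"
    define R where "R = exp (H / 4) / (16 * d)"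
    have R0: "R > 0" using d by (simp add: R_def)
    have lnR: "ln R = H / 4 - ln (16 * d)" using d by (simp add: R_def ln_div)
    have "exp (ln (1 + 16 * radius\<^sup>2)) \<le> exp (ln R)" using Hge(2) lnR by simp
    hence "1 + 16 * radius\<^sup>2 \<le> R" using R0 by (simp add: add_pos_nonneg)
    hence Rge: "R \<ge> 1" "16 * radius\<^sup>2 \<le> R" using zero_le_power2[of radius] by linarith+
    have sR: "4 * radius \<le> sqrt R"
      by (rule real_le_rsqrt) (use Rge(2) in \<open>simp add: power_mult_distrib\<close>)
    obtain l where l: "c ^ (k * l) \<le> sqrt R" "real l \<ge> log c R / (2 * k) - 1"
      by (rule power_le_sqrt_level[OF c Rge(1) k])
    have logR: "log c R = (H / 4 - ln (16 * d)) / u" by (simp add: log_def lnR u_def)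
    have tl: "\<theta> ^ l \<le> H powr (- 1)"
    proof -
      have "\<theta> ^ l = \<theta> powr real l" using \<theta> by (simp add: powr_realpow)
      also have "\<dots> \<le> \<theta> powr (log c R / (2 * k) - 1)" using \<theta> l(2) by (intro powr_mono') auto
      also have "\<theta> powr (z - 1) = \<theta> powr z / \<theta>" for z using \<theta> by (simp add: powr_diff)
      also have "\<theta> powr z = exp (ln \<theta> * z)" for z using \<theta> by (simp add: powr_def mult.commute)
      also have "ln \<theta> * (log c R / (2 * k)) = - ln \<theta> * ln (16 * d) / (2 * k * u) + - a * H"
        using u k by (simp add: logR a_def field_simps)
      finally have "\<theta> ^ l \<le> C0 * exp (- a * H)" by (simp only: exp_add C0_def) simp
      thus ?thesis using H1 by linarith
    qed
    define e where "e = real CARD('d) * (2 * (c ^ (k * l) * radius)) / R"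
    have e: "e \<le> H powr (- 1)"
    proof -
      have "1 / sqrt R = sqrt (16 * d) * exp (- (1 / 8) * H)"
      proof -
        have "sqrt (exp (H / 4)) = exp (H / 8)" by (rule real_sqrt_unique) (simp_all flip: exp_double)
        thus ?thesis by (simp add: R_def real_sqrt_divide exp_minus field_simps)
      qed
      hence "d * (2 * radius) * (1 / sqrt R) = C1 * exp (- (1 / 8) * H)"
        by (simp only: C1_def mult.assoc)
      hence sq: "d * (2 * radius) / sqrt R = C1 * exp (- (1 / 8) * H)" by simp
      show ?thesis using annulus_ratio(2)[OF l(1) sR R0] H2 sq unfolding d_def e_def by linarith
    qed
    have e0: "e \<ge> 0" using c radius_pos R0 by (simp add: e_def)
    have "cube \<omega> (exp (- H)) \<subseteq> cube 0 r"
    proof (rule cube_subset_cube_zero)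
      have "exp (- H) \<le> exp (- H / 4)" using Hge(1) by simp
      thus "norm \<omega> + exp (- H) \<le> r" using \<omega> unfolding r_def by linarith
    qed
    hence "measure \<sigma> (cube \<omega> (exp (- H))) \<le> measure \<sigma> (cube 0 r)"
      by (intro finite_measure.finite_measure_mono[OF S.finite_\<sigma>]) (auto simp: S.sets_\<sigma> cube_def)
    also have "\<dots> \<le> 16 * (M * ((\<theta> ^ l * (2 * vb) + e * q) / packing_volume + e))\<^sup>2"
      unfolding vb_def q_def
    proof (rule S.spectral_cube_bound_zero[OF _ _ _ _ _ e_def])
      show "0 < r" by (simp add: r_def)
      show "R = 1 / (8 * real CARD('d) * r)" by (simp add: R_def r_def d_def exp_minus field_simps)
      show "4 * (c ^ (k * l) * radius) \<le> R" by (rule annulus_ratio(1)[OF l(1) sR R0])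
      show "0 \<le> \<theta> ^ l" using \<theta> by simp
      show "\<exists>lo hi. hi - lo \<le> \<theta> ^ l * (2 * B) \<and> (\<forall>i. lo * csize (k * l) i \<le> Re (twisted_sum 0 h (k * l) i) \<and>
        Re (twisted_sum 0 h (k * l) i) \<le> hi * csize (k * l) i)" if "\<forall>i. norm (h i) \<le> B" for h B
        by (rule contr[OF that])
    qed
    also have "\<dots> \<le> 16 * (M * (C2 * H powr (- 1)))\<^sup>2"
    proof (intro mult_left_mono power_mono S.M_nonneg)
      have vb: "vb \<ge> 0" by (simp add: vb_def)
      have "(\<theta> ^ l * (2 * vb) + e * q) / packing_volume + e \<le>
          (H powr (- 1) * (2 * vb) + H powr (- 1) * q) / packing_volume + H powr (- 1)"
        using tl e vb q packing_volume_pos by (intro add_mono divide_right_mono mult_right_mono) auto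
      thus "(\<theta> ^ l * (2 * vb) + e * q) / packing_volume + e \<le> C2 * H powr (- 1)"
        by (simp add: C2_def algebra_simps add_divide_distrib)
      show "0 \<le> M * ((\<theta> ^ l * (2 * vb) + e * q) / packing_volume + e)"
        using vb \<theta> e0 q packing_volume_pos S.M_nonneg
        by (intro mult_nonneg_nonneg add_nonneg_nonneg divide_nonneg_nonneg) auto
    qed auto
    also have "\<dots> = 16 * C2\<^sup>2 * M\<^sup>2 * H powr (- 2)"
    proof -
      have "H powr (- 1) = 1 / H" "H powr (- 2) = 1 / H\<^sup>2"
        using Hge(1) by (simp_all add: powr_minus powr_numeral divide_inverse)
      thus ?thesis by (simp add: power_mult_distrib power_divide)
    qed
    finally show "measure \<sigma> (cube \<omega> (exp (- H))) \<le> 16 * C2\<^sup>2 * M\<^sup>2 * H powr (- 2)" .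
  qed
  have "16 * C2\<^sup>2 > 0" using C2 by simp
  thus ?thesis using ev by blast
qed

lemma large_frequencies:
  assumes sp: "spectral_profile T \<zeta> L c \<psi> M f \<mu> \<sigma>" and H: "H \<ge> 2" and \<omega>: "H \<le> \<bar>\<omega> $ i\<bar>"
  shows "measure \<sigma> (cube \<omega> (exp (- H))) \<le> M\<^sup>2 * H powr (- 2)"
proof -
  interpret S: spectral_profile T \<zeta> L c \<psi> M f \<mu> \<sigma> by (rule sp)
  have "exp (- H) \<le> 1 / 4"
  proof -
    have "4 \<le> (1 + H / 2)\<^sup>2" using H power_mono[of 2 "1 + H / 2" 2] by simp
    also have "\<dots> \<le> (exp (H / 2))\<^sup>2" using H by (intro power_mono exp_ge_add_one_self) auto
    also have "\<dots> = exp H" by (simp flip: exp_double)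
    finally show ?thesis by (simp add: exp_minus field_simps)
  qed
  moreover have "action 0 X = X" for X :: "'d tile set" by (simp add: action_def image_def)
  hence "norm (f X - f (action s X)) \<le> (2 * M) * norm s" if "X \<in> space \<mu>" for X s
    using S.f_orbit_Lipschitz[of X 0 s] that by (simp add: S.space_\<mu>)
  ultimately have "measure \<sigma> (cube \<omega> (exp (- H))) \<le> (2 * M / (2 * \<bar>\<omega> $ i\<bar>))\<^sup>2"
    using H \<omega> S.M_nonneg by (intro S.spectral_measure_cube_large_frequency) auto
  also have "\<dots> \<le> (M / H)\<^sup>2"
    using H \<omega> S.M_nonneg by (intro power_mono) (auto intro!: divide_left_mono)
  also have "\<dots> = M\<^sup>2 * H powr (- 2)"
  proof -
    have "H powr (- 2) = 1 / H\<^sup>2" using H by (simp add: powr_minus powr_numeral divide_inverse)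
    thus ?thesis by (simp add: power_divide)
  qed
  finally show ?thesis .
qed

end

section \<open>Lipschitz norms\<close>

text \<open>The infimum in the definition is attained, since the Lipschitz condition with constant \<open>s\<close> is closed in \<open>s\<close>.\<close>

lemma lip_norm_bounds:
  fixes g :: "real^'d::finite \<Rightarrow> complex"
  assumes lip: "C-lipschitz_on UNIV g" and K: "compact K" "\<And>x. x \<notin> K \<Longrightarrow> g x = 0"
  shows "norm (g x) \<le> lip_norm g" "norm (g x - g y) \<le> lip_norm g * norm (x - y)"
proof -
  define S where "S = {s. s > 0 \<and> (\<forall>x y. norm (g x - g y) \<le> s * norm (x - y))}"
  have C: "norm (g x - g y) \<le> C * norm (x - y)" "C \<ge> 0" for x y
    using lip by (auto simp: lipschitz_on_def dist_norm)
  have "C + 1 \<in> S" unfolding S_def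
  proof (intro CollectI conjI allI)
    show "C + 1 > 0" using C(2) by simp
    have "C * norm (x - y) \<le> (C + 1) * norm (x - y)" for x y by (intro mult_right_mono) auto
    thus "norm (g x - g y) \<le> (C + 1) * norm (x - y)" for x y using C(1) order_trans by blast
  qed
  hence ne: "S \<noteq> {}" by blast
  have "bounded (g ` K)"
    using lipschitz_on_continuous_on[OF lip] K(1)
    by (intro compact_imp_bounded compact_continuous_image) (auto intro: continuous_on_subset)
  then obtain b where b: "\<And>x. x \<in> K \<Longrightarrow> norm (g x) \<le> b" by (auto simp: bounded_iff)
  have bdd: "bdd_above (range (\<lambda>x. norm (g x)))"
  proof (rule bdd_aboveI2)
    show "norm (g x) \<le> max b 0" for x using b[of x] K(2)[of x] by (cases "x \<in> K") (auto simp: le_max_iff_disj)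
  qed
  have sup: "norm (g x) \<le> (SUP x. norm (g x))" for x using bdd by (rule cSUP_upper2[where x = x]) auto
  have inf0: "0 \<le> Inf S" using ne by (intro cInf_greatest) (auto simp: S_def)
  have inf: "norm (g x - g y) \<le> Inf S * norm (x - y)" for x y
  proof (cases "x = y")
    case False
    have "norm (g x - g y) / norm (x - y) \<le> Inf S"
      using ne False by (intro cInf_greatest) (auto simp: S_def divide_le_eq)
    thus ?thesis using False by (simp add: divide_le_eq)
  qed simp
  have ln: "lip_norm g = (SUP x. norm (g x)) + Inf S" by (simp add: lip_norm_def S_def)
  show "norm (g x) \<le> lip_norm g" using sup[of x] inf0 ln by linarith
  have "0 \<le> (SUP x. norm (g x))" using sup[of x] norm_ge_zero[of "g x"] by linarith
  hence "Inf S * norm (x - y) \<le> lip_norm g * norm (x - y)" by (intro mult_right_mono) (auto simp: ln)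
  thus "norm (g x - g y) \<le> lip_norm g * norm (x - y)" using inf[of x y] by linarith
qed

text \<open>Vanishing outside the support and on its frontier amounts to vanishing outside the interior.\<close>

lemma (in self_similar_substitution) spectral_profile_of_cylindrical:
  assumes inv: "invariant_probability T \<zeta> L \<mu>" and sq: "square_integrable \<mu> f"
    and cyl: "cylindrical T \<mu> f \<psi>" and lip: "\<forall>i. \<exists>C. C-lipschitz_on UNIV (\<psi> i)"
    and mean: "(LINT X|\<mu>. f X) = 0" and spec: "spectral_measure \<mu> f \<sigma>"
  shows "spectral_profile T \<zeta> L c \<psi> (cyl_lip_norm \<psi>) f \<mu> \<sigma>"
proof -
  let ?M = "cyl_lip_norm \<psi>"
  have prob: "prob_space \<mu>" and space: "space \<mu> = tiling_space T \<zeta> L"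
    and meas: "\<And>s. action s \<in> measurable \<mu> \<mu>" and distr: "\<And>s. distr \<mu> \<mu> (action s) = \<mu>"
    using inv by (auto simp: invariant_probability_def)
  have out: "\<psi> i x = 0" if "x \<notin> interior (supp i)" for i x
  proof (cases "x \<in> supp i")
    case True
    hence "x \<in> frontier (supp i)"
      using that compact_imp_closed[OF compact_supp, of i] by (simp add: frontier_def)
    thus ?thesis using cyl by (simp add: cylindrical_def)
  qed (use cyl in \<open>simp add: cylindrical_def\<close>)
  have le: "lip_norm (\<psi> i) \<le> ?M" for i unfolding cyl_lip_norm_def by (intro Max_ge) auto
  have b: "norm (\<psi> i x) \<le> ?M" "norm (\<psi> i x - \<psi> i y) \<le> ?M * norm (x - y)" for i x y
  proof -
    obtain C where C: "C-lipschitz_on UNIV (\<psi> i)" using lip by blast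
    have z: "\<And>x. x \<notin> supp i \<Longrightarrow> \<psi> i x = 0" using out interior_subset by blast
    have lb: "norm (\<psi> i x) \<le> lip_norm (\<psi> i)" "norm (\<psi> i x - \<psi> i y) \<le> lip_norm (\<psi> i) * norm (x - y)"
      using lip_norm_bounds[OF C compact_supp[of i]] z by blast+
    show "norm (\<psi> i x) \<le> ?M" using lb(1) le[of i] by linarith
    have "lip_norm (\<psi> i) * norm (x - y) \<le> ?M * norm (x - y)" using le by (intro mult_right_mono) auto
    thus "norm (\<psi> i x - \<psi> i y) \<le> ?M * norm (x - y)" using lb(2) by linarith
  qed
  have cont: "continuous_on UNIV (\<psi> i)" for i
    using lip lipschitz_on_continuous_on by blast
  interpret P: tile_profile T \<zeta> L c \<psi> ?M
    by unfold_locales (fact b(1) out cont)+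
  interpret P: cylindrical_profile T \<zeta> L c \<psi> ?M f ?M
  proof unfold_locales
    show "f X = \<psi> i s" if "X \<in> tiling_space T \<zeta> L" "shift (- s) (T i) \<in> X" "s \<in> supp i" for X i s
      using cyl that unfolding cylindrical_def space by blast
    show "action s X \<in> tiling_space T \<zeta> L" if "X \<in> tiling_space T \<zeta> L" for X s
      using measurable_space[OF meas, of X s] that by (simp add: space)
  qed (fact b(2))
  interpret P: spectral_setting \<mu> f \<sigma> ?M
    by (rule spectral_setting.intro[OF prob meas distr _ _ spec])
      (use sq P.norm_f_le space in \<open>auto simp: square_integrable_def\<close>)
  show ?thesis by unfold_locales (fact space mean)+
qed

theorem theorem5p3:
  fixes T :: "'m::finite \<Rightarrow> 'd::finite tile"
    and \<zeta> :: "'m \<Rightarrow> 'd tile set"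
    and L :: "real^'d \<Rightarrow> real^'d"
  assumes "alphabet T"
    and "substitution T \<zeta> L"
    and "\<forall>X\<in>tiling_space T \<zeta> L. finite_local_complexity X"
    and "\<forall>x\<in>complex_eigenvalues L. algebraic_int x"
    and "primitive_matrix (substitution_matrix T \<zeta>)"
    and "aperiodic T \<zeta> L"
    and "self_similar T \<zeta> L"
    and "strongly_totally_non_pisot (complex_eigenvalues L)"
  shows "\<exists>r0>0. \<exists>c>0. \<exists>\<gamma>>0. \<forall>\<mu> f \<psi> \<sigma> (\<omega> :: real^'d).
    invariant_probability T \<zeta> L \<mu> \<and>
    square_integrable \<mu> f \<and>
    cylindrical T \<mu> f \<psi> \<and> (\<forall>i. \<exists>C. C-lipschitz_on UNIV (\<psi> i)) \<and>
    (LINT X|\<mu>. f X) = 0 \<and>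
    spectral_measure \<mu> f \<sigma> \<longrightarrow>
      (\<forall>r. 0 < r \<and> r < r0 \<longrightarrow>
         measure \<sigma> (cube \<omega> r) \<le> c * (cyl_lip_norm \<psi>)\<^sup>2 * ln (1 / r) powr (- \<gamma>))"
proof -
  obtain c0 where c0: "c0 > 1" "\<And>x. norm (L x) = c0 * norm x"
    using assms(7) by (auto simp: self_similar_def)
  interpret self_similar_substitution T \<zeta> L c0
    by unfold_locales (use assms(1,2,5) c0 in auto)
  obtain A1 g where A1: "A1 > 0" "g > 0" and mid: "\<forall>\<^sub>F H in at_top. \<forall>\<psi> M f \<mu> \<sigma> \<omega>. spectral_profile T \<zeta> L c0 \<psi> M f \<mu> \<sigma> \<longrightarrow>
     exp (- H / 4) \<le> norm \<omega> \<longrightarrow> norm \<omega> \<le> real CARD('d) * H \<longrightarrow>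
     measure \<sigma> (cube \<omega> (exp (- H))) \<le> A1 * M\<^sup>2 * H powr (- g)"
    using middle_frequencies[OF assms(8)] by blast
  obtain A2 where A2: "A2 > 0" and small: "\<forall>\<^sub>F H in at_top. \<forall>\<psi> M f \<mu> \<sigma> \<omega>. spectral_profile T \<zeta> L c0 \<psi> M f \<mu> \<sigma> \<longrightarrow>
     norm \<omega> \<le> exp (- H / 4) \<longrightarrow> measure \<sigma> (cube \<omega> (exp (- H))) \<le> A2 * M\<^sup>2 * H powr (- 2)"
    using small_frequencies by blast
  obtain H0 where H0: "\<And>H \<psi> M f \<mu> \<sigma> \<omega>. H \<ge> H0 \<Longrightarrow> spectral_profile T \<zeta> L c0 \<psi> M f \<mu> \<sigma> \<Longrightarrow>
       exp (- H / 4) \<le> norm \<omega> \<Longrightarrow> norm \<omega> \<le> real CARD('d) * H \<Longrightarrow>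
       measure \<sigma> (cube \<omega> (exp (- H))) \<le> A1 * M\<^sup>2 * H powr (- g)"
    "\<And>H \<psi> M f \<mu> \<sigma> \<omega>. H \<ge> H0 \<Longrightarrow> spectral_profile T \<zeta> L c0 \<psi> M f \<mu> \<sigma> \<Longrightarrow>
       norm \<omega> \<le> exp (- H / 4) \<Longrightarrow> measure \<sigma> (cube \<omega> (exp (- H))) \<le> A2 * M\<^sup>2 * H powr (- 2)"
  proof -
    from eventually_conj[OF mid small] obtain H0 where "\<forall>H\<ge>H0. (\<forall>\<psi> M f \<mu> \<sigma> \<omega>. spectral_profile T \<zeta> L c0 \<psi> M f \<mu> \<sigma> \<longrightarrow>
       exp (- H / 4) \<le> norm \<omega> \<longrightarrow> norm \<omega> \<le> real CARD('d) * H \<longrightarrow>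
       measure \<sigma> (cube \<omega> (exp (- H))) \<le> A1 * M\<^sup>2 * H powr (- g)) \<and> (\<forall>\<psi> M f \<mu> \<sigma> \<omega>. spectral_profile T \<zeta> L c0 \<psi> M f \<mu> \<sigma> \<longrightarrow>
       norm \<omega> \<le> exp (- H / 4) \<longrightarrow> measure \<sigma> (cube \<omega> (exp (- H))) \<le> A2 * M\<^sup>2 * H powr (- 2))"
      unfolding eventually_at_top_linorder by blast
    thus thesis by (intro that[of H0]) simp_all
  qed
  define A where "A = A1 + A2 + 1"
  define \<gamma> where "\<gamma> = min g 2"
  have \<gamma>: "\<gamma> > 0" using A1 by (simp add: \<gamma>_def)
  have bound: "measure \<sigma> (cube \<omega> (exp (- H))) \<le> A * M\<^sup>2 * H powr (- \<gamma>)"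
    if sp: "spectral_profile T \<zeta> L c0 \<psi> M f \<mu> \<sigma>" and H: "H \<ge> H0" "H \<ge> 2" for \<psi> M f \<mu> \<sigma> \<omega> H
  proof -
    have weaken: "a * M\<^sup>2 * H powr (- t) \<le> A * M\<^sup>2 * H powr (- \<gamma>)" if "0 \<le> a" "a \<le> A" "\<gamma> \<le> t" for a t
      using that H by (intro mult_mono powr_mono) auto
    show ?thesis
    proof (cases "\<exists>i. H \<le> \<bar>\<omega> $ i\<bar>")
      case True
      then obtain i where "H \<le> \<bar>\<omega> $ i\<bar>" by blast
      hence "measure \<sigma> (cube \<omega> (exp (- H))) \<le> 1 * M\<^sup>2 * H powr (- 2)"
        using large_frequencies[OF sp H(2)] by simp
      also have "\<dots> \<le> A * M\<^sup>2 * H powr (- \<gamma>)" using A1 A2 by (intro weaken) (auto simp: A_def \<gamma>_def)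
      finally show ?thesis .
    next
      case False
      have "norm \<omega> \<le> (\<Sum>i\<in>UNIV. \<bar>\<omega> $ i\<bar>)" by (rule norm_le_l1_cart)
      also have "\<dots> \<le> (\<Sum>i\<in>(UNIV :: 'd set). H)" using False by (intro sum_mono) (auto simp: not_le less_imp_le)
      finally have no: "norm \<omega> \<le> real CARD('d) * H" by simp
      show ?thesis
      proof (cases "norm \<omega> \<le> exp (- H / 4)")
        case True
        have "measure \<sigma> (cube \<omega> (exp (- H))) \<le> A2 * M\<^sup>2 * H powr (- 2)" by (rule H0(2)[OF H(1) sp True])
        also have "\<dots> \<le> A * M\<^sup>2 * H powr (- \<gamma>)" using A1 A2 by (intro weaken) (auto simp: A_def \<gamma>_def)
        finally show ?thesis .
      next
        case False
        hence "exp (- H / 4) \<le> norm \<omega>" by simp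
        hence "measure \<sigma> (cube \<omega> (exp (- H))) \<le> A1 * M\<^sup>2 * H powr (- g)" by (rule H0(1)[OF H(1) sp _ no])
        also have "\<dots> \<le> A * M\<^sup>2 * H powr (- \<gamma>)" using A1 A2 by (intro weaken) (auto simp: A_def \<gamma>_def)
        finally show ?thesis .
      qed
    qed
  qed
  define r0 where "r0 = exp (- (max H0 2))"
  have A0: "A > 0" using A1 A2 by (simp add: A_def)
  have main: "measure \<sigma> (cube \<omega> r) \<le> A * (cyl_lip_norm \<psi>)\<^sup>2 * ln (1 / r) powr (- \<gamma>)"
    if hyp: "invariant_probability T \<zeta> L \<mu> \<and> square_integrable \<mu> f \<and> cylindrical T \<mu> f \<psi> \<and>
        (\<forall>i. \<exists>C. C-lipschitz_on UNIV (\<psi> i)) \<and> (LINT X|\<mu>. f X) = 0 \<and> spectral_measure \<mu> f \<sigma>"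
      and r: "0 < r" "r < r0" for \<mu> f \<psi> \<sigma> r and \<omega> :: "real^'d"
  proof -
    define H where "H = ln (1 / r)"
    have rH: "r = exp (- H)" using r by (simp add: H_def ln_div)
    have "- H \<le> - (max H0 2)" using r(2) unfolding rH r0_def by simp
    hence H: "H \<ge> H0" "H \<ge> 2" by simp_all
    have "spectral_profile T \<zeta> L c0 \<psi> (cyl_lip_norm \<psi>) f \<mu> \<sigma>"
      using hyp by (intro spectral_profile_of_cylindrical) auto
    from bound[OF this H, of \<omega>] show ?thesis by (simp only: rH[symmetric] H_def[symmetric])
  qed
  have r00: "r0 > 0" by (simp add: r0_def)
  show ?thesis
    by (rule exI[of _ r0], rule conjI[OF r00], rule exI[of _ A], rule conjI[OF A0],
        rule exI[of _ \<gamma>], rule conjI[OF \<gamma>], intro allI impI, elim conjE, rule main) auto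
qed

end
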